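(* Let $H$ be a Hopf algebra over a commutative ring $k$, let $\delta: H\to k$ be a character and $\sigma\in H$ a grouplike element. If $(\delta,\sigma)$ is a modular pair in involution, then $\widetilde{H}^{(\delta,\sigma)}$, with the face operators $d_i$, degeneracy operators $s_i$ and cyclic operators $\tau_n$ given in the context, is a cyclic module. Conversely, if $\delta(\sigma)=1$ and $\widetilde{H}^{(\delta,\sigma)}$ with these operators is a cyclic module, then $(\delta,\sigma)$ is a modular pair in involution.
   Context: $k$ is a commutative ring, $\otimes=\otimes_k$, and $(H,\mu,\eta,\Delta,\varepsilon,S)$ is a Hopf algebra over $k$ with antipode $S$. Sweedler notation: $\Delta(h)=\sum h^{(1)}\otimes h^{(2)}$. A grouplike element $\sigma$ satisfies $\Delta(\sigma)=\sigma\otimes\sigma$, $\varepsilon(\sigma)=1$; a character is a unital $k$-algebra homomorphism $\delta:H\to k$. Put $S_\sigma(h)=\sigma S(h)$ and $\widetilde S_\sigma(h)=\sigma\sum\delta(h^{(2)})S(h^{(1)})$. The pair $(\delta,\sigma)$ is a modular pair if $\delta(\sigma)=1$, and a modular pair in involution if moreover $\widetilde S_\sigma^2=\mathrm{id}_H$. Define $\widetilde{H}^{(\delta,\sigma)}_n=H^{\otimes n}$ for $n\ge1$ and $\widetilde{H}^{(\delta,\sigma)}_0=k$, with operators $d_0(h_1\otimes\dots\otimes h_n)=\varepsilon(h_1)h_2\otimes\dots\otimes h_n$; $d_i(h_1\otimes\dots\otimes h_n)=h_1\otimes\dots\otimes h_ih_{i+1}\otimes\dots\otimes h_n$ for $1\le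 i\le n-1$; $d_n(h_1\otimes\dots\otimes h_n)=\delta(h_n)h_1\otimes\dots\otimes h_{n-1}$; $s_0(h_1\otimes\dots\otimes h_n)=1\otimes h_1\otimes\dots\otimes h_n$; $s_i(h_1\otimes\dots\otimes h_n)=h_1\otimes\dots\otimes h_i\otimes1\otimes h_{i+1}\otimes\dots\otimes h_n$ for $1\le i\le n-1$; $s_n(h_1\otimes\dots\otimes h_n)=h_1\otimes\dots\otimes h_n\otimes1$; $\tau_n(h_1\otimes\dots\otimes h_n)=\sum\delta(h_n^{(2)})\,S_\sigma(h_1^{(1)}h_2^{(1)}\cdots h_n^{(1)})\otimes h_1^{(2)}\otimes\dots\otimes h_{n-1}^{(2)}$. (For $n=1$: $d_0=\varepsilon$, $d_1=\delta$; in degree $0$: $s_0(1)=1$, $\tau_0=\mathrm{id}$.) A cyclic module is a simplicial $k$-module with operators $\tau_n$ in each degree $n$ satisfying $\tau_n^{n+1}=\mathrm{id}$, $d_i\tau_n=\tau_{n-1}d_{i-1}$ and $s_i\tau_n=\tau_{n+1}s_{i-1}$ for $1\le i\le n$, $d_0\tau_n=d_n$, and $s_0\tau_n=\tau_{n+1}^2s_n$. *)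

theory Defs
  imports "HOL-Algebra.Module" "HOL-Algebra.AbelCoset" "HOL-Algebra.RingHom"
begin

section \<open>Linear maps, free modules and quotient modules\<close>

definition linear_maps ::
  "('k, 'a) ring_scheme \<Rightarrow> ('k, 'm, 'b) module_scheme \<Rightarrow> ('k, 'n, 'c) module_scheme \<Rightarrow> ('m \<Rightarrow> 'n) set"
  where "linear_maps k M N =
    {f \<in> carrier M \<rightarrow> carrier N.
       (\<forall>x\<in>carrier M. \<forall>y\<in>carrier M. f (x \<oplus>\<^bsub>M\<^esub> y) = f x \<oplus>\<^bsub>N\<^esub> f y) \<and>
       (\<forall>r\<in>carrier k. \<forall>x\<in>carrier M. f (r \<odot>\<^bsub>M\<^esub> x) = r \<odot>\<^bsub>N\<^esub> f x)}"

text \<open>The module structures below carry no multiplication, so the fields \<open>mult\<close> and \<open>one\<close>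
  of the record are left unspecified.\<close>

definition free_module :: "('k, 'a) ring_scheme \<Rightarrow> 'x set \<Rightarrow> ('k, 'x \<Rightarrow> 'k) module"
  where "free_module k B =
    \<lparr>carrier = {p. (\<forall>x. p x \<in> carrier k) \<and> finite {x. p x \<noteq> \<zero>\<^bsub>k\<^esub>} \<and> {x. p x \<noteq> \<zero>\<^bsub>k\<^esub>} \<subseteq> B},
     mult = undefined, one = undefined,
     zero = (\<lambda>x. \<zero>\<^bsub>k\<^esub>), add = (\<lambda>p q x. p x \<oplus>\<^bsub>k\<^esub> q x),
     smult = (\<lambda>r p x. r \<otimes>\<^bsub>k\<^esub> p x)\<rparr>"

definition basis_vector :: "('k, 'a) ring_scheme \<Rightarrow> 'x \<Rightarrow> 'x \<Rightarrow> 'k"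
  where "basis_vector k b = (\<lambda>x. if x = b then \<one>\<^bsub>k\<^esub> else \<zero>\<^bsub>k\<^esub>)"

definition submodule_span :: "('k, 'a) ring_scheme \<Rightarrow> ('k, 'm, 'b) module_scheme \<Rightarrow> 'm set \<Rightarrow> 'm set"
  where "submodule_span k M A = \<Inter>{N. submodule N k M \<and> A \<subseteq> N}"

definition quotient_module :: "('k, 'm, 'b) module_scheme \<Rightarrow> 'm set \<Rightarrow> ('k, 'm set) module"
  where "quotient_module M N =
    \<lparr>carrier = a_rcosets\<^bsub>M\<^esub> N, mult = undefined, one = undefined,
     zero = N, add = set_add M,
     smult = (\<lambda>r C. \<Union>c\<in>C. N +>\<^bsub>M\<^esub> (r \<odot>\<^bsub>M\<^esub> c))\<rparr>"


section \<open>Tensor powers of a module\<close>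

text \<open>The \<open>n\<close>-th tensor power of \<open>H\<close> is the free module on the words of length \<open>n\<close> over \<open>H\<close>,
  modulo the relations expressing multilinearity. The 0-th power is the free module of
  rank one on the empty word, which is identified with the ground ring (\<open>tensor_power_0\<close>).\<close>

definition words :: "('k, 'h, 'b) module_scheme \<Rightarrow> nat \<Rightarrow> 'h list set"
  where "words H n = {xs. length xs = n \<and> set xs \<subseteq> carrier H}"

abbreviation free_words ::
  "('k, 'a) ring_scheme \<Rightarrow> ('k, 'h, 'b) module_scheme \<Rightarrow> nat \<Rightarrow> ('k, 'h list \<Rightarrow> 'k) module"
  where "free_words k H n \<equiv> free_module k (words H n)"

definition tensor_relators ::
  "('k, 'a) ring_scheme \<Rightarrow> ('k, 'h, 'b) module_scheme \<Rightarrow> nat \<Rightarrow> ('h list \<Rightarrow> 'k) set"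
  where "tensor_relators k H n =
    {basis_vector k (us @ [x \<oplus>\<^bsub>H\<^esub> y] @ vs)
        \<ominus>\<^bsub>free_words k H n\<^esub> (basis_vector k (us @ [x] @ vs)
                        \<oplus>\<^bsub>free_words k H n\<^esub> basis_vector k (us @ [y] @ vs)) | us x y vs.
      us @ [x] @ vs \<in> words H n \<and> y \<in> carrier H} \<union>
    {basis_vector k (us @ [r \<odot>\<^bsub>H\<^esub> x] @ vs)
        \<ominus>\<^bsub>free_words k H n\<^esub> (r \<odot>\<^bsub>free_words k H n\<^esub> basis_vector k (us @ [x] @ vs)) | us r x vs.
      us @ [x] @ vs \<in> words H n \<and> r \<in> carrier k}"

definition tensor_null ::
  "('k, 'a) ring_scheme \<Rightarrow> ('k, 'h, 'b) module_scheme \<Rightarrow> nat \<Rightarrow> ('h list \<Rightarrow> 'k) set"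
  where "tensor_null k H n = submodule_span k (free_words k H n) (tensor_relators k H n)"

definition tensor_power ::
  "('k, 'a) ring_scheme \<Rightarrow> ('k, 'h, 'b) module_scheme \<Rightarrow> nat \<Rightarrow> ('k, ('h list \<Rightarrow> 'k) set) module"
  where "tensor_power k H n = quotient_module (free_words k H n) (tensor_null k H n)"

text \<open>\<open>pure_tensor k H [h\<^sub>1, \<dots>, h\<^sub>n]\<close> is \<open>h\<^sub>1 \<otimes> \<dots> \<otimes> h\<^sub>n\<close>.\<close>

definition pure_tensor ::
  "('k, 'a) ring_scheme \<Rightarrow> ('k, 'h, 'b) module_scheme \<Rightarrow> 'h list \<Rightarrow> ('h list \<Rightarrow> 'k) set"
  where "pure_tensor k H xs =
    tensor_null k H (length xs) +>\<^bsub>free_words k H (length xs)\<^esub> basis_vector k xs"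

definition multilinear_maps ::
  "('k, 'a) ring_scheme \<Rightarrow> ('k, 'h, 'b) module_scheme \<Rightarrow> nat \<Rightarrow> ('k, 'm, 'c) module_scheme
     \<Rightarrow> ('h list \<Rightarrow> 'm) set"
  where "multilinear_maps k H n M =
    {f \<in> words H n \<rightarrow> carrier M.
       (\<forall>us x y vs. us @ [x] @ vs \<in> words H n \<and> y \<in> carrier H \<longrightarrow>
          f (us @ [x \<oplus>\<^bsub>H\<^esub> y] @ vs) = f (us @ [x] @ vs) \<oplus>\<^bsub>M\<^esub> f (us @ [y] @ vs)) \<and>
       (\<forall>us r x vs. us @ [x] @ vs \<in> words H n \<and> r \<in> carrier k \<longrightarrow>
          f (us @ [r \<odot>\<^bsub>H\<^esub> x] @ vs) = r \<odot>\<^bsub>M\<^esub> f (us @ [x] @ vs))}"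

text \<open>The linear map out of a tensor power that sends \<open>h\<^sub>1 \<otimes> \<dots> \<otimes> h\<^sub>n\<close> to \<open>f [h\<^sub>1, \<dots>, h\<^sub>n]\<close>,
  computed on an arbitrary representing formal linear combination of words. For multilinear \<open>f\<close>
  the choice is immaterial; see \<open>tensor_lift_linear\<close>, \<open>tensor_lift_pure\<close> and
  \<open>tensor_lift_unique\<close> below.\<close>

definition tensor_lift ::
  "('k, 'a) ring_scheme \<Rightarrow> ('k, 'm, 'c) module_scheme \<Rightarrow> ('h list \<Rightarrow> 'm) \<Rightarrow> ('h list \<Rightarrow> 'k) set \<Rightarrow> 'm"
  where "tensor_lift k M f t =
    (let p = (SOME p. p \<in> t) in \<Oplus>\<^bsub>M\<^esub>xs\<in>{xs. p xs \<noteq> \<zero>\<^bsub>k\<^esub>}. p xs \<odot>\<^bsub>M\<^esub> f xs)"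

text \<open>The canonical map from the product of the \<open>m\<close>-th and the \<open>(n - m)\<close>-th tensor power
  to the \<open>n\<close>-th one; the argument \<open>n\<close> is the total degree.\<close>

definition tensor_append ::
  "('k, 'a) ring_scheme \<Rightarrow> ('k, 'h, 'b) module_scheme \<Rightarrow> nat
     \<Rightarrow> ('h list \<Rightarrow> 'k) set \<Rightarrow> ('h list \<Rightarrow> 'k) set \<Rightarrow> ('h list \<Rightarrow> 'k) set"
  where "tensor_append k H n t u =
    tensor_lift k (tensor_power k H n)
      (\<lambda>xs. tensor_lift k (tensor_power k H n) (\<lambda>ys. pure_tensor k H (xs @ ys)) u) t"

text \<open>The product \<open>(a \<otimes> b)(c \<otimes> d) = ac \<otimes> bd\<close> on \<open>H \<otimes> H\<close>.\<close>

definition tensor_square_mult ::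
  "('k, 'a) ring_scheme \<Rightarrow> ('k, 'h, 'b) module_scheme
     \<Rightarrow> ('h list \<Rightarrow> 'k) set \<Rightarrow> ('h list \<Rightarrow> 'k) set \<Rightarrow> ('h list \<Rightarrow> 'k) set"
  where "tensor_square_mult k H t u =
    tensor_lift k (tensor_power k H 2)
      (\<lambda>xs. tensor_lift k (tensor_power k H 2)
        (\<lambda>ys. pure_tensor k H [xs ! 0 \<otimes>\<^bsub>H\<^esub> ys ! 0, xs ! 1 \<otimes>\<^bsub>H\<^esub> ys ! 1]) u) t"


section \<open>The universal property of tensor powers\<close>

lemma free_module_module:
  assumes "cring k"
  shows "module k (free_module k B)"
proof -
  interpret k: cring k by fact
  have supp_add: "finite {x. p x \<oplus>\<^bsub>k\<^esub> q x \<noteq> \<zero>\<^bsub>k\<^esub>} \<and> {x. p x \<oplus>\<^bsub>k\<^esub> q x \<noteq> \<zero>\<^bsub>k\<^esub>} \<subseteq> B"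
    if "p \<in> carrier (free_module k B)" "q \<in> carrier (free_module k B)" for p q
  proof -
    have "{x. p x \<oplus>\<^bsub>k\<^esub> q x \<noteq> \<zero>\<^bsub>k\<^esub>} \<subseteq> {x. p x \<noteq> \<zero>\<^bsub>k\<^esub>} \<union> {x. q x \<noteq> \<zero>\<^bsub>k\<^esub>}"
      using that by auto
    then show ?thesis
      using that by (auto simp: free_module_def intro: finite_subset)
  qed
  have supp_smult: "finite {x. r \<otimes>\<^bsub>k\<^esub> p x \<noteq> \<zero>\<^bsub>k\<^esub>} \<and> {x. r \<otimes>\<^bsub>k\<^esub> p x \<noteq> \<zero>\<^bsub>k\<^esub>} \<subseteq> B"
    if "p \<in> carrier (free_module k B)" "r \<in> carrier k" for p r
  proof -
    have "{x. r \<otimes>\<^bsub>k\<^esub> p x \<noteq> \<zero>\<^bsub>k\<^esub>} \<subseteq> {x. p x \<noteq> \<zero>\<^bsub>k\<^esub>}"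
      using that by auto
    then show ?thesis
      using that by (auto simp: free_module_def intro: finite_subset)
  qed
  show ?thesis
  proof (rule moduleI)
    show "abelian_group (free_module k B)"
    proof (rule abelian_groupI)
      fix p assume p: "p \<in> carrier (free_module k B)"
      show "\<exists>q\<in>carrier (free_module k B). q \<oplus>\<^bsub>free_module k B\<^esub> p = \<zero>\<^bsub>free_module k B\<^esub>"
      proof (rule bexI[of _ "\<lambda>x. \<ominus>\<^bsub>k\<^esub> \<one>\<^bsub>k\<^esub> \<otimes>\<^bsub>k\<^esub> p x"])
        have "\<ominus>\<^bsub>k\<^esub> \<one>\<^bsub>k\<^esub> \<otimes>\<^bsub>k\<^esub> p x \<oplus>\<^bsub>k\<^esub> p x = \<zero>\<^bsub>k\<^esub>" for x
          using p by (simp add: free_module_def k.l_minus k.l_neg)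
        then show "(\<lambda>x. \<ominus>\<^bsub>k\<^esub> \<one>\<^bsub>k\<^esub> \<otimes>\<^bsub>k\<^esub> p x) \<oplus>\<^bsub>free_module k B\<^esub> p = \<zero>\<^bsub>free_module k B\<^esub>"
          by (simp add: free_module_def)
        show "(\<lambda>x. \<ominus>\<^bsub>k\<^esub> \<one>\<^bsub>k\<^esub> \<otimes>\<^bsub>k\<^esub> p x) \<in> carrier (free_module k B)"
          using supp_smult[OF p, of "\<ominus>\<^bsub>k\<^esub> \<one>\<^bsub>k\<^esub>"] p by (simp add: free_module_def)
      qed
    qed (use supp_add in \<open>auto simp: free_module_def k.a_ac fun_eq_iff\<close>)
  qed (use supp_smult in \<open>auto simp: free_module_def k.l_distr k.r_distr k.m_assoc fun_eq_iff
        intro: assms\<close>)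
qed

lemma basis_vector_closed:
  assumes "cring k" "b \<in> B"
  shows "basis_vector k b \<in> carrier (free_module k B)"
proof -
  interpret k: cring k by fact
  have "{x. basis_vector k b x \<noteq> \<zero>\<^bsub>k\<^esub>} \<subseteq> {b}" by (auto simp: basis_vector_def)
  then show ?thesis
    using assms(2) by (auto simp: free_module_def basis_vector_def dest: finite_subset)
qed

lemma submodule_span_submodule:
  assumes "module k M" "A \<subseteq> carrier M"
  shows "submodule (submodule_span k M A) k M"
proof -
  interpret module k M by fact
  have sub: "submodule (carrier M) k M" by (rule carrier_is_submodule)
  show ?thesis
    unfolding submodule_span_def
  proof (rule submoduleI, goal_cases)
    case 1 then show ?case using sub assms(2) by auto
  next
    case 2 then show ?case
      by (auto simp: submodule_def dest: subgroup.one_closed)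
  qed (auto dest: submoduleE(3,4,5))
qed

lemma submodule_span_superset: "A \<subseteq> submodule_span k M A"
  by (auto simp: submodule_span_def)

lemma submodule_span_least: "\<lbrakk>submodule N k M; A \<subseteq> N\<rbrakk> \<Longrightarrow> submodule_span k M A \<subseteq> N"
  by (auto simp: submodule_span_def)

context
  fixes k :: "('k, 'a) ring_scheme" and M :: "('k, 'm, 'b) module_scheme" and N
  assumes M: "module k M" and N: "submodule N k M"
begin

interpretation module k M by (rule M)

lemma quotient_subgroup: "abelian_subgroup N M"
  using N by (intro abelian_subgroupI3 additive_subgroup.intro)
    (auto simp: submodule_def abelian_group_axioms)

interpretation N: abelian_subgroup N M by (rule quotient_subgroup)

lemma quotient_carrier:
  "carrier (quotient_module M N) = (\<lambda>x. N +>\<^bsub>M\<^esub> x) ` carrier M"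
  by (auto simp: quotient_module_def A_RCOSETS_defs a_r_coset_def r_coset_def)

lemma quotient_zero: "\<zero>\<^bsub>quotient_module M N\<^esub> = N"
  by (simp add: quotient_module_def)

lemma quotient_add:
  "\<lbrakk>x \<in> carrier M; y \<in> carrier M\<rbrakk> \<Longrightarrow>
    (N +>\<^bsub>M\<^esub> x) \<oplus>\<^bsub>quotient_module M N\<^esub> (N +>\<^bsub>M\<^esub> y) = N +>\<^bsub>M\<^esub> (x \<oplus>\<^bsub>M\<^esub> y)"
  by (simp add: quotient_module_def N.a_rcos_sum)

lemma quotient_eq_iff:
  assumes "x \<in> carrier M" "y \<in> carrier M"
  shows "N +>\<^bsub>M\<^esub> x = N +>\<^bsub>M\<^esub> y \<longleftrightarrow> x \<ominus>\<^bsub>M\<^esub> y \<in> N"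
proof
  assume "N +>\<^bsub>M\<^esub> x = N +>\<^bsub>M\<^esub> y"
  then have "x \<in> N +>\<^bsub>M\<^esub> y" using N.a_rcos_self[OF assms(1)] by simp
  then show "x \<ominus>\<^bsub>M\<^esub> y \<in> N"
    unfolding a_minus_def by (rule N.a_rcos_module_imp[OF assms(2)])
next
  assume "x \<ominus>\<^bsub>M\<^esub> y \<in> N"
  then have "x \<in> N +>\<^bsub>M\<^esub> y"
    unfolding a_minus_def by (rule N.a_rcos_module_rev[OF assms(2,1)])
  then show "N +>\<^bsub>M\<^esub> x = N +>\<^bsub>M\<^esub> y"
    using a_repr_independence[OF _ assms(2) N.a_subgroup] by simp
qed

lemma quotient_smult:
  assumes r: "r \<in> carrier k" and x: "x \<in> carrier M"
  shows "r \<odot>\<^bsub>quotient_module M N\<^esub> (N +>\<^bsub>M\<^esub> x) = N +>\<^bsub>M\<^esub> (r \<odot>\<^bsub>M\<^esub> x)"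
proof -
  have "N +>\<^bsub>M\<^esub> (r \<odot>\<^bsub>M\<^esub> c) = N +>\<^bsub>M\<^esub> (r \<odot>\<^bsub>M\<^esub> x)" if "c \<in> N +>\<^bsub>M\<^esub> x" for c
  proof -
    from that obtain n where n: "n \<in> N" "c = n \<oplus>\<^bsub>M\<^esub> x"
      by (auto simp: a_r_coset_def r_coset_def)
    have nM: "n \<in> carrier M" using n(1) N.a_subset by auto
    have "r \<odot>\<^bsub>M\<^esub> c = r \<odot>\<^bsub>M\<^esub> n \<oplus>\<^bsub>M\<^esub> r \<odot>\<^bsub>M\<^esub> x"
      using n nM x r by (simp add: smult_r_distr)
    moreover have "r \<odot>\<^bsub>M\<^esub> n \<in> N" by (rule submodule.smult_closed[OF N r n(1)])
    ultimately have "r \<odot>\<^bsub>M\<^esub> c \<in> N +>\<^bsub>M\<^esub> (r \<odot>\<^bsub>M\<^esub> x)"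
      by (auto simp: a_r_coset_def r_coset_def)
    then show ?thesis
      using a_repr_independence[OF _ smult_closed[OF r x] N.a_subgroup] by simp
  qed
  then have "(\<Union>c\<in>N +>\<^bsub>M\<^esub> x. N +>\<^bsub>M\<^esub> (r \<odot>\<^bsub>M\<^esub> c)) = (\<Union>c\<in>N +>\<^bsub>M\<^esub> x. N +>\<^bsub>M\<^esub> (r \<odot>\<^bsub>M\<^esub> x))"
    by (rule SUP_cong[OF refl])
  also have "\<dots> = N +>\<^bsub>M\<^esub> (r \<odot>\<^bsub>M\<^esub> x)"
    by (rule SUP_const) (use N.a_rcos_self[OF x] in blast)
  finally show ?thesis by (simp add: quotient_module_def)
qed

lemma quotient_module_module: "module k (quotient_module M N)"
proof (rule moduleI)
  show "abelian_group (quotient_module M N)"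
  proof (rule abelian_groupI)
    fix C assume "C \<in> carrier (quotient_module M N)"
    then obtain x where x: "x \<in> carrier M" "C = N +>\<^bsub>M\<^esub> x" by (auto simp: quotient_carrier)
    then have "(N +>\<^bsub>M\<^esub> (\<ominus>\<^bsub>M\<^esub> x)) \<oplus>\<^bsub>quotient_module M N\<^esub> C = N +>\<^bsub>M\<^esub> \<zero>\<^bsub>M\<^esub>"
      by (simp add: quotient_add M.l_neg)
    then show "\<exists>D\<in>carrier (quotient_module M N).
        D \<oplus>\<^bsub>quotient_module M N\<^esub> C = \<zero>\<^bsub>quotient_module M N\<^esub>"
      using x by (intro bexI[of _ "N +>\<^bsub>M\<^esub> (\<ominus>\<^bsub>M\<^esub> x)"])
        (auto simp: quotient_carrier quotient_zero N.a_subset)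
    show "\<zero>\<^bsub>quotient_module M N\<^esub> \<oplus>\<^bsub>quotient_module M N\<^esub> C = C"
      using x quotient_add[of "\<zero>\<^bsub>M\<^esub>" x] by (simp add: quotient_zero N.a_subset)
  next
    have "N = N +>\<^bsub>M\<^esub> \<zero>\<^bsub>M\<^esub>" by (simp add: N.a_subset)
    then show "\<zero>\<^bsub>quotient_module M N\<^esub> \<in> carrier (quotient_module M N)"
      by (auto simp: quotient_carrier quotient_zero)
  qed (auto simp: quotient_carrier quotient_add M.a_ac)
next
  fix a b C D
  assume ab: "a \<in> carrier k" "b \<in> carrier k"
    and "C \<in> carrier (quotient_module M N)" "D \<in> carrier (quotient_module M N)"
  then obtain x y where xy: "x \<in> carrier M" "C = N +>\<^bsub>M\<^esub> x" "y \<in> carrier M" "D = N +>\<^bsub>M\<^esub> y"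
    by (auto simp: quotient_carrier)
  let ?Q = "quotient_module M N"
  show "(a \<oplus>\<^bsub>k\<^esub> b) \<odot>\<^bsub>?Q\<^esub> C = a \<odot>\<^bsub>?Q\<^esub> C \<oplus>\<^bsub>?Q\<^esub> b \<odot>\<^bsub>?Q\<^esub> C"
    using ab xy by (simp add: quotient_add quotient_smult smult_l_distr)
  show "a \<odot>\<^bsub>?Q\<^esub> (C \<oplus>\<^bsub>?Q\<^esub> D) = a \<odot>\<^bsub>?Q\<^esub> C \<oplus>\<^bsub>?Q\<^esub> a \<odot>\<^bsub>?Q\<^esub> D"
    using ab xy by (simp add: quotient_add quotient_smult smult_r_distr)
  show "(a \<otimes>\<^bsub>k\<^esub> b) \<odot>\<^bsub>?Q\<^esub> C = a \<odot>\<^bsub>?Q\<^esub> (b \<odot>\<^bsub>?Q\<^esub> C)"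
    using ab xy by (simp add: quotient_smult smult_assoc1)
  show "a \<odot>\<^bsub>?Q\<^esub> C \<in> carrier ?Q"
    using ab xy by (auto simp: quotient_carrier quotient_smult)
next
  fix C
  assume "C \<in> carrier (quotient_module M N)"
  then obtain x where x: "x \<in> carrier M" "C = N +>\<^bsub>M\<^esub> x"
    by (auto simp: quotient_carrier)
  show "\<one>\<^bsub>k\<^esub> \<odot>\<^bsub>quotient_module M N\<^esub> C = C"
    using x by (simp add: quotient_smult)
qed (rule R.is_cring)

end


lemma linear_mapsI:
  assumes "\<And>x. x \<in> carrier M \<Longrightarrow> f x \<in> carrier N"
    and "\<And>x y. \<lbrakk>x \<in> carrier M; y \<in> carrier M\<rbrakk> \<Longrightarrow> f (x \<oplus>\<^bsub>M\<^esub> y) = f x \<oplus>\<^bsub>N\<^esub> f y"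
    and "\<And>r x. \<lbrakk>r \<in> carrier k; x \<in> carrier M\<rbrakk> \<Longrightarrow> f (r \<odot>\<^bsub>M\<^esub> x) = r \<odot>\<^bsub>N\<^esub> f x"
  shows "f \<in> linear_maps k M N"
  using assms by (auto simp: linear_maps_def)

lemma linear_mapsD:
  assumes "f \<in> linear_maps k M N"
  shows "x \<in> carrier M \<Longrightarrow> f x \<in> carrier N"
    and "\<lbrakk>x \<in> carrier M; y \<in> carrier M\<rbrakk> \<Longrightarrow> f (x \<oplus>\<^bsub>M\<^esub> y) = f x \<oplus>\<^bsub>N\<^esub> f y"
    and "\<lbrakk>r \<in> carrier k; x \<in> carrier M\<rbrakk> \<Longrightarrow> f (r \<odot>\<^bsub>M\<^esub> x) = r \<odot>\<^bsub>N\<^esub> f x"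
  using assms by (auto simp: linear_maps_def)

lemma linear_maps_zero_minus:
  assumes "module k M" "module k N" and f: "f \<in> linear_maps k M N"
  shows "f \<zero>\<^bsub>M\<^esub> = \<zero>\<^bsub>N\<^esub>"
    and "x \<in> carrier M \<Longrightarrow> f (\<ominus>\<^bsub>M\<^esub> x) = \<ominus>\<^bsub>N\<^esub> f x"
proof -
  interpret M: module k M by fact
  interpret N: module k N by fact
  show "f \<zero>\<^bsub>M\<^esub> = \<zero>\<^bsub>N\<^esub>"
    using linear_mapsD(3)[OF f, of "\<zero>\<^bsub>k\<^esub>" "\<zero>\<^bsub>M\<^esub>"] linear_mapsD(1)[OF f, of "\<zero>\<^bsub>M\<^esub>"] by simp
  show "f (\<ominus>\<^bsub>M\<^esub> x) = \<ominus>\<^bsub>N\<^esub> f x" if "x \<in> carrier M"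
    using linear_mapsD(3)[OF f, of "\<ominus>\<^bsub>k\<^esub> \<one>\<^bsub>k\<^esub>" x] linear_mapsD(1)[OF f that] that
    by (simp add: M.smult_l_minus N.smult_l_minus)
qed

lemma linear_maps_kernel_submodule:
  assumes M: "module k M" and N: "module k N" and f: "f \<in> linear_maps k M N"
  shows "submodule {x \<in> carrier M. f x = \<zero>\<^bsub>N\<^esub>} k M"
proof -
  interpret M: module k M by fact
  interpret N: module k N by fact
  show ?thesis
    by (rule M.submoduleI)
      (auto simp: linear_maps_zero_minus[OF M N f] linear_mapsD[OF f])
qed

lemma free_module_ext:
  assumes M: "module k M"
    and f: "f \<in> linear_maps k (free_module k B) M" and g: "g \<in> linear_maps k (free_module k B) M"
    and eq: "\<And>b. b \<in> B \<Longrightarrow> f (basis_vector k b) = g (basis_vector k b)"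
    and p: "p \<in> carrier (free_module k B)"
  shows "f p = g p"
proof -
  interpret M: module k M by fact
  let ?F = "free_module k B"
  have F: "module k ?F" by (rule free_module_module) (rule M.is_cring)
  have "f p = g p" if "finite A" "{x. p x \<noteq> \<zero>\<^bsub>k\<^esub>} \<subseteq> A" "p \<in> carrier ?F" for A p
    using that
  proof (induction A arbitrary: p rule: finite_induct)
    case empty
    then have "p = \<zero>\<^bsub>?F\<^esub>" by (auto simp: free_module_def)
    then show ?case
      using linear_maps_zero_minus(1)[OF F M f] linear_maps_zero_minus(1)[OF F M g] by simp
  next
    case (insert b A)
    show ?case
    proof (cases "p b = \<zero>\<^bsub>k\<^esub>")
      case True
      then show ?thesis using insert.prems by (intro insert.IH) auto
    next
      case False
      then have b: "b \<in> B" and pb: "p b \<in> carrier k"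
        using insert.prems by (auto simp: free_module_def)
      let ?q = "p(b := \<zero>\<^bsub>k\<^esub>)"
      have q: "?q \<in> carrier ?F"
        using insert.prems by (auto simp: free_module_def intro: rev_finite_subset)
      have IH: "f ?q = g ?q"
        using insert.prems(1) by (intro insert.IH[OF _ q]) auto
      have e: "basis_vector k b \<in> carrier ?F"
        using b M.is_cring by (intro basis_vector_closed)
      have "p = ?q \<oplus>\<^bsub>?F\<^esub> (p b \<odot>\<^bsub>?F\<^esub> basis_vector k b)"
        using insert.prems by (auto simp: free_module_def basis_vector_def fun_eq_iff)
      then show ?thesis
        using IH eq[OF b] linear_mapsD[OF f] linear_mapsD[OF g] q e pb
          module.smult_closed[OF F pb e] by metis
    qed
  qed
  then show ?thesis using p by (auto simp: free_module_def)
qed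

definition free_lift ::
  "('k, 'a) ring_scheme \<Rightarrow> ('k, 'm, 'c) module_scheme \<Rightarrow> ('x \<Rightarrow> 'm) \<Rightarrow> ('x \<Rightarrow> 'k) \<Rightarrow> 'm"
  where "free_lift k M f p = (\<Oplus>\<^bsub>M\<^esub>x\<in>{x. p x \<noteq> \<zero>\<^bsub>k\<^esub>}. p x \<odot>\<^bsub>M\<^esub> f x)"

lemma free_lift_superset:
  assumes "module k M" "f \<in> B \<rightarrow> carrier M" "p \<in> carrier (free_module k B)"
    and "finite A" "{x. p x \<noteq> \<zero>\<^bsub>k\<^esub>} \<subseteq> A" "A \<subseteq> B"
  shows "free_lift k M f p = (\<Oplus>\<^bsub>M\<^esub>x\<in>A. p x \<odot>\<^bsub>M\<^esub> f x)"
proof -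
  interpret M: module k M by fact
  show ?thesis
    unfolding free_lift_def
    by (rule M.add.finprod_mono_neutral_cong_left)
      (use assms in \<open>auto simp: free_module_def Pi_iff subset_iff\<close>)
qed

lemma free_lift_linear:
  assumes M: "module k M" and f: "f \<in> B \<rightarrow> carrier M"
  shows "free_lift k M f \<in> linear_maps k (free_module k B) M"
proof (rule linear_mapsI)
  interpret M: module k M by fact
  let ?F = "free_module k B"
  interpret F: module k ?F by (rule free_module_module) (rule M.is_cring)
  fix p assume p: "p \<in> carrier ?F"
  then have p_supp: "finite {x. p x \<noteq> \<zero>\<^bsub>k\<^esub>}" "{x. p x \<noteq> \<zero>\<^bsub>k\<^esub>} \<subseteq> B" and [simp]: "p x \<in> carrier k" for x
    by (auto simp: free_module_def)
  have [simp]: "x \<in> B \<Longrightarrow> f x \<in> carrier M" for x using f by auto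
  show "free_lift k M f p \<in> carrier M"
    unfolding free_lift_def using p_supp by (intro M.finsum_closed) auto
  {
    fix q assume q: "q \<in> carrier ?F"
    then have q_supp: "finite {x. q x \<noteq> \<zero>\<^bsub>k\<^esub>}" "{x. q x \<noteq> \<zero>\<^bsub>k\<^esub>} \<subseteq> B" and [simp]: "q x \<in> carrier k" for x
      by (auto simp: free_module_def)
    let ?A = "{x. p x \<noteq> \<zero>\<^bsub>k\<^esub>} \<union> {x. q x \<noteq> \<zero>\<^bsub>k\<^esub>}"
    have A: "finite ?A" "?A \<subseteq> B" using p_supp q_supp by auto
    have pq: "(p \<oplus>\<^bsub>?F\<^esub> q) x = p x \<oplus>\<^bsub>k\<^esub> q x" for x by (simp add: free_module_def)
    have "free_lift k M f (p \<oplus>\<^bsub>?F\<^esub> q) = (\<Oplus>\<^bsub>M\<^esub>x\<in>?A. (p \<oplus>\<^bsub>?F\<^esub> q) x \<odot>\<^bsub>M\<^esub> f x)"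
      using A p q by (intro free_lift_superset[OF M f]) (auto simp: pq)
    also have "\<dots> = (\<Oplus>\<^bsub>M\<^esub>x\<in>?A. p x \<odot>\<^bsub>M\<^esub> f x \<oplus>\<^bsub>M\<^esub> q x \<odot>\<^bsub>M\<^esub> f x)"
      using A by (intro M.finsum_cong') (auto simp: pq M.smult_l_distr)
    also have "\<dots> = (\<Oplus>\<^bsub>M\<^esub>x\<in>?A. p x \<odot>\<^bsub>M\<^esub> f x) \<oplus>\<^bsub>M\<^esub> (\<Oplus>\<^bsub>M\<^esub>x\<in>?A. q x \<odot>\<^bsub>M\<^esub> f x)"
      using A by (intro M.finsum_addf) auto
    also have "\<dots> = free_lift k M f p \<oplus>\<^bsub>M\<^esub> free_lift k M f q"
      using A p q by (simp add: free_lift_superset[OF M f, of _ ?A])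
    finally show "free_lift k M f (p \<oplus>\<^bsub>?F\<^esub> q) = free_lift k M f p \<oplus>\<^bsub>M\<^esub> free_lift k M f q" .
  }
  fix r assume r: "r \<in> carrier k"
  have rp: "(r \<odot>\<^bsub>?F\<^esub> p) x = r \<otimes>\<^bsub>k\<^esub> p x" for x by (simp add: free_module_def)
  have "free_lift k M f (r \<odot>\<^bsub>?F\<^esub> p) = (\<Oplus>\<^bsub>M\<^esub>x\<in>{x. p x \<noteq> \<zero>\<^bsub>k\<^esub>}. (r \<odot>\<^bsub>?F\<^esub> p) x \<odot>\<^bsub>M\<^esub> f x)"
    using p_supp p r by (intro free_lift_superset[OF M f]) (auto simp: rp)
  also have "\<dots> = (\<Oplus>\<^bsub>M\<^esub>x\<in>{x. p x \<noteq> \<zero>\<^bsub>k\<^esub>}. r \<odot>\<^bsub>M\<^esub> (p x \<odot>\<^bsub>M\<^esub> f x))"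
    using p_supp r by (intro M.finsum_cong') (auto simp: rp M.smult_assoc1)
  also have "\<dots> = r \<odot>\<^bsub>M\<^esub> free_lift k M f p"
    unfolding free_lift_def using p_supp r
    by (intro M.finsum_smult_ldistr[symmetric]) auto
  finally show "free_lift k M f (r \<odot>\<^bsub>?F\<^esub> p) = r \<odot>\<^bsub>M\<^esub> free_lift k M f p" .
qed

lemma free_lift_basis_vector:
  assumes M: "module k M" and f: "f \<in> B \<rightarrow> carrier M" and b: "b \<in> B"
  shows "free_lift k M f (basis_vector k b) = f b"
proof -
  interpret M: module k M by fact
  have "free_lift k M f (basis_vector k b) = (\<Oplus>\<^bsub>M\<^esub>x\<in>{b}. basis_vector k b x \<odot>\<^bsub>M\<^esub> f x)"
    using b by (intro free_lift_superset[OF M f] basis_vector_closed M.is_cring)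
      (auto simp: basis_vector_def)
  moreover have "f b \<in> carrier M" using f b by auto
  ultimately show ?thesis by (simp add: basis_vector_def)
qed

lemma tensor_lift_free_lift: "tensor_lift k M f t = free_lift k M f (SOME p. p \<in> t)"
  by (simp add: tensor_lift_def free_lift_def Let_def)

context
  fixes k :: "('k, 'a) ring_scheme" and H :: "('k, 'h, 'b) module_scheme"
  assumes H: "module k H"
begin

interpretation module k H by (rule H)

lemma free_words_module: "module k (free_words k H n)"
  by (rule free_module_module) (rule R.is_cring)

lemma basis_word_closed: "xs \<in> words H n \<Longrightarrow> basis_vector k xs \<in> carrier (free_words k H n)"
  by (rule basis_vector_closed) (rule R.is_cring)

lemma tensor_relators_closed: "tensor_relators k H n \<subseteq> carrier (free_words k H n)"
proof -
  interpret F: module k "free_words k H n" by (rule free_words_module)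
  have w: "us @ [y] @ vs \<in> words H n" "us @ [x \<oplus>\<^bsub>H\<^esub> y] @ vs \<in> words H n"
    if "us @ [x] @ vs \<in> words H n" "y \<in> carrier H" for us x y vs
    using that by (auto simp: words_def)
  have w': "us @ [r \<odot>\<^bsub>H\<^esub> x] @ vs \<in> words H n"
    if "us @ [x] @ vs \<in> words H n" "r \<in> carrier k" for us r x vs
    using that by (auto simp: words_def)
  have "basis_vector k (us @ [x \<oplus>\<^bsub>H\<^esub> y] @ vs) \<ominus>\<^bsub>free_words k H n\<^esub>
      (basis_vector k (us @ [x] @ vs) \<oplus>\<^bsub>free_words k H n\<^esub> basis_vector k (us @ [y] @ vs))
      \<in> carrier (free_words k H n)"
    if a: "us @ [x] @ vs \<in> words H n" "y \<in> carrier H" for us x y vs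
    using basis_word_closed[OF a(1)] w[OF a, THEN basis_word_closed]
    by (simp only: F.M.minus_closed F.M.a_closed)
  moreover have "basis_vector k (us @ [r \<odot>\<^bsub>H\<^esub> x] @ vs) \<ominus>\<^bsub>free_words k H n\<^esub>
      (r \<odot>\<^bsub>free_words k H n\<^esub> basis_vector k (us @ [x] @ vs)) \<in> carrier (free_words k H n)"
    if a: "us @ [x] @ vs \<in> words H n" "r \<in> carrier k" for us r x vs
    using a(2) basis_word_closed[OF a(1)] w'[OF a, THEN basis_word_closed]
    by (simp only: F.M.minus_closed F.smult_closed)
  ultimately show ?thesis
    unfolding tensor_relators_def by blast
qed

lemma tensor_null_submodule: "submodule (tensor_null k H n) k (free_words k H n)"
  unfolding tensor_null_def
  by (intro submodule_span_submodule free_words_module tensor_relators_closed)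

lemma tensor_power_module: "module k (tensor_power k H n)"
  unfolding tensor_power_def
  by (intro quotient_module_module free_words_module tensor_null_submodule)

lemma pure_tensor_multilinear: "pure_tensor k H \<in> multilinear_maps k H n (tensor_power k H n)"
proof -
  let ?F = "free_words k H n" and ?N = "tensor_null k H n"
  interpret F: module k ?F by (rule free_words_module)
  note Q = free_words_module[of n] tensor_null_submodule[of n]
  have rel: "tensor_relators k H n \<subseteq> ?N"
    unfolding tensor_null_def by (rule submodule_span_superset)
  have pure: "pure_tensor k H xs = ?N +>\<^bsub>?F\<^esub> basis_vector k xs" if "xs \<in> words H n" for xs
    using that by (auto simp: words_def pure_tensor_def)
  show ?thesis
    unfolding multilinear_maps_def
  proof (intro CollectI conjI allI impI; (elim conjE)?)
    show "pure_tensor k H \<in> words H n \<rightarrow> carrier (tensor_power k H n)"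
      by (auto simp: pure tensor_power_def quotient_carrier[OF Q] basis_word_closed)
  next
    fix us x y vs assume a: "us @ [x] @ vs \<in> words H n" "y \<in> carrier H"
    then have w: "us @ [y] @ vs \<in> words H n" "us @ [x \<oplus>\<^bsub>H\<^esub> y] @ vs \<in> words H n"
      by (auto simp: words_def)
    have "basis_vector k (us @ [x \<oplus>\<^bsub>H\<^esub> y] @ vs) \<ominus>\<^bsub>?F\<^esub>
      (basis_vector k (us @ [x] @ vs) \<oplus>\<^bsub>?F\<^esub> basis_vector k (us @ [y] @ vs)) \<in> ?N"
      using a by (intro subsetD[OF rel]) (unfold tensor_relators_def, blast)
    then show "pure_tensor k H (us @ [x \<oplus>\<^bsub>H\<^esub> y] @ vs) =
      pure_tensor k H (us @ [x] @ vs) \<oplus>\<^bsub>tensor_power k H n\<^esub> pure_tensor k H (us @ [y] @ vs)"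
      using a(1) w basis_word_closed[OF a(1)] w[THEN basis_word_closed]
      unfolding pure[OF a(1)] pure[OF w(1)] pure[OF w(2)] tensor_power_def
      by (simp only: quotient_add[OF Q] quotient_eq_iff[OF Q] F.M.add.m_closed)
  next
    fix us r x vs assume a: "us @ [x] @ vs \<in> words H n" "r \<in> carrier k"
    then have w: "us @ [r \<odot>\<^bsub>H\<^esub> x] @ vs \<in> words H n"
      by (auto simp: words_def)
    have "basis_vector k (us @ [r \<odot>\<^bsub>H\<^esub> x] @ vs) \<ominus>\<^bsub>?F\<^esub>
      (r \<odot>\<^bsub>?F\<^esub> basis_vector k (us @ [x] @ vs)) \<in> ?N"
      using a by (intro subsetD[OF rel]) (unfold tensor_relators_def, blast)
    then show "pure_tensor k H (us @ [r \<odot>\<^bsub>H\<^esub> x] @ vs) =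
      r \<odot>\<^bsub>tensor_power k H n\<^esub> pure_tensor k H (us @ [x] @ vs)"
      using a w basis_word_closed[OF a(1)] w[THEN basis_word_closed]
      unfolding pure[OF a(1)] pure[OF w] tensor_power_def
      by (simp only: quotient_smult[OF Q] quotient_eq_iff[OF Q] F.smult_closed)
  qed
qed

lemma tensor_lift_coset:
  assumes M: "module k M" and f: "f \<in> multilinear_maps k H n M"
    and p: "p \<in> carrier (free_words k H n)"
  shows "tensor_lift k M f (tensor_null k H n +>\<^bsub>free_words k H n\<^esub> p) = free_lift k M f p"
proof -
  let ?F = "free_words k H n" and ?N = "tensor_null k H n"
  interpret M: module k M by fact
  interpret F: module k ?F by (rule free_words_module)
  interpret N: abelian_subgroup ?N ?F
    by (rule quotient_subgroup[OF free_words_module tensor_null_submodule])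
  have f': "f \<in> words H n \<rightarrow> carrier M" using f by (simp add: multilinear_maps_def)
  note lin = free_lift_linear[OF M f']
  note basis = free_lift_basis_vector[OF M f']
  have "?N \<subseteq> {x \<in> carrier ?F. free_lift k M f x = \<zero>\<^bsub>M\<^esub>}"
    unfolding tensor_null_def
  proof (rule submodule_span_least)
    show "submodule {x \<in> carrier ?F. free_lift k M f x = \<zero>\<^bsub>M\<^esub>} k ?F"
      by (rule linear_maps_kernel_submodule[OF free_words_module M lin])
    have diff: "free_lift k M f (x \<ominus>\<^bsub>?F\<^esub> y) = \<zero>\<^bsub>M\<^esub>"
      if "x \<in> carrier ?F" "y \<in> carrier ?F" "free_lift k M f x = free_lift k M f y" for x y
      using that linear_mapsD(1)[OF lin]
      by (simp add: a_minus_def linear_mapsD(2)[OF lin] M.M.r_neg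
          linear_maps_zero_minus[OF free_words_module M lin])
    have add: "free_lift k M f (basis_vector k (us @ [x \<oplus>\<^bsub>H\<^esub> y] @ vs) \<ominus>\<^bsub>?F\<^esub>
        (basis_vector k (us @ [x] @ vs) \<oplus>\<^bsub>?F\<^esub> basis_vector k (us @ [y] @ vs))) = \<zero>\<^bsub>M\<^esub>"
      if a: "us @ [x] @ vs \<in> words H n" "y \<in> carrier H" for us x y vs
    proof -
      have w: "us @ [y] @ vs \<in> words H n" "us @ [x \<oplus>\<^bsub>H\<^esub> y] @ vs \<in> words H n"
        using a by (auto simp: words_def)
      have "f (us @ [x \<oplus>\<^bsub>H\<^esub> y] @ vs) = f (us @ [x] @ vs) \<oplus>\<^bsub>M\<^esub> f (us @ [y] @ vs)"
        using f a unfolding multilinear_maps_def by blast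
      then show ?thesis
        using a(1) w basis_word_closed[OF a(1)] w[THEN basis_word_closed]
        by (intro diff) (simp_all only: linear_mapsD(2)[OF lin] basis F.M.add.m_closed)
    qed
    have smult: "free_lift k M f (basis_vector k (us @ [r \<odot>\<^bsub>H\<^esub> x] @ vs) \<ominus>\<^bsub>?F\<^esub>
        (r \<odot>\<^bsub>?F\<^esub> basis_vector k (us @ [x] @ vs))) = \<zero>\<^bsub>M\<^esub>"
      if a: "us @ [x] @ vs \<in> words H n" "r \<in> carrier k" for us r x vs
    proof -
      have w: "us @ [r \<odot>\<^bsub>H\<^esub> x] @ vs \<in> words H n"
        using a by (auto simp: words_def)
      have "f (us @ [r \<odot>\<^bsub>H\<^esub> x] @ vs) = r \<odot>\<^bsub>M\<^esub> f (us @ [x] @ vs)"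
        using f a unfolding multilinear_maps_def by blast
      then show ?thesis
        using a w basis_word_closed[OF a(1)] w[THEN basis_word_closed]
        by (intro diff) (simp_all only: linear_mapsD(3)[OF lin] basis F.smult_closed)
    qed
    show "tensor_relators k H n \<subseteq> {x \<in> carrier ?F. free_lift k M f x = \<zero>\<^bsub>M\<^esub>}"
      using tensor_relators_closed[of n] add smult
      unfolding tensor_relators_def by blast
  qed
  then have null: "x \<in> carrier ?F \<and> free_lift k M f x = \<zero>\<^bsub>M\<^esub>" if "x \<in> ?N" for x
    using that by blast
  have "(SOME q. q \<in> ?N +>\<^bsub>?F\<^esub> p) \<in> ?N +>\<^bsub>?F\<^esub> p"
    using N.a_rcos_self[OF p] some_in_eq by blast
  then obtain x where "x \<in> ?N" "(SOME q. q \<in> ?N +>\<^bsub>?F\<^esub> p) = x \<oplus>\<^bsub>?F\<^esub> p"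
    by (auto simp: a_r_coset_def r_coset_def)
  then show ?thesis
    using null[of x] linear_mapsD(1)[OF lin p]
    by (simp add: tensor_lift_free_lift linear_mapsD(2)[OF lin] p)
qed

lemma tensor_lift_linear:
  assumes M: "module k M" and f: "f \<in> multilinear_maps k H n M"
  shows "tensor_lift k M f \<in> linear_maps k (tensor_power k H n) M"
proof -
  interpret F: module k "free_words k H n" by (rule free_words_module)
  note Q = free_words_module[of n] tensor_null_submodule[of n]
  have "free_lift k M f \<in> linear_maps k (free_words k H n) M"
    using f by (intro free_lift_linear M) (simp add: multilinear_maps_def)
  note lin = linear_mapsD[OF this]
  show ?thesis
    by (rule linear_mapsI)
      (auto simp: tensor_power_def quotient_carrier[OF Q] quotient_add[OF Q] quotient_smult[OF Q]
        tensor_lift_coset[OF M f] lin)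
qed

lemma tensor_lift_pure:
  assumes M: "module k M" and f: "f \<in> multilinear_maps k H n M" and xs: "xs \<in> words H n"
  shows "tensor_lift k M f (pure_tensor k H xs) = f xs"
  using tensor_lift_coset[OF M f basis_word_closed[OF xs]] free_lift_basis_vector[OF M _ xs, of f] f xs
  by (simp add: pure_tensor_def words_def multilinear_maps_def)

lemma tensor_lift_unique:
  assumes M: "module k M" and f: "f \<in> multilinear_maps k H n M"
    and g: "g \<in> linear_maps k (tensor_power k H n) M"
    and eq: "\<And>xs. xs \<in> words H n \<Longrightarrow> g (pure_tensor k H xs) = f xs"
    and t: "t \<in> carrier (tensor_power k H n)"
  shows "g t = tensor_lift k M f t"
proof -
  let ?F = "free_words k H n" and ?N = "tensor_null k H n"
  note Q = free_words_module[of n] tensor_null_submodule[of n]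
  have f': "f \<in> words H n \<rightarrow> carrier M" using f by (simp add: multilinear_maps_def)
  have lin: "(\<lambda>p. g (?N +>\<^bsub>?F\<^esub> p)) \<in> linear_maps k ?F M"
    using linear_mapsD[OF g] unfolding tensor_power_def
    by (intro linear_mapsI)
      (auto simp: quotient_carrier[OF Q] quotient_add[OF Q, symmetric] quotient_smult[OF Q, symmetric])
  obtain p where p: "p \<in> carrier ?F" "t = ?N +>\<^bsub>?F\<^esub> p"
    using t by (auto simp: tensor_power_def quotient_carrier[OF Q])
  have "g (?N +>\<^bsub>?F\<^esub> p) = free_lift k M f p"
  proof (rule free_module_ext[OF M lin free_lift_linear[OF M f'] _ p(1)])
    fix xs assume xs: "xs \<in> words H n"
    then show "g (?N +>\<^bsub>?F\<^esub> basis_vector k xs) = free_lift k M f (basis_vector k xs)"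
      using eq[OF xs] by (simp add: free_lift_basis_vector[OF M f'] pure_tensor_def words_def)
  qed
  then show ?thesis
    using p tensor_lift_coset[OF M f] by simp
qed

lemma tensor_power_0:
  assumes t: "t \<in> carrier (tensor_power k H 0)"
  shows "\<exists>!r. r \<in> carrier k \<and> t = r \<odot>\<^bsub>tensor_power k H 0\<^esub> pure_tensor k H []"
proof -
  let ?F = "free_words k H 0" and ?N = "tensor_null k H 0"
  interpret F: module k ?F by (rule free_words_module)
  note Q = free_words_module[of 0] tensor_null_submodule[of 0]
  have nil: "[] \<in> words H 0" by (simp add: words_def)
  have "tensor_relators k H 0 = {}" by (auto simp: tensor_relators_def words_def)
  moreover have "submodule {\<zero>\<^bsub>?F\<^esub>} k ?F" by (rule F.submoduleI) auto
  ultimately have null: "?N \<subseteq> {\<zero>\<^bsub>?F\<^esub>}"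
    unfolding tensor_null_def by (intro submodule_span_least) auto
  have smult: "r \<odot>\<^bsub>tensor_power k H 0\<^esub> pure_tensor k H [] = ?N +>\<^bsub>?F\<^esub> (r \<odot>\<^bsub>?F\<^esub> basis_vector k [])"
    if "r \<in> carrier k" for r
    using quotient_smult[OF Q that basis_word_closed[OF nil]]
    by (simp add: tensor_power_def pure_tensor_def)
  obtain p where p: "p \<in> carrier ?F" "t = ?N +>\<^bsub>?F\<^esub> p"
    using t by (auto simp: tensor_power_def quotient_carrier[OF Q])
  have p0: "p [] \<in> carrier k" using p by (simp add: free_module_def)
  have eq: "p = p [] \<odot>\<^bsub>?F\<^esub> basis_vector k []"
    using p(1) by (auto simp: free_module_def basis_vector_def words_def fun_eq_iff)
  show ?thesis
  proof (rule ex1I[of _ "p []"])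
    show "p [] \<in> carrier k \<and> t = p [] \<odot>\<^bsub>tensor_power k H 0\<^esub> pure_tensor k H []"
      using p0 p(2) eq smult[OF p0] by simp
  next
    fix r assume r: "r \<in> carrier k \<and> t = r \<odot>\<^bsub>tensor_power k H 0\<^esub> pure_tensor k H []"
    define q where "q = r \<odot>\<^bsub>?F\<^esub> basis_vector k []"
    have q: "q \<in> carrier ?F"
      unfolding q_def using r basis_word_closed[OF nil] by (intro F.smult_closed) auto
    have "q \<ominus>\<^bsub>?F\<^esub> p = \<zero>\<^bsub>?F\<^esub>"
      using r smult[of r] p(2) null quotient_eq_iff[OF Q q p(1)] by (auto simp: q_def)
    then have "q = p" using q p(1) by (metis F.M.add.inv_equality F.M.minus_equality F.M.minus_minus F.M.a_inv_closed a_minus_def)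
    then have "q [] = p []" by simp
    then show "r = p []"
      using r by (simp add: q_def free_module_def basis_vector_def)
  qed
qed

end


section \<open>Hopf algebras\<close>

text \<open>The library locale \<open>algebra\<close> requires a commutative multiplication.\<close>

locale assoc_algebra = module R M + M?: ring M for R and M (structure) +
  assumes smult_mult_left:
      "\<lbrakk>r \<in> carrier R; x \<in> carrier M; y \<in> carrier M\<rbrakk> \<Longrightarrow> (r \<odot> x) \<otimes> y = r \<odot> (x \<otimes> y)"
    and smult_mult_right:
      "\<lbrakk>r \<in> carrier R; x \<in> carrier M; y \<in> carrier M\<rbrakk> \<Longrightarrow> x \<otimes> (r \<odot> y) = r \<odot> (x \<otimes> y)"

definition character ::
  "('k, 'a) ring_scheme \<Rightarrow> ('k, 'h, 'b) module_scheme \<Rightarrow> ('h \<Rightarrow> 'k) \<Rightarrow> bool"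
  where "character k H \<delta> \<longleftrightarrow>
    \<delta> \<in> ring_hom H k \<and> (\<forall>r\<in>carrier k. \<forall>h\<in>carrier H. \<delta> (r \<odot>\<^bsub>H\<^esub> h) = r \<otimes>\<^bsub>k\<^esub> \<delta> h)"

locale hopf_algebra = assoc_algebra k H for k and H (structure) +
  fixes \<Delta> :: "'b \<Rightarrow> ('b list \<Rightarrow> 'a) set"
    and \<epsilon> :: "'b \<Rightarrow> 'a"
    and S :: "'b \<Rightarrow> 'b"
  assumes comult_linear: "\<Delta> \<in> linear_maps k H (tensor_power k H 2)"
    and comult_one: "\<Delta> \<one> = pure_tensor k H [\<one>, \<one>]"
    and comult_mult: "\<lbrakk>x \<in> carrier H; y \<in> carrier H\<rbrakk> \<Longrightarrow>
      \<Delta> (x \<otimes> y) = tensor_square_mult k H (\<Delta> x) (\<Delta> y)"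
    and counit_character: "character k H \<epsilon>"
    and coassociative: "h \<in> carrier H \<Longrightarrow>
      tensor_lift k (tensor_power k H 3)
        (\<lambda>ab. tensor_append k H 3 (\<Delta> (ab ! 0)) (pure_tensor k H [ab ! 1])) (\<Delta> h) =
      tensor_lift k (tensor_power k H 3)
        (\<lambda>ab. tensor_append k H 3 (pure_tensor k H [ab ! 0]) (\<Delta> (ab ! 1))) (\<Delta> h)"
    and counit_left: "h \<in> carrier H \<Longrightarrow> tensor_lift k H (\<lambda>ab. \<epsilon> (ab ! 0) \<odot> ab ! 1) (\<Delta> h) = h"
    and counit_right: "h \<in> carrier H \<Longrightarrow> tensor_lift k H (\<lambda>ab. \<epsilon> (ab ! 1) \<odot> ab ! 0) (\<Delta> h) = h"
    and antipode_linear: "S \<in> linear_maps k H H"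
    and antipode_left: "h \<in> carrier H \<Longrightarrow>
      tensor_lift k H (\<lambda>ab. S (ab ! 0) \<otimes> ab ! 1) (\<Delta> h) = \<epsilon> h \<odot> \<one>"
    and antipode_right: "h \<in> carrier H \<Longrightarrow>
      tensor_lift k H (\<lambda>ab. ab ! 0 \<otimes> S (ab ! 1)) (\<Delta> h) = \<epsilon> h \<odot> \<one>"

definition grouplike ::
  "('k, 'a) ring_scheme \<Rightarrow> ('k, 'h, 'b) module_scheme \<Rightarrow> ('h \<Rightarrow> ('h list \<Rightarrow> 'k) set) \<Rightarrow> ('h \<Rightarrow> 'k)
     \<Rightarrow> 'h \<Rightarrow> bool"
  where "grouplike k H \<Delta> \<epsilon> \<sigma> \<longleftrightarrow>
    \<sigma> \<in> carrier H \<and> \<Delta> \<sigma> = pure_tensor k H [\<sigma>, \<sigma>] \<and> \<epsilon> \<sigma> = \<one>\<^bsub>k\<^esub>"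

definition twisted_antipode ::
  "('k, 'a) ring_scheme \<Rightarrow> ('k, 'h, 'b) module_scheme \<Rightarrow> ('h \<Rightarrow> ('h list \<Rightarrow> 'k) set) \<Rightarrow> ('h \<Rightarrow> 'h)
     \<Rightarrow> ('h \<Rightarrow> 'k) \<Rightarrow> 'h \<Rightarrow> 'h \<Rightarrow> 'h"
  where "twisted_antipode k H \<Delta> S \<delta> \<sigma> h =
    \<sigma> \<otimes>\<^bsub>H\<^esub> tensor_lift k H (\<lambda>ab. \<delta> (ab ! 1) \<odot>\<^bsub>H\<^esub> S (ab ! 0)) (\<Delta> h)"

definition modular_pair :: "('k, 'a) ring_scheme \<Rightarrow> ('h \<Rightarrow> 'k) \<Rightarrow> 'h \<Rightarrow> bool"
  where "modular_pair k \<delta> \<sigma> \<longleftrightarrow> \<delta> \<sigma> = \<one>\<^bsub>k\<^esub>"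

definition modular_pair_in_involution ::
  "('k, 'a) ring_scheme \<Rightarrow> ('k, 'h, 'b) module_scheme \<Rightarrow> ('h \<Rightarrow> ('h list \<Rightarrow> 'k) set) \<Rightarrow> ('h \<Rightarrow> 'h)
     \<Rightarrow> ('h \<Rightarrow> 'k) \<Rightarrow> 'h \<Rightarrow> bool"
  where "modular_pair_in_involution k H \<Delta> S \<delta> \<sigma> \<longleftrightarrow>
    modular_pair k \<delta> \<sigma> \<and>
    (\<forall>h\<in>carrier H. twisted_antipode k H \<Delta> S \<delta> \<sigma> (twisted_antipode k H \<Delta> S \<delta> \<sigma> h) = h)"


section \<open>Cyclic modules\<close>

text \<open>The operators \<open>d n i\<close>, \<open>s n i\<close> and \<open>\<tau> n\<close> are those defined on \<open>X n\<close>.\<close>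

locale simplicial_module =
  fixes k :: "('k, 'a) ring_scheme"
    and X :: "nat \<Rightarrow> ('k, 'x) module"
    and d :: "nat \<Rightarrow> nat \<Rightarrow> 'x \<Rightarrow> 'x"
    and s :: "nat \<Rightarrow> nat \<Rightarrow> 'x \<Rightarrow> 'x"
  assumes module: "module k (X n)"
    and face_linear: "\<lbrakk>1 \<le> n; i \<le> n\<rbrakk> \<Longrightarrow> d n i \<in> linear_maps k (X n) (X (n - 1))"
    and degeneracy_linear: "i \<le> n \<Longrightarrow> s n i \<in> linear_maps k (X n) (X (n + 1))"
    and face_face: "\<lbrakk>2 \<le> n; i < j; j \<le> n; x \<in> carrier (X n)\<rbrakk> \<Longrightarrow>
      d (n - 1) i (d n j x) = d (n - 1) (j - 1) (d n i x)"
    and degeneracy_degeneracy: "\<lbrakk>i \<le> j; j \<le> n; x \<in> carrier (X n)\<rbrakk> \<Longrightarrow>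
      s (n + 1) i (s n j x) = s (n + 1) (j + 1) (s n i x)"
    and face_degeneracy_less: "\<lbrakk>i < j; j \<le> n; x \<in> carrier (X n)\<rbrakk> \<Longrightarrow>
      d (n + 1) i (s n j x) = s (n - 1) (j - 1) (d n i x)"
    and face_degeneracy_same: "\<lbrakk>j \<le> n; i = j \<or> i = j + 1; x \<in> carrier (X n)\<rbrakk> \<Longrightarrow>
      d (n + 1) i (s n j x) = x"
    and face_degeneracy_greater: "\<lbrakk>j + 1 < i; i \<le> n + 1; x \<in> carrier (X n)\<rbrakk> \<Longrightarrow>
      d (n + 1) i (s n j x) = s (n - 1) j (d n (i - 1) x)"

locale cyclic_module = simplicial_module k X d s
  for k :: "('k, 'a) ring_scheme"
    and X :: "nat \<Rightarrow> ('k, 'x) module"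
    and d :: "nat \<Rightarrow> nat \<Rightarrow> 'x \<Rightarrow> 'x"
    and s :: "nat \<Rightarrow> nat \<Rightarrow> 'x \<Rightarrow> 'x" +
  fixes \<tau> :: "nat \<Rightarrow> 'x \<Rightarrow> 'x"
  assumes cyclic_linear: "\<tau> n \<in> linear_maps k (X n) (X n)"
    and cyclic_power: "x \<in> carrier (X n) \<Longrightarrow> (\<tau> n ^^ (n + 1)) x = x"
    and face_cyclic: "\<lbrakk>1 \<le> i; i \<le> n; x \<in> carrier (X n)\<rbrakk> \<Longrightarrow>
      d n i (\<tau> n x) = \<tau> (n - 1) (d n (i - 1) x)"
    and face_zero_cyclic: "\<lbrakk>1 \<le> n; x \<in> carrier (X n)\<rbrakk> \<Longrightarrow> d n 0 (\<tau> n x) = d n n x"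
    and degeneracy_cyclic: "\<lbrakk>1 \<le> i; i \<le> n; x \<in> carrier (X n)\<rbrakk> \<Longrightarrow>
      s n i (\<tau> n x) = \<tau> (n + 1) (s n (i - 1) x)"
    and degeneracy_zero_cyclic: "x \<in> carrier (X n) \<Longrightarrow>
      s n 0 (\<tau> n x) = \<tau> (n + 1) (\<tau> (n + 1) (s n n x))"


section \<open>The operators attached to a character and a grouplike element\<close>

text \<open>Words are indexed from 0, so \<open>h\<^sub>i\<close> is \<open>hs ! (i - 1)\<close>.\<close>

definition face ::
  "('k, 'a) ring_scheme \<Rightarrow> ('k, 'h, 'b) module_scheme \<Rightarrow> ('h \<Rightarrow> 'k) \<Rightarrow> ('h \<Rightarrow> 'k) \<Rightarrow> nat \<Rightarrow> nat
     \<Rightarrow> ('h list \<Rightarrow> 'k) set \<Rightarrow> ('h list \<Rightarrow> 'k) set"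
  where "face k H \<epsilon> \<delta> n i =
    tensor_lift k (tensor_power k H (n - 1))
      (\<lambda>hs. if i = 0 then \<epsilon> (hd hs) \<odot>\<^bsub>tensor_power k H (n - 1)\<^esub> pure_tensor k H (tl hs)
            else if i < n then
              pure_tensor k H (take (i - 1) hs @ [hs ! (i - 1) \<otimes>\<^bsub>H\<^esub> hs ! i] @ drop (i + 1) hs)
            else \<delta> (last hs) \<odot>\<^bsub>tensor_power k H (n - 1)\<^esub> pure_tensor k H (butlast hs))"

definition degeneracy ::
  "('k, 'a) ring_scheme \<Rightarrow> ('k, 'h, 'b) module_scheme \<Rightarrow> nat \<Rightarrow> nat
     \<Rightarrow> ('h list \<Rightarrow> 'k) set \<Rightarrow> ('h list \<Rightarrow> 'k) set"
  where "degeneracy k H n i =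
    tensor_lift k (tensor_power k H (n + 1))
      (\<lambda>hs. pure_tensor k H (take i hs @ [\<one>\<^bsub>H\<^esub>] @ drop i hs))"

text \<open>\<open>\<Delta>(h\<^sub>1) \<otimes> \<dots> \<otimes> \<Delta>(h\<^sub>n)\<close> as an element of the \<open>2n\<close>-th tensor power.\<close>

primrec comult_word ::
  "('k, 'a) ring_scheme \<Rightarrow> ('k, 'h, 'b) module_scheme \<Rightarrow> ('h \<Rightarrow> ('h list \<Rightarrow> 'k) set) \<Rightarrow> 'h list
     \<Rightarrow> ('h list \<Rightarrow> 'k) set"
  where
    "comult_word k H \<Delta> [] = pure_tensor k H []"
  | "comult_word k H \<Delta> (h # hs) =
       tensor_append k H (2 * length (h # hs)) (\<Delta> h) (comult_word k H \<Delta> hs)"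

text \<open>For a word \<open>w = [a\<^sub>1, b\<^sub>1, \<dots>, a\<^sub>n, b\<^sub>n]\<close>, the tensor
  \<open>\<delta>(b\<^sub>n) S\<^sub>\<sigma>(a\<^sub>1 \<cdots> a\<^sub>n) \<otimes> b\<^sub>1 \<otimes> \<dots> \<otimes> b\<^sub>n\<^sub>-\<^sub>1\<close>.\<close>

definition cyclic_word ::
  "('k, 'a) ring_scheme \<Rightarrow> ('k, 'h, 'b) module_scheme \<Rightarrow> ('h \<Rightarrow> 'h) \<Rightarrow> ('h \<Rightarrow> 'k) \<Rightarrow> 'h \<Rightarrow> nat
     \<Rightarrow> 'h list \<Rightarrow> ('h list \<Rightarrow> 'k) set"
  where "cyclic_word k H S \<delta> \<sigma> n w =
    (let as = map (\<lambda>i. w ! (2 * i)) [0..<n]; bs = map (\<lambda>i. w ! (2 * i + 1)) [0..<n]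
     in \<delta> (last bs) \<odot>\<^bsub>tensor_power k H n\<^esub>
          pure_tensor k H ((\<sigma> \<otimes>\<^bsub>H\<^esub> S (foldr (\<otimes>\<^bsub>H\<^esub>) as \<one>\<^bsub>H\<^esub>)) # butlast bs))"

text \<open>In positive degree, the composition of \<open>\<Delta> \<otimes> \<dots> \<otimes> \<Delta>\<close> with the linear map
  given by \<open>cyclic_word\<close>; this is what the Sweedler formula for \<open>\<tau>\<^sub>n\<close> abbreviates.\<close>

definition cyclic_operator ::
  "('k, 'a) ring_scheme \<Rightarrow> ('k, 'h, 'b) module_scheme \<Rightarrow> ('h \<Rightarrow> ('h list \<Rightarrow> 'k) set) \<Rightarrow> ('h \<Rightarrow> 'h)
     \<Rightarrow> ('h \<Rightarrow> 'k) \<Rightarrow> 'h \<Rightarrow> nat \<Rightarrow> ('h list \<Rightarrow> 'k) set \<Rightarrow> ('h list \<Rightarrow> 'k) set"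
  where "cyclic_operator k H \<Delta> S \<delta> \<sigma> n t =
    (if n = 0 then t
     else tensor_lift k (tensor_power k H n) (cyclic_word k H S \<delta> \<sigma> n)
            (tensor_lift k (tensor_power k H (2 * n)) (comult_word k H \<Delta>) t))"

end

theory Submission
  imports Defs
begin

text \<open>Write \<open>\<Delta> h = \<Sum> h' \<otimes> h''\<close>. The extra degeneracy
  \<open>E (h\<^sub>1 \<otimes> \<dots> \<otimes> h\<^sub>n) = \<Sum> \<sigma>S(h\<^sub>1' \<cdots> h\<^sub>n') \<otimes> h\<^sub>1'' \<otimes> \<dots> \<otimes> h\<^sub>n''\<close>
  satisfies \<open>d\<^sub>0 E = id\<close>, \<open>d\<^sub>i E = E d\<^sub>i\<^sub>-\<^sub>1\<close>, \<open>s\<^sub>i E = E s\<^sub>i\<^sub>-\<^sub>1\<close> and \<open>E E = s\<^sub>0 E\<close>, and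
  \<open>\<tau>\<^sub>n = d\<^sub>n\<^sub>+\<^sub>1 E\<close>. Hence all the cyclic relations but \<open>\<tau>\<^sub>n\<^sup>n\<^sup>+\<^sup>1 = id\<close> follow from the simplicial
  identities, without the involution hypothesis. That hypothesis yields \<open>E \<tau>\<^sub>n = R E\<close> for the
  rotation \<open>R (g\<^sub>0 \<otimes> \<dots> \<otimes> g\<^sub>n) = \<theta>(g\<^sub>n) \<otimes> g\<^sub>0 \<otimes> \<dots> \<otimes> g\<^sub>n\<^sub>-\<^sub>1\<close> with \<open>\<theta>(g) = \<Sum> \<delta>(g') g''\<close>, so that
  \<open>\<tau>\<^sub>n\<^sup>n\<^sup>+\<^sup>1 = d\<^sub>0 R\<^sup>n\<^sup>+\<^sup>1 E\<close>; this is the identity because \<open>R\<^sup>n\<^sup>+\<^sup>1 = \<theta> \<otimes> \<dots> \<otimes> \<theta>\<close>.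
  Conversely, \<open>\<tau>\<^sub>1\<close> is the twisted antipode, so \<open>\<tau>\<^sub>1\<^sup>2 = id\<close> is the involution condition.\<close>

section \<open>Linear and multilinear maps\<close>

text \<open>The obstacle is Sweedler notation itself: a sum over \<open>\<Delta> h\<close> has no
  canonical terms, only the value of a functional on a class in a quotient module.
  \<open>tensor_lift\<close> evaluates a function on one chosen representative, so sums can be
  exchanged and linear maps pushed under them for any closed integrand; coassociativity, the counit
  and antipode laws and multiplicativity of \<open>\<Delta>\<close> change the representative, hence
  the linearity conditions in each leg that accompany most steps. Two cancellations carry the order
  of the cyclic operator. Comparing E after the cyclic operator with R after E, what remains of the
  last letter h in the head is the sum of \<delta>(h'') times S_\<sigma> applied twice to h';
  convolving the involution condition with \<delta> on the left identifies it with \<theta>(h).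
  After the full turn, the counit turns \<theta> of the head into \<delta>(S(h1' ... hn')), because
  \<delta>(\<sigma>) = 1; and \<delta> composed with S is the convolution inverse of \<delta>, so it
  undoes \<theta> on the remaining factors.\<close>

lemma linear_maps_compose:
  "\<lbrakk>g \<in> linear_maps k N P; f \<in> linear_maps k M N\<rbrakk> \<Longrightarrow> (\<lambda>x. g (f x)) \<in> linear_maps k M P"
  by (auto simp: linear_maps_def Pi_iff)

text \<open>\<open>linear_maps\<close> constrains a function on the carrier only; the module
  hypothesis keeps sums and multiples inside it, so that \<open>eq\<close> applies to them.\<close>

lemma linear_maps_cong:
  assumes "module k M" and g: "g \<in> linear_maps k M N" and eq: "\<And>x. x \<in> carrier M \<Longrightarrow> f x = g x"
  shows "f \<in> linear_maps k M N"
proof -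
  interpret module k M by fact
  show ?thesis by (rule linear_mapsI) (simp_all add: eq linear_mapsD[OF g])
qed

lemma linear_maps_ident: "(\<lambda>x. x) \<in> linear_maps k M M"
  by (simp add: linear_maps_def)

lemma linear_maps_smult:
  assumes "module k N" and f: "f \<in> linear_maps k M N" and r: "r \<in> carrier k"
  shows "(\<lambda>x. r \<odot>\<^bsub>N\<^esub> f x) \<in> linear_maps k M N"
proof -
  interpret N: module k N by fact
  show ?thesis
    by (rule linear_mapsI)
      (auto simp: linear_mapsD[OF f] r N.smult_r_distr N.smult_assoc1[symmetric] N.R.m_comm)
qed

lemma free_lift_cong:
  assumes "p \<in> carrier (free_module k B)" "\<And>x. x \<in> B \<Longrightarrow> f x = g x" "module k N" "g \<in> B \<rightarrow> carrier N"
  shows "free_lift k N f p = free_lift k N g p"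
proof -
  interpret N: module k N by fact
  show ?thesis
    unfolding free_lift_def
    by (rule N.finsum_cong') (use assms in \<open>auto simp: free_module_def Pi_iff subset_iff\<close>)
qed

lemma free_lift_compose:
  assumes N: "module k N" and P: "module k P" and g: "g \<in> linear_maps k N P"
    and f: "f \<in> B \<rightarrow> carrier N" and p: "p \<in> carrier (free_module k B)"
  shows "g (free_lift k N f p) = free_lift k P (\<lambda>x. g (f x)) p"
proof -
  have gf: "(\<lambda>x. g (f x)) \<in> B \<rightarrow> carrier P" using f linear_mapsD(1)[OF g] by auto
  show ?thesis
    by (rule free_module_ext[OF P linear_maps_compose[OF g free_lift_linear[OF N f]] free_lift_linear[OF P gf] _ p])
      (simp add: free_lift_basis_vector[OF N f] free_lift_basis_vector[OF P gf])
qed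

text \<open>The roles are reversed against \<open>free_lift_linear\<close>: the formal sum
  \<open>p\<close> is fixed and the integrand moves. This lets a parameter inside a Sweedler sum be
  varied linearly.\<close>

lemma free_lift_parameter_linear:
  assumes N: "module k N" and F: "\<And>w. w \<in> B \<Longrightarrow> (\<lambda>x. F x w) \<in> linear_maps k X N"
    and p: "p \<in> carrier (free_module k B)"
  shows "(\<lambda>x. free_lift k N (F x) p) \<in> linear_maps k X N"
proof (rule linear_mapsI)
  interpret N: module k N by (rule N)
  have supp: "finite {x. p x \<noteq> \<zero>\<^bsub>k\<^esub>}" "\<And>x. p x \<noteq> \<zero>\<^bsub>k\<^esub> \<Longrightarrow> x \<in> B" and pk: "\<And>x. p x \<in> carrier k"
    using p by (auto simp: free_module_def)
  note F' = linear_mapsD[OF F[OF supp(2)]]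
  fix x assume x: "x \<in> carrier X"
  then show "free_lift k N (F x) p \<in> carrier N"
    unfolding free_lift_def by (intro N.finsum_closed) (auto simp: F' pk)
  {
    fix y assume y: "y \<in> carrier X"
    have "free_lift k N (F (x \<oplus>\<^bsub>X\<^esub> y)) p =
      (\<Oplus>\<^bsub>N\<^esub>w\<in>{w. p w \<noteq> \<zero>\<^bsub>k\<^esub>}. p w \<odot>\<^bsub>N\<^esub> F x w \<oplus>\<^bsub>N\<^esub> p w \<odot>\<^bsub>N\<^esub> F y w)"
      unfolding free_lift_def using x y
      by (intro N.finsum_cong') (auto simp: F' pk N.smult_r_distr)
    then show "free_lift k N (F (x \<oplus>\<^bsub>X\<^esub> y)) p = free_lift k N (F x) p \<oplus>\<^bsub>N\<^esub> free_lift k N (F y) p"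
      unfolding free_lift_def using x y by (simp add: N.finsum_addf F' pk Pi_iff)
  }
  fix r assume r: "r \<in> carrier k"
  have "free_lift k N (F (r \<odot>\<^bsub>X\<^esub> x)) p = (\<Oplus>\<^bsub>N\<^esub>w\<in>{w. p w \<noteq> \<zero>\<^bsub>k\<^esub>}. r \<odot>\<^bsub>N\<^esub> (p w \<odot>\<^bsub>N\<^esub> F x w))"
    unfolding free_lift_def using x r
    by (intro N.finsum_cong') (auto simp: F' pk N.smult_assoc1[symmetric] N.R.m_comm)
  also have "\<dots> = r \<odot>\<^bsub>N\<^esub> free_lift k N (F x) p"
    unfolding free_lift_def using x r supp(1)
    by (intro N.finsum_smult_ldistr[symmetric]) (auto simp: F' pk)
  finally show "free_lift k N (F (r \<odot>\<^bsub>X\<^esub> x)) p = r \<odot>\<^bsub>N\<^esub> free_lift k N (F x) p" .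
qed

text \<open>Fubini for two finite formal sums. Both sides are linear in \<open>q\<close>, so a basis
  vector \<open>q\<close> is enough, and there both collapse to one sum over
  \<open>p\<close>.\<close>

lemma free_lift_swap:
  assumes N: "module k N" and F: "\<And>x y. \<lbrakk>x \<in> A; y \<in> B\<rbrakk> \<Longrightarrow> F x y \<in> carrier N"
    and p: "p \<in> carrier (free_module k A)" and q: "q \<in> carrier (free_module k B)"
  shows "free_lift k N (\<lambda>x. free_lift k N (F x) q) p = free_lift k N (\<lambda>y. free_lift k N (\<lambda>x. F x y) p) q"
proof (rule free_module_ext[OF N _ _ _ q])
  have F1: "F x \<in> B \<rightarrow> carrier N" if "x \<in> A" for x using F that by auto
  have F2: "(\<lambda>x. F x y) \<in> A \<rightarrow> carrier N" if "y \<in> B" for y using F that by auto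
  have F2': "(\<lambda>y. free_lift k N (\<lambda>x. F x y) p) \<in> B \<rightarrow> carrier N"
    using linear_mapsD(1)[OF free_lift_linear[OF N F2] p] by auto
  show "(\<lambda>q. free_lift k N (\<lambda>x. free_lift k N (F x) q) p) \<in> linear_maps k (free_module k B) N"
    by (rule free_lift_parameter_linear[OF N _ p]) (rule free_lift_linear[OF N F1])
  show "free_lift k N (\<lambda>y. free_lift k N (\<lambda>x. F x y) p) \<in> linear_maps k (free_module k B) N"
    by (rule free_lift_linear[OF N F2'])
  show "free_lift k N (\<lambda>x. free_lift k N (F x) (basis_vector k y)) p =
      free_lift k N (\<lambda>y. free_lift k N (\<lambda>x. F x y) p) (basis_vector k y)" if y: "y \<in> B" for y
    unfolding free_lift_basis_vector[OF N F2' y]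
    by (rule free_lift_cong[OF p _ N F2[OF y]]) (rule free_lift_basis_vector[OF N F1 y])
qed

section \<open>Words and multilinear maps, letter by letter\<close>

lemma words_simps [simp]:
  "xs \<in> words H 0 \<longleftrightarrow> xs = []"
  "[] \<in> words H n \<longleftrightarrow> n = 0"
  "x # xs \<in> words H (Suc n) \<longleftrightarrow> x \<in> carrier H \<and> xs \<in> words H n"
  by (auto simp: words_def)

lemma words_appendI: "\<lbrakk>xs \<in> words H m; ys \<in> words H n\<rbrakk> \<Longrightarrow> xs @ ys \<in> words H (m + n)"
  by (auto simp: words_def)

lemma words_append_iff:
  "length xs = m \<Longrightarrow> xs @ ys \<in> words H (m + n) \<longleftrightarrow> xs \<in> words H m \<and> ys \<in> words H n"
  by (auto simp: words_def)

lemma words_length: "xs \<in> words H n \<Longrightarrow> length xs = n"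
  by (simp add: words_def)

lemma words_SucE:
  assumes "w \<in> words H (Suc n)"
  obtains x xs where "w = x # xs" "x \<in> carrier H" "xs \<in> words H n"
  using assms by (cases w) (auto simp: words_def)

lemma words_addE:
  assumes "w \<in> words H (m + n)"
  obtains xs ys where "w = xs @ ys" "xs \<in> words H m" "ys \<in> words H n"
proof
  show "w = take m w @ drop m w" by simp
  show "take m w \<in> words H m" "drop m w \<in> words H n"
    using assms by (auto simp: words_def dest: in_set_takeD in_set_dropD)
qed

lemma words_snocE:
  assumes "w \<in> words H (Suc n)"
  obtains xs x where "w = xs @ [x]" "xs \<in> words H n" "x \<in> carrier H"
proof -
  from assms obtain xs ys where "w = xs @ ys" "xs \<in> words H n" "ys \<in> words H (Suc 0)"
    using words_addE[of w H n "Suc 0"] by auto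
  then show thesis using that by (auto elim!: words_SucE)
qed

lemma multilinear_mapsI:
  assumes "\<And>xs. xs \<in> words H n \<Longrightarrow> f xs \<in> carrier N"
    and "\<And>us x y vs. \<lbrakk>us @ [x] @ vs \<in> words H n; y \<in> carrier H\<rbrakk> \<Longrightarrow>
      f (us @ [x \<oplus>\<^bsub>H\<^esub> y] @ vs) = f (us @ [x] @ vs) \<oplus>\<^bsub>N\<^esub> f (us @ [y] @ vs)"
    and "\<And>us r x vs. \<lbrakk>us @ [x] @ vs \<in> words H n; r \<in> carrier k\<rbrakk> \<Longrightarrow>
      f (us @ [r \<odot>\<^bsub>H\<^esub> x] @ vs) = r \<odot>\<^bsub>N\<^esub> f (us @ [x] @ vs)"
  shows "f \<in> multilinear_maps k H n N"
  using assms unfolding multilinear_maps_def by blast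

lemma multilinear_mapsD:
  assumes "f \<in> multilinear_maps k H n N"
  shows "xs \<in> words H n \<Longrightarrow> f xs \<in> carrier N"
    and "\<lbrakk>us @ [x] @ vs \<in> words H n; y \<in> carrier H\<rbrakk> \<Longrightarrow>
      f (us @ [x \<oplus>\<^bsub>H\<^esub> y] @ vs) = f (us @ [x] @ vs) \<oplus>\<^bsub>N\<^esub> f (us @ [y] @ vs)"
    and "\<lbrakk>us @ [x] @ vs \<in> words H n; r \<in> carrier k\<rbrakk> \<Longrightarrow>
      f (us @ [r \<odot>\<^bsub>H\<^esub> x] @ vs) = r \<odot>\<^bsub>N\<^esub> f (us @ [x] @ vs)"
  using assms unfolding multilinear_maps_def by blast+

lemma multilinear_maps_compose:
  assumes g: "g \<in> linear_maps k N P" and f: "f \<in> multilinear_maps k H n N"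
  shows "(\<lambda>xs. g (f xs)) \<in> multilinear_maps k H n P"
proof (rule multilinear_mapsI)
  fix us x y vs assume w: "us @ [x] @ vs \<in> words H n" "y \<in> carrier H"
  then have "us @ [y] @ vs \<in> words H n" by (auto simp: words_def)
  then show "g (f (us @ [x \<oplus>\<^bsub>H\<^esub> y] @ vs)) = g (f (us @ [x] @ vs)) \<oplus>\<^bsub>P\<^esub> g (f (us @ [y] @ vs))"
    using w by (simp only: multilinear_mapsD[OF f] linear_mapsD[OF g])
next
  fix us r x vs assume "us @ [x] @ vs \<in> words H n" "r \<in> carrier k"
  then show "g (f (us @ [r \<odot>\<^bsub>H\<^esub> x] @ vs)) = r \<odot>\<^bsub>P\<^esub> g (f (us @ [x] @ vs))"
    by (simp only: multilinear_mapsD[OF f] linear_mapsD[OF g])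
qed (simp add: multilinear_mapsD[OF f] linear_mapsD[OF g])

lemma multilinear_maps_append:
  assumes f: "f \<in> multilinear_maps k H (l + m + n) N" and us: "us \<in> words H l" and vs: "vs \<in> words H n"
  shows "(\<lambda>ys. f (us @ ys @ vs)) \<in> multilinear_maps k H m N"
proof (rule multilinear_mapsI)
  have w: "us @ ys @ vs \<in> words H (l + m + n)" if "ys \<in> words H m" for ys
    using that us vs by (auto simp: words_def)
  show "f (us @ xs @ vs) \<in> carrier N" if "xs \<in> words H m" for xs
    by (rule multilinear_mapsD(1)[OF f w[OF that]])
  fix us' x vs' assume *: "us' @ [x] @ vs' \<in> words H m"
  show "f (us @ (us' @ [x \<oplus>\<^bsub>H\<^esub> y] @ vs') @ vs) =
      f (us @ (us' @ [x] @ vs') @ vs) \<oplus>\<^bsub>N\<^esub> f (us @ (us' @ [y] @ vs') @ vs)" if "y \<in> carrier H" for y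
    using multilinear_mapsD(2)[OF f, of "us @ us'" x "vs' @ vs" y] w[OF *] that by simp
  show "f (us @ (us' @ [r \<odot>\<^bsub>H\<^esub> x] @ vs') @ vs) = r \<odot>\<^bsub>N\<^esub> f (us @ (us' @ [x] @ vs') @ vs)"
    if "r \<in> carrier k" for r
    using multilinear_mapsD(3)[OF f, of "us @ us'" x "vs' @ vs" r] w[OF *] that by simp
qed

lemma multilinear_maps_slot:
  assumes f: "f \<in> multilinear_maps k H (l + Suc n) N" and us: "us \<in> words H l" and vs: "vs \<in> words H n"
  shows "(\<lambda>x. f (us @ x # vs)) \<in> linear_maps k H N"
proof -
  have "us @ [x] @ vs \<in> words H (l + Suc n)" if "x \<in> carrier H" for x
    using us vs that by (auto simp: words_def)
  note w = this
  show ?thesis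
    using w by (intro linear_mapsI) (use multilinear_mapsD[OF f] in auto)
qed

text \<open>The letter that varies lies in one of the two blocks, and the hypothesis for that block
  applies with the other block fixed.\<close>

lemma multilinear_maps_appendI:
  assumes l: "\<And>ys. ys \<in> words H n \<Longrightarrow> (\<lambda>xs. f (xs @ ys)) \<in> multilinear_maps k H m N"
    and r: "\<And>xs. xs \<in> words H m \<Longrightarrow> (\<lambda>ys. f (xs @ ys)) \<in> multilinear_maps k H n N"
  shows "f \<in> multilinear_maps k H (m + n) N"
proof (rule multilinear_mapsI)
  show "f xs \<in> carrier N" if "xs \<in> words H (m + n)" for xs
    using that by (auto elim!: words_addE dest!: l multilinear_mapsD(1))
  fix us x vs assume w: "us @ [x] @ vs \<in> words H (m + n)"
  have "(\<forall>y\<in>carrier H. f (us @ [x \<oplus>\<^bsub>H\<^esub> y] @ vs) = f (us @ [x] @ vs) \<oplus>\<^bsub>N\<^esub> f (us @ [y] @ vs)) \<and>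
    (\<forall>r\<in>carrier k. f (us @ [r \<odot>\<^bsub>H\<^esub> x] @ vs) = r \<odot>\<^bsub>N\<^esub> f (us @ [x] @ vs))"
  proof (cases "length us < m")
    case True
    \<comment> \<open>The first block has room for \<open>m - Suc (length us)\<close> letters after
      \<open>x\<close>; the suffix is cut there.\<close>
    define vs1 vs2 where vs12: "vs1 = take (m - Suc (length us)) vs" "vs2 = drop (m - Suc (length us)) vs"
    have vs: "vs = vs1 @ vs2" by (simp add: vs12)
    have len: "length (us @ [x] @ vs1) = m" using True w by (auto simp: vs12 words_def)
    have 1: "us @ [x] @ vs1 \<in> words H m" "vs2 \<in> words H n"
      using w words_append_iff[OF len, of vs2 H n] vs by auto
    show ?thesis
      using multilinear_mapsD(2,3)[OF l[OF 1(2)] 1(1)] by (simp add: vs)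
  next
    case False
    define us1 us2 where us12: "us1 = take m us" "us2 = drop m us"
    have us: "us = us1 @ us2" by (simp add: us12)
    have len: "length us1 = m" using False by (auto simp: us12)
    have 1: "us1 \<in> words H m" "us2 @ [x] @ vs \<in> words H n"
      using w words_append_iff[OF len, of "us2 @ [x] @ vs" H n] us by auto
    show ?thesis
      using multilinear_mapsD(2,3)[OF r[OF 1(1)] 1(2)] by (simp add: us)
  qed
  then show "\<And>y. y \<in> carrier H \<Longrightarrow> f (us @ [x \<oplus>\<^bsub>H\<^esub> y] @ vs) = f (us @ [x] @ vs) \<oplus>\<^bsub>N\<^esub> f (us @ [y] @ vs)"
    and "\<And>r. r \<in> carrier k \<Longrightarrow> f (us @ [r \<odot>\<^bsub>H\<^esub> x] @ vs) = r \<odot>\<^bsub>N\<^esub> f (us @ [x] @ vs)"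
    by auto
qed

text \<open>This form isolates one variable letter, so that rules for linear dependence on a single
  parameter yield multilinearity.\<close>

lemma multilinear_maps_slotI:
  assumes closed: "\<And>xs. xs \<in> words H n \<Longrightarrow> f xs \<in> carrier N"
    and slot: "\<And>i j us vs. \<lbrakk>n = i + Suc j; us \<in> words H i; vs \<in> words H j\<rbrakk> \<Longrightarrow>
      (\<lambda>x. f (us @ x # vs)) \<in> linear_maps k H N"
  shows "f \<in> multilinear_maps k H n N"
proof (rule multilinear_mapsI)
  fix us x vs assume w: "us @ [x] @ vs \<in> words H n"
  then have x: "x \<in> carrier H" by (auto simp: words_def)
  have "n = length us + Suc (length vs)" "us \<in> words H (length us)" "vs \<in> words H (length vs)"
    using w by (auto simp: words_def)
  note l = linear_mapsD[OF slot[OF this]]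
  show "f (us @ [x \<oplus>\<^bsub>H\<^esub> y] @ vs) = f (us @ [x] @ vs) \<oplus>\<^bsub>N\<^esub> f (us @ [y] @ vs)" if "y \<in> carrier H" for y
    using l(2)[OF x that] by simp
  show "f (us @ [r \<odot>\<^bsub>H\<^esub> x] @ vs) = r \<odot>\<^bsub>N\<^esub> f (us @ [x] @ vs)" if "r \<in> carrier k" for r
    using l(3)[OF that x] by simp
qed (rule closed)

lemma multilinear_maps_0: "f [] \<in> carrier N \<Longrightarrow> f \<in> multilinear_maps k H 0 N"
  by (rule multilinear_mapsI) auto

lemma multilinear_maps_1:
  assumes f: "(\<lambda>x. f [x]) \<in> linear_maps k H N"
  shows "f \<in> multilinear_maps k H (Suc 0) N"
proof (rule multilinear_mapsI)
  have us: "us = [] \<and> vs = [] \<and> x \<in> carrier H" if "us @ [x] @ vs \<in> words H (Suc 0)" for us x vs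
    using that by (auto simp: words_def)
  show "f xs \<in> carrier N" if "xs \<in> words H (Suc 0)" for xs
    using that linear_mapsD(1)[OF f] by (auto elim!: words_SucE)
  show "f (us @ [x \<oplus>\<^bsub>H\<^esub> y] @ vs) = f (us @ [x] @ vs) \<oplus>\<^bsub>N\<^esub> f (us @ [y] @ vs)"
    if "us @ [x] @ vs \<in> words H (Suc 0)" "y \<in> carrier H" for us x y vs
    using us[OF that(1)] linear_mapsD(2)[OF f, of x y] that by simp
  show "f (us @ [r \<odot>\<^bsub>H\<^esub> x] @ vs) = r \<odot>\<^bsub>N\<^esub> f (us @ [x] @ vs)"
    if "us @ [x] @ vs \<in> words H (Suc 0)" "r \<in> carrier k" for us r x vs
    using us[OF that(1)] linear_mapsD(3)[OF f, of r x] that by simp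
qed

text \<open>Peeling from this end suits word products and the zeroth face;
  \<open>multilinear_maps_snocI\<close> serves the operators that single out the last
  letter.\<close>

lemma multilinear_maps_ConsI:
  assumes "\<And>xs. xs \<in> words H n \<Longrightarrow> (\<lambda>x. f (x # xs)) \<in> linear_maps k H N"
    and "\<And>x. x \<in> carrier H \<Longrightarrow> (\<lambda>xs. f (x # xs)) \<in> multilinear_maps k H n N"
  shows "f \<in> multilinear_maps k H (Suc n) N"
proof -
  have "f \<in> multilinear_maps k H (Suc 0 + n) N"
    by (rule multilinear_maps_appendI) (use assms in \<open>auto intro!: multilinear_maps_1 elim!: words_SucE\<close>)
  then show ?thesis by simp
qed

lemma multilinear_maps_snocI:
  assumes "\<And>xs. xs \<in> words H n \<Longrightarrow> (\<lambda>x. f (xs @ [x])) \<in> linear_maps k H N"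
    and "\<And>x. x \<in> carrier H \<Longrightarrow> (\<lambda>xs. f (xs @ [x])) \<in> multilinear_maps k H n N"
  shows "f \<in> multilinear_maps k H (Suc n) N"
proof -
  have "f \<in> multilinear_maps k H (n + Suc 0) N"
    by (rule multilinear_maps_appendI) (use assms in \<open>auto intro!: multilinear_maps_1 elim!: words_SucE\<close>)
  then show ?thesis by simp
qed

lemma multilinear_maps_Cons:
  assumes f: "f \<in> multilinear_maps k H (Suc n) N"
  shows "xs \<in> words H n \<Longrightarrow> (\<lambda>x. f (x # xs)) \<in> linear_maps k H N"
    and "x \<in> carrier H \<Longrightarrow> (\<lambda>xs. f (x # xs)) \<in> multilinear_maps k H n N"
  using multilinear_maps_slot[of f k H 0 n N "[]" xs] multilinear_maps_append[of f k H "Suc 0" n 0 N "[x]" "[]"] f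
  by auto

lemma multilinear_maps_cong:
  assumes "module k H" and g: "g \<in> multilinear_maps k H n N" and eq: "\<And>xs. xs \<in> words H n \<Longrightarrow> f xs = g xs"
  shows "f \<in> multilinear_maps k H n N"
proof -
  interpret module k H by fact
  have w: "us @ [y] @ vs \<in> words H n" if "us @ [x] @ vs \<in> words H n" "y \<in> carrier H" for us x y vs
    using that by (auto simp: words_def)
  show ?thesis
  proof (rule multilinear_mapsI)
    fix us x y vs assume a: "us @ [x] @ vs \<in> words H n" "y \<in> carrier H"
    then have "x \<oplus>\<^bsub>H\<^esub> y \<in> carrier H" by (auto simp: words_def)
    then show "f (us @ [x \<oplus>\<^bsub>H\<^esub> y] @ vs) = f (us @ [x] @ vs) \<oplus>\<^bsub>N\<^esub> f (us @ [y] @ vs)"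
      using a w[OF a(1)] by (simp only: eq multilinear_mapsD[OF g])
  next
    fix us r x vs assume a: "us @ [x] @ vs \<in> words H n" "r \<in> carrier k"
    then have "r \<odot>\<^bsub>H\<^esub> x \<in> carrier H" by (auto simp: words_def)
    then show "f (us @ [r \<odot>\<^bsub>H\<^esub> x] @ vs) = r \<odot>\<^bsub>N\<^esub> f (us @ [x] @ vs)"
      using a w[OF a(1)] by (simp only: eq multilinear_mapsD[OF g])
  qed (simp add: eq multilinear_mapsD[OF g])
qed

section \<open>Evaluating lifts from tensor powers\<close>

context
  fixes k :: "('k, 'a) ring_scheme" and H :: "('k, 'h, 'b) module_scheme"
  assumes H: "module k H"
begin

text \<open>Since the chosen representative is a genuine element of the free module, the facts about
  \<open>free_lift\<close> transfer to \<open>tensor_lift\<close> for closed integrands, whether or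
  not these are multilinear.\<close>

lemma tensor_representative:
  assumes "t \<in> carrier (tensor_power k H n)"
  shows "(SOME p. p \<in> t) \<in> carrier (free_words k H n)"
proof -
  let ?F = "free_words k H n" and ?N = "tensor_null k H n"
  note Q = free_words_module[OF H, of n] tensor_null_submodule[OF H, of n]
  interpret F: module k ?F by (rule Q)
  interpret N: abelian_subgroup ?N ?F by (rule quotient_subgroup[OF Q])
  obtain p where p: "p \<in> carrier ?F" "t = ?N +>\<^bsub>?F\<^esub> p"
    using assms by (auto simp: tensor_power_def quotient_carrier[OF Q])
  have "(SOME q. q \<in> t) \<in> t"
    using N.a_rcos_self[OF p(1)] p(2) some_in_eq by blast
  then show ?thesis
    using p N.a_subset by (auto simp: a_r_coset_def r_coset_def)
qed

lemma tensor_lift_closed: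
  assumes "module k N" "\<And>w. w \<in> words H n \<Longrightarrow> f w \<in> carrier N" "t \<in> carrier (tensor_power k H n)"
  shows "tensor_lift k N f t \<in> carrier N"
  unfolding tensor_lift_free_lift
  using free_lift_linear[OF assms(1)] tensor_representative[OF assms(3)] assms(2)
  by (blast dest: linear_mapsD(1))

lemma tensor_lift_cong:
  assumes "module k N" "t \<in> carrier (tensor_power k H n)" "\<And>w. w \<in> words H n \<Longrightarrow> f w = g w"
    "\<And>w. w \<in> words H n \<Longrightarrow> g w \<in> carrier N"
  shows "tensor_lift k N f t = tensor_lift k N g t"
  unfolding tensor_lift_free_lift
  by (rule free_lift_cong[OF tensor_representative[OF assms(2)] assms(3,1)]) (use assms(4) in auto)

lemma tensor_lift_compose:
  assumes "module k N" "module k P" "g \<in> linear_maps k N P"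
    "\<And>w. w \<in> words H n \<Longrightarrow> f w \<in> carrier N" "t \<in> carrier (tensor_power k H n)"
  shows "g (tensor_lift k N f t) = tensor_lift k P (\<lambda>w. g (f w)) t"
  unfolding tensor_lift_free_lift
  by (rule free_lift_compose[OF assms(1-3) _ tensor_representative[OF assms(5)]]) (use assms(4) in auto)

lemma tensor_lift_swap:
  assumes "module k N" "\<And>v w. \<lbrakk>v \<in> words H m; w \<in> words H n\<rbrakk> \<Longrightarrow> F v w \<in> carrier N"
    "t \<in> carrier (tensor_power k H m)" "u \<in> carrier (tensor_power k H n)"
  shows "tensor_lift k N (\<lambda>v. tensor_lift k N (F v) u) t = tensor_lift k N (\<lambda>w. tensor_lift k N (\<lambda>v. F v w) t) u"
  unfolding tensor_lift_free_lift
  by (rule free_lift_swap[OF assms(1,2) assms(3,4)[THEN tensor_representative]])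

lemma tensor_lift_parameter_linear:
  assumes "module k N" "\<And>w. w \<in> words H n \<Longrightarrow> (\<lambda>x. F x w) \<in> linear_maps k X N"
    "t \<in> carrier (tensor_power k H n)"
  shows "(\<lambda>x. tensor_lift k N (F x) t) \<in> linear_maps k X N"
  unfolding tensor_lift_free_lift
  by (rule free_lift_parameter_linear[OF assms(1,2) tensor_representative[OF assms(3)]])

text \<open>The uniqueness half of the universal property. Identities between operators are reduced
  to pure tensors through this lemma.\<close>

lemma tensor_power_ext:
  assumes "module k N" and f: "f \<in> linear_maps k (tensor_power k H n) N"
    and g: "g \<in> linear_maps k (tensor_power k H n) N"
    and eq: "\<And>xs. xs \<in> words H n \<Longrightarrow> f (pure_tensor k H xs) = g (pure_tensor k H xs)"
    and t: "t \<in> carrier (tensor_power k H n)"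
  shows "f t = g t"
proof -
  have gm: "(\<lambda>xs. g (pure_tensor k H xs)) \<in> multilinear_maps k H n N"
    by (rule multilinear_maps_compose[OF g pure_tensor_multilinear[OF H]])
  have "f t = tensor_lift k N (\<lambda>xs. g (pure_tensor k H xs)) t"
    by (rule tensor_lift_unique[OF H assms(1) gm f eq t])
  also have "\<dots> = g t"
    by (rule tensor_lift_unique[OF H assms(1) gm g refl t, symmetric])
  finally show ?thesis .
qed

end

section \<open>Sweedler sums\<close>

context hopf_algebra
begin

lemma module_H [simp]: "module k H" ..

lemma module_tensor_power [simp]: "module k (tensor_power k H n)"
  by (rule tensor_power_module) simp

lemma pure_tensor_closed [simp]: "xs \<in> words H n \<Longrightarrow> pure_tensor k H xs \<in> carrier (tensor_power k H n)"
  using multilinear_mapsD(1)[OF pure_tensor_multilinear[OF module_H]] .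

lemma comult_closed [simp]: "h \<in> carrier H \<Longrightarrow> \<Delta> h \<in> carrier (tensor_power k H 2)"
  using linear_mapsD(1)[OF comult_linear] .

lemma antipode_closed [simp]: "h \<in> carrier H \<Longrightarrow> S h \<in> carrier H"
  using linear_mapsD(1)[OF antipode_linear] .

lemma smult_closed_module [simp]:
  "\<lbrakk>module k N; r \<in> carrier k; x \<in> carrier N\<rbrakk> \<Longrightarrow> r \<odot>\<^bsub>N\<^esub> x \<in> carrier N"
  by (rule module.smult_closed)

lemma smult_one_module [simp]: "\<lbrakk>module k N; x \<in> carrier N\<rbrakk> \<Longrightarrow> \<one>\<^bsub>k\<^esub> \<odot>\<^bsub>N\<^esub> x = x"
  by (rule module.smult_one)

lemma smult_smult_module:
  "\<lbrakk>module k N; r \<in> carrier k; s \<in> carrier k; x \<in> carrier N\<rbrakk> \<Longrightarrow>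
    r \<odot>\<^bsub>N\<^esub> (s \<odot>\<^bsub>N\<^esub> x) = (r \<otimes>\<^bsub>k\<^esub> s) \<odot>\<^bsub>N\<^esub> x"
  by (simp add: module.smult_assoc1)

lemma smult_commute_module:
  "\<lbrakk>module k N; r \<in> carrier k; s \<in> carrier k; x \<in> carrier N\<rbrakk> \<Longrightarrow>
    r \<odot>\<^bsub>N\<^esub> (s \<odot>\<^bsub>N\<^esub> x) = s \<odot>\<^bsub>N\<^esub> (r \<odot>\<^bsub>N\<^esub> x)"
  by (simp add: smult_smult_module R.m_comm)

lemma characterD:
  assumes "character k H \<chi>"
  shows "h \<in> carrier H \<Longrightarrow> \<chi> h \<in> carrier k"
    and "\<lbrakk>x \<in> carrier H; y \<in> carrier H\<rbrakk> \<Longrightarrow> \<chi> (x \<otimes> y) = \<chi> x \<otimes>\<^bsub>k\<^esub> \<chi> y"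
    and "\<chi> \<one> = \<one>\<^bsub>k\<^esub>"
    and "\<lbrakk>x \<in> carrier H; y \<in> carrier H\<rbrakk> \<Longrightarrow> \<chi> (x \<oplus> y) = \<chi> x \<oplus>\<^bsub>k\<^esub> \<chi> y"
    and "\<lbrakk>r \<in> carrier k; h \<in> carrier H\<rbrakk> \<Longrightarrow> \<chi> (r \<odot> h) = r \<otimes>\<^bsub>k\<^esub> \<chi> h"
  using assms by (auto simp: character_def dest: ring_hom_memE)

lemmas counit = characterD[OF counit_character]

declare counit(1,3) [simp]

text \<open>\<open>sweedler N F h\<close> is \<open>\<Sum> F h' h''\<close>. Values of \<open>F\<close> outside \<open>N\<close> and arguments \<open>h\<close> outside \<open>H\<close>
  are sent to zero, so that the congruence and closure rules need no side conditions.\<close>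

definition sweedler :: "('a, 'n, 'e) module_scheme \<Rightarrow> ('b \<Rightarrow> 'b \<Rightarrow> 'n) \<Rightarrow> 'b \<Rightarrow> 'n"
  where "sweedler N F h =
    (if h \<in> carrier H
     then tensor_lift k N (\<lambda>w. if w \<in> words H 2 \<and> F (w ! 0) (w ! 1) \<in> carrier N
                              then F (w ! 0) (w ! 1) else \<zero>\<^bsub>N\<^esub>) (\<Delta> h)
     else \<zero>\<^bsub>N\<^esub>)"

definition bilinear_maps :: "('a, 'n, 'e) module_scheme \<Rightarrow> ('b \<Rightarrow> 'b \<Rightarrow> 'n) set"
  where "bilinear_maps N =
    {F. (\<forall>a\<in>carrier H. F a \<in> linear_maps k H N) \<and>
        (\<forall>b\<in>carrier H. (\<lambda>a. F a b) \<in> linear_maps k H N)}"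

lemma zero_closed_module: "module k N \<Longrightarrow> \<zero>\<^bsub>N\<^esub> \<in> carrier N"
  by (simp add: module_def abelian_group_def abelian_monoid.zero_closed)

lemma sweedler_closed [simp]: "module k N \<Longrightarrow> sweedler N F h \<in> carrier N"
  unfolding sweedler_def
  by (auto intro!: tensor_lift_closed[OF module_H, where n = 2] simp: zero_closed_module)

lemma words_2: "w \<in> words H 2 \<Longrightarrow> w = [w ! 0, w ! 1] \<and> w ! 0 \<in> carrier H \<and> w ! 1 \<in> carrier H"
  by (auto simp: numeral_2_eq_2 elim!: words_SucE)

lemma sweedler_cong:
  assumes "h = h'" "\<And>a b. \<lbrakk>a \<in> carrier H; b \<in> carrier H\<rbrakk> \<Longrightarrow> F a b = G a b"
  shows "sweedler N F h = sweedler N G h'"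
proof -
  have "(\<lambda>w. if w \<in> words H 2 \<and> F (w ! 0) (w ! 1) \<in> carrier N then F (w ! 0) (w ! 1) else \<zero>\<^bsub>N\<^esub>) =
    (\<lambda>w. if w \<in> words H 2 \<and> G (w ! 0) (w ! 1) \<in> carrier N then G (w ! 0) (w ! 1) else \<zero>\<^bsub>N\<^esub>)"
    using assms(2) words_2 by (intro ext) metis
  then show ?thesis by (simp add: sweedler_def assms(1) del: One_nat_def)
qed

text \<open>As a congruence rule this gives every rewrite under a Sweedler sum the assumption that
  both legs lie in \<open>H\<close>, which the conditional ring and module laws require.\<close>

lemma sweedler_cong_strong [cong]:
  assumes "N = N'" "h = h'" "\<And>a b. \<lbrakk>a \<in> carrier H; b \<in> carrier H\<rbrakk> \<Longrightarrow> F a b = G a b"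
  shows "sweedler N F h = sweedler N' G h'"
  unfolding assms(1) by (rule sweedler_cong[OF assms(2,3)])

lemma sweedler_tensor_lift:
  assumes "module k N" "h \<in> carrier H" "\<And>a b. \<lbrakk>a \<in> carrier H; b \<in> carrier H\<rbrakk> \<Longrightarrow> F a b \<in> carrier N"
  shows "tensor_lift k N (\<lambda>w. F (w ! 0) (w ! 1)) (\<Delta> h) = sweedler N F h"
  using assms words_2
  by (auto simp: sweedler_def zero_closed_module
      intro!: tensor_lift_cong[OF module_H assms(1) comult_closed])

lemma sweedler_compose:
  assumes N: "module k N" and P: "module k P" and g: "g \<in> linear_maps k N P"
    and F: "\<And>a b. \<lbrakk>a \<in> carrier H; b \<in> carrier H\<rbrakk> \<Longrightarrow> F a b \<in> carrier N"
  shows "g (sweedler N F h) = sweedler P (\<lambda>a b. g (F a b)) h"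
proof (cases "h \<in> carrier H")
  case True
  have "g (tensor_lift k N (\<lambda>w. F (w ! 0) (w ! 1)) (\<Delta> h)) =
      tensor_lift k P (\<lambda>w. g (F (w ! 0) (w ! 1))) (\<Delta> h)"
    by (rule tensor_lift_compose[OF module_H N P g _ comult_closed[OF True]]) (use F words_2 in auto)
  then show ?thesis
    using True F by (simp add: sweedler_tensor_lift[symmetric] N P linear_mapsD(1)[OF g] del: One_nat_def)
next
  case False
  then show ?thesis by (simp add: sweedler_def linear_maps_zero_minus(1)[OF N P g])
qed

lemma sweedler_swap:
  assumes N: "module k N" and x: "x \<in> carrier H" and y: "y \<in> carrier H"
    and F: "\<And>a b c d. \<lbrakk>a \<in> carrier H; b \<in> carrier H; c \<in> carrier H; d \<in> carrier H\<rbrakk> \<Longrightarrow> F a b c d \<in> carrier N"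
  shows "sweedler N (\<lambda>a b. sweedler N (F a b) y) x = sweedler N (\<lambda>c d. sweedler N (\<lambda>a b. F a b c d) x) y"
proof -
  have "tensor_lift k N (\<lambda>v. tensor_lift k N (\<lambda>w. F (v ! 0) (v ! 1) (w ! 0) (w ! 1)) (\<Delta> y)) (\<Delta> x) =
      tensor_lift k N (\<lambda>w. tensor_lift k N (\<lambda>v. F (v ! 0) (v ! 1) (w ! 0) (w ! 1)) (\<Delta> x)) (\<Delta> y)"
    by (rule tensor_lift_swap[OF module_H N _ comult_closed[OF x] comult_closed[OF y]]) (use F words_2 in auto)
  also have "\<dots> = tensor_lift k N (\<lambda>w. sweedler N (\<lambda>a b. F a b (w ! 0) (w ! 1)) x) (\<Delta> y)"
    using F words_2 x
    by (intro tensor_lift_cong[OF module_H N comult_closed[OF y]]) (auto simp: N simp del: One_nat_def intro!: sweedler_tensor_lift)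
  also have "tensor_lift k N (\<lambda>v. tensor_lift k N (\<lambda>w. F (v ! 0) (v ! 1) (w ! 0) (w ! 1)) (\<Delta> y)) (\<Delta> x) =
      tensor_lift k N (\<lambda>v. sweedler N (F (v ! 0) (v ! 1)) y) (\<Delta> x)"
    using F words_2 y
    by (intro tensor_lift_cong[OF module_H N comult_closed[OF x]]) (auto simp: N simp del: One_nat_def intro!: sweedler_tensor_lift)
  finally show ?thesis by (simp add: sweedler_tensor_lift[symmetric] N x y)
qed

lemma bilinear_mapsI:
  assumes "\<And>a. a \<in> carrier H \<Longrightarrow> (\<lambda>b. F a b) \<in> linear_maps k H N"
    and "\<And>b. b \<in> carrier H \<Longrightarrow> (\<lambda>a. F a b) \<in> linear_maps k H N"
  shows "F \<in> bilinear_maps N"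
  using assms by (simp add: bilinear_maps_def)

lemma bilinear_mapsD:
  assumes F: "F \<in> bilinear_maps N"
  shows "\<lbrakk>a \<in> carrier H; f \<in> linear_maps k X H\<rbrakk> \<Longrightarrow> (\<lambda>x. F a (f x)) \<in> linear_maps k X N"
    and "\<lbrakk>b \<in> carrier H; f \<in> linear_maps k X H\<rbrakk> \<Longrightarrow> (\<lambda>x. F (f x) b) \<in> linear_maps k X N"
    and "\<lbrakk>a \<in> carrier H; b \<in> carrier H\<rbrakk> \<Longrightarrow> F a b \<in> carrier N"
  using F linear_maps_compose[where g = "F a" and f = f and M = X and N = H and P = N and k = k]
    linear_maps_compose[where g = "\<lambda>a. F a b" and f = f and M = X and N = H and P = N and k = k]
  by (auto simp: bilinear_maps_def dest: linear_mapsD(1))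

lemma bilinear_multilinear:
  assumes F: "F \<in> bilinear_maps N"
  shows "(\<lambda>w. F (w ! 0) (w ! 1)) \<in> multilinear_maps k H 2 N"
  unfolding numeral_2_eq_2
  by (intro multilinear_maps_ConsI multilinear_maps_1; auto elim!: words_SucE intro!: bilinear_mapsD[OF F] linear_maps_ident)

text \<open>Linearity in the argument is inherited from \<open>\<Delta>\<close>, because a bilinear
  \<open>F\<close> makes the lift independent of the chosen representative.\<close>

lemma sweedler_linear:
  assumes N: "module k N" and F: "F \<in> bilinear_maps N"
  shows "sweedler N F \<in> linear_maps k H N"
proof (rule linear_maps_cong[OF module_H linear_maps_compose[OF tensor_lift_linear[OF module_H N bilinear_multilinear[OF F]] comult_linear]])
  show "h \<in> carrier H \<Longrightarrow> sweedler N F h = tensor_lift k N (\<lambda>w. F (w ! 0) (w ! 1)) (\<Delta> h)" for h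
    by (simp add: sweedler_tensor_lift[symmetric] N bilinear_mapsD[OF F])
qed

lemma sweedler_linear_compose:
  assumes "module k N" "F \<in> bilinear_maps N" "f \<in> linear_maps k X H"
  shows "(\<lambda>x. sweedler N F (f x)) \<in> linear_maps k X N"
  by (rule linear_maps_compose[OF sweedler_linear[OF assms(1,2)] assms(3)])

lemma sweedler_parameter_linear:
  assumes X: "module k X" and N: "module k N" and h: "h \<in> carrier H"
    and F: "\<And>a b. \<lbrakk>a \<in> carrier H; b \<in> carrier H\<rbrakk> \<Longrightarrow> (\<lambda>x. F x a b) \<in> linear_maps k X N"
  shows "(\<lambda>x. sweedler N (F x) h) \<in> linear_maps k X N"
proof (rule linear_maps_cong[OF X])
  show "(\<lambda>x. tensor_lift k N (\<lambda>w. F x (w ! 0) (w ! 1)) (\<Delta> h)) \<in> linear_maps k X N"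
    by (rule tensor_lift_parameter_linear[OF module_H N _ comult_closed[OF h]]) (use F words_2 in auto)
  show "sweedler N (F x) h = tensor_lift k N (\<lambda>w. F x (w ! 0) (w ! 1)) (\<Delta> h)" if "x \<in> carrier X" for x
    using that by (intro sweedler_tensor_lift[symmetric] N h) (rule linear_mapsD(1)[OF F])
qed

lemma mult_linear_left:
  assumes "f \<in> linear_maps k X H" "c \<in> carrier H"
  shows "(\<lambda>x. f x \<otimes> c) \<in> linear_maps k X H"
  by (rule linear_mapsI) (auto simp: linear_mapsD[OF assms(1)] assms(2) M.l_distr smult_mult_left)

lemma mult_linear_right:
  assumes "f \<in> linear_maps k X H" "c \<in> carrier H"
  shows "(\<lambda>x. c \<otimes> f x) \<in> linear_maps k X H"
  by (rule linear_mapsI) (auto simp: linear_mapsD[OF assms(1)] assms(2) M.r_distr smult_mult_right)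

lemma character_smult_linear:
  assumes \<chi>: "character k H \<chi>" and N: "module k N" and f: "f \<in> linear_maps k X H" and c: "c \<in> carrier N"
  shows "(\<lambda>x. \<chi> (f x) \<odot>\<^bsub>N\<^esub> c) \<in> linear_maps k X N"
proof -
  interpret N: module k N by fact
  show ?thesis
    by (rule linear_mapsI)
      (auto simp: linear_mapsD[OF f] characterD[OF \<chi>] c N.smult_l_distr N.smult_assoc1)
qed

lemmas antipode_linear_compose = linear_maps_compose[OF antipode_linear]
lemmas smult_linear = linear_maps_smult[where k = k]

text \<open>A variable may occur in the argument of a Sweedler sum or in its integrand;
  \<open>sweedler_linear_compose\<close> and \<open>sweedler_parameter_linear\<close> cover the two
  cases, so these rules handle nested sums by recursion on the expression.\<close>

lemmas linear_intros = linear_maps_ident antipode_linear_compose mult_linear_left mult_linear_right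
  character_smult_linear[OF counit_character] smult_linear sweedler_linear_compose
  sweedler_parameter_linear bilinear_mapsI

section \<open>The Hopf axioms as rules for Sweedler sums\<close>

lemma sweedler_pure:
  assumes N: "module k N" and F: "F \<in> bilinear_maps N"
    and h: "h \<in> carrier H" "a \<in> carrier H" "b \<in> carrier H" "\<Delta> h = pure_tensor k H [a, b]"
  shows "sweedler N F h = F a b"
proof -
  have "sweedler N F h = tensor_lift k N (\<lambda>w. F (w ! 0) (w ! 1)) (pure_tensor k H [a, b])"
    using sweedler_tensor_lift[OF N h(1), of F] bilinear_mapsD(3)[OF F] h(4) by simp
  also have "\<dots> = F a b"
    using tensor_lift_pure[OF module_H N bilinear_multilinear[OF F], of "[a, b]"] h
    by (simp add: numeral_2_eq_2)
  finally show ?thesis .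
qed

lemma sweedler_one: "\<lbrakk>module k N; F \<in> bilinear_maps N\<rbrakk> \<Longrightarrow> sweedler N F \<one> = F \<one> \<one>"
  by (rule sweedler_pure) (simp_all add: comult_one)

text \<open>\<open>comult_mult\<close> is an equation in the tensor square. The bilinear
  \<open>F\<close> induces a linear map \<open>g\<close> on it, and \<open>g\<close> applied to the
  equation gives a rule for sums.\<close>

lemma sweedler_mult:
  assumes N: "module k N" and F: "F \<in> bilinear_maps N" and x: "x \<in> carrier H" and y: "y \<in> carrier H"
  shows "sweedler N F (x \<otimes> y) = sweedler N (\<lambda>a b. sweedler N (\<lambda>c d. F (a \<otimes> c) (b \<otimes> d)) y) x"
proof -
  let ?T = "tensor_power k H 2"
  define g where "g = tensor_lift k N (\<lambda>w. F (w ! 0) (w ! 1))"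
  have g: "g \<in> linear_maps k ?T N"
    unfolding g_def by (rule tensor_lift_linear[OF module_H N bilinear_multilinear[OF F]])
  have p: "[a, b] \<in> words H 2" if "a \<in> carrier H" "b \<in> carrier H" for a b
    using that by (simp add: numeral_2_eq_2)
  have gp: "g (pure_tensor k H [a, b]) = F a b" if "a \<in> carrier H" "b \<in> carrier H" for a b
    using tensor_lift_pure[OF module_H N bilinear_multilinear[OF F] p[OF that]] by (simp add: g_def)
  have "\<Delta> (x \<otimes> y) = tensor_lift k ?T
      (\<lambda>xs. sweedler ?T (\<lambda>c d. pure_tensor k H [xs ! 0 \<otimes> c, xs ! 1 \<otimes> d]) y) (\<Delta> x)"
    unfolding comult_mult[OF x y] tensor_square_mult_def
  proof (rule tensor_lift_cong[OF module_H module_tensor_power comult_closed[OF x]])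
    fix xs assume "xs \<in> words H 2"
    then show "tensor_lift k ?T (\<lambda>ys. pure_tensor k H [xs ! 0 \<otimes> ys ! 0, xs ! 1 \<otimes> ys ! 1]) (\<Delta> y) =
        sweedler ?T (\<lambda>c d. pure_tensor k H [xs ! 0 \<otimes> c, xs ! 1 \<otimes> d]) y"
      using words_2[of xs] y p by (intro sweedler_tensor_lift) auto
  qed simp
  also have "\<dots> = sweedler ?T (\<lambda>a b. sweedler ?T (\<lambda>c d. pure_tensor k H [a \<otimes> c, b \<otimes> d]) y) x"
    by (intro sweedler_tensor_lift) (simp_all add: x)
  finally have "g (\<Delta> (x \<otimes> y)) = sweedler N (\<lambda>a b. sweedler N (\<lambda>c d. F (a \<otimes> c) (b \<otimes> d)) y) x"
    by (simp add: sweedler_compose[OF module_tensor_power N g] p gp)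
  moreover have "g (\<Delta> (x \<otimes> y)) = sweedler N F (x \<otimes> y)"
    unfolding g_def by (intro sweedler_tensor_lift N bilinear_mapsD[OF F]) (simp_all add: x y)
  ultimately show ?thesis by simp
qed

text \<open>As in \<open>sweedler_mult\<close>, the trilinear \<open>F\<close> induces a linear map
  \<open>g\<close> on the third tensor power, and \<open>g\<close> is applied to the axiom
  \<open>coassociative\<close>.\<close>

lemma sweedler_coassoc:
  assumes N: "module k N" and h: "h \<in> carrier H"
    and F1: "\<And>b c. \<lbrakk>b \<in> carrier H; c \<in> carrier H\<rbrakk> \<Longrightarrow> (\<lambda>a. F a b c) \<in> linear_maps k H N"
    and F2: "\<And>a c. \<lbrakk>a \<in> carrier H; c \<in> carrier H\<rbrakk> \<Longrightarrow> (\<lambda>b. F a b c) \<in> linear_maps k H N"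
    and F3: "\<And>a b. \<lbrakk>a \<in> carrier H; b \<in> carrier H\<rbrakk> \<Longrightarrow> (\<lambda>c. F a b c) \<in> linear_maps k H N"
  shows "sweedler N (\<lambda>a b. sweedler N (\<lambda>c d. F c d b) a) h = sweedler N (\<lambda>a b. sweedler N (F a) b) h"
proof -
  let ?T = "tensor_power k H 3"
  define g where "g = tensor_lift k N (\<lambda>w. F (w ! 0) (w ! 1) (w ! 2))"
  have Fm: "(\<lambda>w. F (w ! 0) (w ! 1) (w ! 2)) \<in> multilinear_maps k H 3 N"
    unfolding numeral_3_eq_3
    by (intro multilinear_maps_ConsI multilinear_maps_1; auto elim!: words_SucE intro!: F1 F2 F3 simp: numeral_2_eq_2)
  have g: "g \<in> linear_maps k ?T N"
    unfolding g_def by (rule tensor_lift_linear[OF module_H N Fm])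
  have p1: "[a] \<in> words H 1" if "a \<in> carrier H" for a using that by simp
  have p: "[a, b, c] \<in> words H 3" if "a \<in> carrier H" "b \<in> carrier H" "c \<in> carrier H" for a b c
    using that by (simp add: numeral_3_eq_3)
  have gp: "g (pure_tensor k H [a, b, c]) = F a b c" if "a \<in> carrier H" "b \<in> carrier H" "c \<in> carrier H" for a b c
    using tensor_lift_pure[OF module_H N Fm p[OF that]] by (simp add: g_def)
  have Fc: "F a b c \<in> carrier N" if "a \<in> carrier H" "b \<in> carrier H" "c \<in> carrier H" for a b c
    using linear_mapsD(1)[OF F1] that by blast
  have pm: "pure_tensor k H \<in> multilinear_maps k H 3 ?T"
    by (rule pure_tensor_multilinear) simp
  \<comment> \<open>The axiom is phrased with \<open>tensor_append\<close>. The facts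
    \<open>l\<close> and \<open>r\<close> evaluate its two forms as Sweedler sums of pure
    tensors.\<close>
  have "tensor_append k H 3 (\<Delta> a) (pure_tensor k H [b]) =
      sweedler ?T (\<lambda>c d. pure_tensor k H [c, d, b]) a" if ab: "a \<in> carrier H" "b \<in> carrier H" for a b
  proof -
    have "tensor_append k H 3 (\<Delta> a) (pure_tensor k H [b]) =
        tensor_lift k ?T (\<lambda>xs. pure_tensor k H [xs ! 0, xs ! 1, b]) (\<Delta> a)"
      unfolding tensor_append_def
    proof (rule tensor_lift_cong[OF module_H module_tensor_power comult_closed[OF ab(1)]])
      fix xs assume xs: "xs \<in> words H 2"
      then have "(\<lambda>ys. pure_tensor k H (xs @ ys)) \<in> multilinear_maps k H 1 ?T"
        using multilinear_maps_append[of "pure_tensor k H" k H 2 1 0 ?T xs "[]"] pm by simp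
      from tensor_lift_pure[OF module_H module_tensor_power this p1[OF ab(2)]]
      show "tensor_lift k ?T (\<lambda>ys. pure_tensor k H (xs @ ys)) (pure_tensor k H [b]) =
          pure_tensor k H [xs ! 0, xs ! 1, b]"
        using words_2[OF xs] by (metis append_Cons append_Nil)
      show "pure_tensor k H [xs ! 0, xs ! 1, b] \<in> carrier ?T"
        using words_2[OF xs] ab by (intro pure_tensor_closed p) auto
    qed
    also have "\<dots> = sweedler ?T (\<lambda>c d. pure_tensor k H [c, d, b]) a"
      using ab by (intro sweedler_tensor_lift) (simp_all add: p)
    finally show ?thesis .
  qed
  note l = this
  have "tensor_append k H 3 (pure_tensor k H [a]) (\<Delta> b) =
      sweedler ?T (\<lambda>c d. pure_tensor k H [a, c, d]) b" if ab: "a \<in> carrier H" "b \<in> carrier H" for a b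
  proof -
    \<comment> \<open>Here the outer lift meets a pure tensor, so the inner lift, with
      \<open>\<Delta> b\<close> fixed, has to be linear in the letter of \<open>xs\<close>.\<close>
    have m: "(\<lambda>xs. tensor_lift k ?T (\<lambda>ys. pure_tensor k H (xs @ ys)) (\<Delta> b)) \<in> multilinear_maps k H 1 ?T"
    proof -
      have "(\<lambda>x. pure_tensor k H (x # w)) \<in> linear_maps k H ?T" if "w \<in> words H 2" for w
        using multilinear_maps_Cons(1)[of "pure_tensor k H" k H 2 ?T w] pm that by (simp add: numeral_3_eq_3)
      then have "(\<lambda>x. tensor_lift k ?T (\<lambda>ys. pure_tensor k H ([x] @ ys)) (\<Delta> b)) \<in> linear_maps k H ?T"
        by (intro tensor_lift_parameter_linear[OF module_H module_tensor_power _ comult_closed[OF ab(2)]]) simp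
      then show ?thesis unfolding One_nat_def by (rule multilinear_maps_1)
    qed
    have "tensor_append k H 3 (pure_tensor k H [a]) (\<Delta> b) =
        tensor_lift k ?T (\<lambda>ys. pure_tensor k H ([a] @ ys)) (\<Delta> b)"
      unfolding tensor_append_def
      by (rule tensor_lift_pure[OF module_H module_tensor_power m p1[OF ab(1)]])
    also have "\<dots> = tensor_lift k ?T (\<lambda>xs. pure_tensor k H [a, xs ! 0, xs ! 1]) (\<Delta> b)"
    proof (rule tensor_lift_cong[OF module_H module_tensor_power comult_closed[OF ab(2)]])
      fix xs assume xs: "xs \<in> words H 2"
      show "pure_tensor k H ([a] @ xs) = pure_tensor k H [a, xs ! 0, xs ! 1]"
        using words_2[OF xs] by (metis append_Cons append_Nil)
      show "pure_tensor k H [a, xs ! 0, xs ! 1] \<in> carrier ?T"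
        using words_2[OF xs] ab by (intro pure_tensor_closed p) auto
    qed
    also have "\<dots> = sweedler ?T (\<lambda>c d. pure_tensor k H [a, c, d]) b"
      using ab by (intro sweedler_tensor_lift) (simp_all add: p)
    finally show ?thesis .
  qed
  note r = this
  have "sweedler ?T (\<lambda>a b. sweedler ?T (\<lambda>c d. pure_tensor k H [c, d, b]) a) h =
      sweedler ?T (\<lambda>a b. tensor_append k H 3 (\<Delta> a) (pure_tensor k H [b])) h"
    by (simp add: l)
  also have "\<dots> = tensor_lift k ?T (\<lambda>ab. tensor_append k H 3 (\<Delta> (ab ! 0)) (pure_tensor k H [ab ! 1])) (\<Delta> h)"
    by (rule sweedler_tensor_lift[symmetric]) (simp_all add: h l)
  also have "\<dots> = tensor_lift k ?T (\<lambda>ab. tensor_append k H 3 (pure_tensor k H [ab ! 0]) (\<Delta> (ab ! 1))) (\<Delta> h)"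
    by (rule coassociative[OF h])
  also have "\<dots> = sweedler ?T (\<lambda>a b. tensor_append k H 3 (pure_tensor k H [a]) (\<Delta> b)) h"
    by (rule sweedler_tensor_lift) (simp_all add: h r)
  also have "\<dots> = sweedler ?T (\<lambda>a b. sweedler ?T (\<lambda>c d. pure_tensor k H [a, c, d]) b) h"
    by (simp add: r)
  finally have "g (sweedler ?T (\<lambda>a b. sweedler ?T (\<lambda>c d. pure_tensor k H [c, d, b]) a) h) =
      g (sweedler ?T (\<lambda>a b. sweedler ?T (\<lambda>c d. pure_tensor k H [a, c, d]) b) h)" by simp
  then show ?thesis by (simp add: sweedler_compose[OF module_tensor_power N g] p gp)
qed

text \<open>An axiom valued in \<open>H\<close> is pushed through an arbitrary linear map
  \<open>g\<close>, so that it can be applied deep inside an expression. The next three lemmas do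
  the same.\<close>

lemma sweedler_counit_left:
  assumes N: "module k N" and g: "g \<in> linear_maps k H N" and h: "h \<in> carrier H"
  shows "sweedler N (\<lambda>a b. \<epsilon> a \<odot>\<^bsub>N\<^esub> g b) h = g h"
proof -
  have "sweedler H (\<lambda>a b. \<epsilon> a \<odot> b) h = h"
    using counit_left[OF h] by (subst (asm) sweedler_tensor_lift) (simp_all add: h)
  then have "g h = g (sweedler H (\<lambda>a b. \<epsilon> a \<odot> b) h)" by simp
  also have "\<dots> = sweedler N (\<lambda>a b. \<epsilon> a \<odot>\<^bsub>N\<^esub> g b) h"
    by (simp add: sweedler_compose[OF module_H N g] linear_mapsD[OF g])
  finally show ?thesis ..
qed

lemma sweedler_counit_right:
  assumes N: "module k N" and g: "g \<in> linear_maps k H N" and h: "h \<in> carrier H"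
  shows "sweedler N (\<lambda>a b. \<epsilon> b \<odot>\<^bsub>N\<^esub> g a) h = g h"
proof -
  have "sweedler H (\<lambda>a b. \<epsilon> b \<odot> a) h = h"
    using counit_right[OF h] by (subst (asm) sweedler_tensor_lift) (simp_all add: h)
  then have "g h = g (sweedler H (\<lambda>a b. \<epsilon> b \<odot> a) h)" by simp
  also have "\<dots> = sweedler N (\<lambda>a b. \<epsilon> b \<odot>\<^bsub>N\<^esub> g a) h"
    by (simp add: sweedler_compose[OF module_H N g] linear_mapsD[OF g])
  finally show ?thesis ..
qed

lemma sweedler_antipode_left:
  assumes N: "module k N" and g: "g \<in> linear_maps k H N" and h: "h \<in> carrier H"
  shows "sweedler N (\<lambda>a b. g (S a \<otimes> b)) h = \<epsilon> h \<odot>\<^bsub>N\<^esub> g \<one>"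
proof -
  have "sweedler H (\<lambda>a b. S a \<otimes> b) h = \<epsilon> h \<odot> \<one>"
    using antipode_left[OF h] by (subst (asm) sweedler_tensor_lift) (simp_all add: h)
  then have "g (\<epsilon> h \<odot> \<one>) = g (sweedler H (\<lambda>a b. S a \<otimes> b) h)" by simp
  also have "\<dots> = sweedler N (\<lambda>a b. g (S a \<otimes> b)) h"
    by (simp add: sweedler_compose[OF module_H N g])
  finally show ?thesis using h by (simp add: linear_mapsD[OF g])
qed

lemma sweedler_antipode_right:
  assumes N: "module k N" and g: "g \<in> linear_maps k H N" and h: "h \<in> carrier H"
  shows "sweedler N (\<lambda>a b. g (a \<otimes> S b)) h = \<epsilon> h \<odot>\<^bsub>N\<^esub> g \<one>"
proof -
  have "sweedler H (\<lambda>a b. a \<otimes> S b) h = \<epsilon> h \<odot> \<one>"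
    using antipode_right[OF h] by (subst (asm) sweedler_tensor_lift) (simp_all add: h)
  then have "g (\<epsilon> h \<odot> \<one>) = g (sweedler H (\<lambda>a b. a \<otimes> S b) h)" by simp
  also have "\<dots> = sweedler N (\<lambda>a b. g (a \<otimes> S b)) h"
    by (simp add: sweedler_compose[OF module_H N g])
  finally show ?thesis using h by (simp add: linear_mapsD[OF g])
qed

section \<open>The antipode\<close>

lemma antipode_one: "S \<one> = \<one>"
proof -
  have "sweedler H (\<lambda>a b. S a \<otimes> b) \<one> = S \<one> \<otimes> \<one>"
    by (rule sweedler_one) (auto intro!: linear_intros)
  then show ?thesis
    using sweedler_antipode_left[OF module_H linear_maps_ident, of \<one>] by simp
qed

text \<open>Apply the counit to the antipode law: the factor \<epsilon>(h'') removes the second leg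
  and leaves \<epsilon>(S h). Sweedler sums take values in a module record, so scalars are carried
  as multiples of \<open>\<one>\<close> and recovered at the end by
  \<open>\<epsilon>\<close>.\<close>

lemma counit_antipode: assumes h: "h \<in> carrier H" shows "\<epsilon> (S h) = \<epsilon> h"
proof -
  have g: "(\<lambda>x. \<epsilon> x \<odot> \<one>) \<in> linear_maps k H H" by (auto intro!: linear_intros)
  have "\<epsilon> h \<odot> \<one> = sweedler H (\<lambda>a b. \<epsilon> (S a \<otimes> b) \<odot> \<one>) h"
    by (subst sweedler_antipode_left[OF module_H g]) (simp_all add: h)
  also have "\<dots> = sweedler H (\<lambda>a b. \<epsilon> b \<odot> (\<epsilon> (S a) \<odot> \<one>)) h"
    by (simp add: counit smult_smult_module R.m_comm)
  also have "\<dots> = \<epsilon> (S h) \<odot> \<one>"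
    by (rule sweedler_counit_right) (auto intro!: linear_intros simp: h)
  finally have "\<epsilon> (\<epsilon> h \<odot> \<one>) = \<epsilon> (\<epsilon> (S h) \<odot> \<one>)" by simp
  then show ?thesis using h by (simp add: counit)
qed

lemma antipode_mult:
  assumes x: "x \<in> carrier H" and y: "y \<in> carrier H"
  shows "S (x \<otimes> y) = S y \<otimes> S x"
proof -
  \<comment> \<open>Both sides are convolution inverses of the product \<open>H \<otimes> H \<rightarrow> H\<close>.\<close>
  have r: "sweedler H (\<lambda>p q. sweedler H (\<lambda>r s. z \<otimes> ((p \<otimes> r) \<otimes> (S s \<otimes> S q))) d) b = \<epsilon> b \<odot> (\<epsilon> d \<odot> z)"
    if [simp]: "b \<in> carrier H" "d \<in> carrier H" "z \<in> carrier H" for b d z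
  proof -
    have "sweedler H (\<lambda>r s. z \<otimes> ((p \<otimes> r) \<otimes> (S s \<otimes> S q))) d = \<epsilon> d \<odot> (z \<otimes> (p \<otimes> S q))"
      if [simp]: "p \<in> carrier H" "q \<in> carrier H" for p q
    proof -
      have g: "(\<lambda>u. z \<otimes> (p \<otimes> u \<otimes> S q)) \<in> linear_maps k H H" by (auto intro!: linear_intros)
      have "sweedler H (\<lambda>r s. z \<otimes> ((p \<otimes> r) \<otimes> (S s \<otimes> S q))) d = sweedler H (\<lambda>r s. z \<otimes> (p \<otimes> (r \<otimes> S s) \<otimes> S q)) d"
        by (simp add: M.m_assoc)
      also have "\<dots> = \<epsilon> d \<odot> (z \<otimes> (p \<otimes> \<one> \<otimes> S q))"
        by (rule sweedler_antipode_right[OF module_H g]) simp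
      finally show ?thesis by simp
    qed
    moreover have "sweedler H (\<lambda>p q. \<epsilon> d \<odot> (z \<otimes> (p \<otimes> S q))) b = \<epsilon> b \<odot> (\<epsilon> d \<odot> (z \<otimes> \<one>))"
      by (rule sweedler_antipode_right[where g = "\<lambda>u. \<epsilon> d \<odot> (z \<otimes> u)"]) (auto intro!: linear_intros)
    ultimately show ?thesis by simp
  qed
  \<comment> \<open>The integrand of the triple convolution S(x1 y1) (x2 y2) S(y3) S(x3). Cancelling
    its last two blocks leaves S(x y); cancelling its first two leaves S(y) S(x).\<close>
  define E where "E = (\<lambda>x1 x2 x3 y1 y2 y3. S (x1 \<otimes> y1) \<otimes> ((x2 \<otimes> y2) \<otimes> (S y3 \<otimes> S x3)))"
  have E_closed [simp]: "E x1 x2 x3 y1 y2 y3 \<in> carrier H"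
    if "x1 \<in> carrier H" "x2 \<in> carrier H" "x3 \<in> carrier H" "y1 \<in> carrier H" "y2 \<in> carrier H" "y3 \<in> carrier H"
    for x1 x2 x3 y1 y2 y3 using that by (simp add: E_def)
  have "S (x \<otimes> y) = sweedler H (\<lambda>a b. \<epsilon> b \<odot> S (a \<otimes> y)) x"
    by (rule sweedler_counit_right[symmetric]) (auto intro!: linear_intros simp: x y)
  also have "\<dots> = sweedler H (\<lambda>a b. sweedler H (\<lambda>c d. \<epsilon> d \<odot> (\<epsilon> b \<odot> S (a \<otimes> c))) y) x"
    by (rule sweedler_cong[OF refl], rule sweedler_counit_right[symmetric]) (auto intro!: linear_intros simp: y)
  \<comment> \<open>Fact \<open>r\<close> is read backwards with \<open>z\<close> equal to S(a c):
    the two counits are expanded into the products that cancel to them.\<close>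
  also have "\<dots> = sweedler H (\<lambda>a b. sweedler H (\<lambda>c d.
      sweedler H (\<lambda>p q. sweedler H (\<lambda>r s. E a p q c r s) d) b) y) x"
    unfolding E_def by (simp add: r smult_commute_module)
  \<comment> \<open>The sums over \<open>x\<close> and \<open>y\<close> are interchanged so that
    both sums belonging to \<open>y\<close> are adjacent, and coassociativity applies to each
    variable in turn.\<close>
  also have "\<dots> = sweedler H (\<lambda>a b. sweedler H (\<lambda>p q. sweedler H (\<lambda>c d.
      sweedler H (\<lambda>r s. E a p q c r s) d) y) b) x"
    by (intro sweedler_cong refl sweedler_swap) (auto simp: y)
  also have "\<dots> = sweedler H (\<lambda>a b. sweedler H (\<lambda>p q. sweedler H (\<lambda>d s.
      sweedler H (\<lambda>c r. E a p q c r s) d) y) b) x"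
    unfolding E_def by (intro sweedler_cong refl sweedler_coassoc[symmetric]) (auto intro!: linear_intros simp: y)
  also have "\<dots> = sweedler H (\<lambda>b q. sweedler H (\<lambda>a p. sweedler H (\<lambda>d s.
      sweedler H (\<lambda>c r. E a p q c r s) d) y) b) x"
    unfolding E_def by (rule sweedler_coassoc[symmetric]) (auto intro!: linear_intros simp: x y)
  also have "\<dots> = sweedler H (\<lambda>b q. sweedler H (\<lambda>d s. sweedler H (\<lambda>a p.
      sweedler H (\<lambda>c r. E a p q c r s) d) b) y) x"
    by (intro sweedler_cong refl sweedler_swap) (auto simp: y)
  also have "\<dots> = sweedler H (\<lambda>b q. sweedler H (\<lambda>d s. \<epsilon> b \<odot> (\<epsilon> d \<odot> (S s \<otimes> S q))) y) x"
  proof (intro sweedler_cong refl)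
    fix b q d s assume [simp]: "b \<in> carrier H" "q \<in> carrier H" "d \<in> carrier H" "s \<in> carrier H"
    have "sweedler H (\<lambda>a p. sweedler H (\<lambda>c r. E a p q c r s) d) b =
        sweedler H (\<lambda>a p. sweedler H (\<lambda>c r. S (a \<otimes> c) \<otimes> (p \<otimes> r) \<otimes> (S s \<otimes> S q)) d) b"
      unfolding E_def by (simp add: M.m_assoc)
    \<comment> \<open>The two letterwise sums are reassembled into the coproduct of
      \<open>b \<otimes> d\<close>, where a single antipode law suffices.\<close>
    also have "\<dots> = sweedler H (\<lambda>u v. S u \<otimes> v \<otimes> (S s \<otimes> S q)) (b \<otimes> d)"
      by (rule sweedler_mult[symmetric]) (auto intro!: linear_intros)
    also have "\<dots> = \<epsilon> (b \<otimes> d) \<odot> (\<one> \<otimes> (S s \<otimes> S q))"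
      by (rule sweedler_antipode_left[where g = "\<lambda>u. u \<otimes> (S s \<otimes> S q)"]) (auto intro!: linear_intros)
    finally show "sweedler H (\<lambda>a p. sweedler H (\<lambda>c r. E a p q c r s) d) b = \<epsilon> b \<odot> (\<epsilon> d \<odot> (S s \<otimes> S q))"
      by (simp add: counit smult_smult_module)
  qed
  also have "\<dots> = sweedler H (\<lambda>b q. \<epsilon> b \<odot> (S y \<otimes> S q)) x"
  proof (intro sweedler_cong refl)
    fix b q assume [simp]: "b \<in> carrier H" "q \<in> carrier H"
    have "sweedler H (\<lambda>d s. \<epsilon> b \<odot> (\<epsilon> d \<odot> (S s \<otimes> S q))) y = sweedler H (\<lambda>d s. \<epsilon> d \<odot> (\<epsilon> b \<odot> (S s \<otimes> S q))) y"
      by (simp add: smult_commute_module)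
    also have "\<dots> = \<epsilon> b \<odot> (S y \<otimes> S q)"
      by (rule sweedler_counit_left) (auto intro!: linear_intros simp: y)
    finally show "sweedler H (\<lambda>d s. \<epsilon> b \<odot> (\<epsilon> d \<odot> (S s \<otimes> S q))) y = \<epsilon> b \<odot> (S y \<otimes> S q)" .
  qed
  also have "\<dots> = S y \<otimes> S x"
    by (rule sweedler_counit_left) (auto intro!: linear_intros simp: x y)
  finally show ?thesis .
qed

text \<open>Both sides are evaluations of
  \<open>\<Sum> F ((S h\<^sub>1)' h\<^sub>2 S(h\<^sub>5)) ((S h\<^sub>1)'' h\<^sub>3 S(h\<^sub>4))\<close>, where \<open>h\<^sub>1 \<otimes> \<dots> \<otimes> h\<^sub>5\<close> is the iterated
  coproduct of the argument: the antipode cancels either \<open>h\<^sub>3\<close> with \<open>h\<^sub>4\<close> and \<open>h\<^sub>2\<close> with \<open>h\<^sub>5\<close>,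
  or \<open>h\<^sub>1\<close> with \<open>h\<^sub>2, h\<^sub>3\<close>.\<close>

lemma sweedler_antipode:
  assumes N: "module k N" and F: "F \<in> bilinear_maps N" and x: "x \<in> carrier H"
  shows "sweedler N F (S x) = sweedler N (\<lambda>a b. F (S b) (S a)) x"
proof -
  note [simp] = N bilinear_mapsD(3)[OF F]
  note lin = linear_intros bilinear_mapsD(1,2)[OF F] N
  \<comment> \<open>The argument \<open>r\<close> stands for legs 4 and 5 before they are separated;
    inside, \<open>p\<close> is leg 4, \<open>q\<close> is leg 5, and \<open>u\<close>,
    \<open>v\<close> are the legs of S(h1).\<close>
  define G where "G = (\<lambda>x1 x2 x3 r. sweedler N (\<lambda>p q. sweedler N (\<lambda>u v. F (u \<otimes> x2 \<otimes> S q) (v \<otimes> x3 \<otimes> S p)) (S x1)) r)"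
  have G1: "(\<lambda>a. G a b c d) \<in> linear_maps k H N" if "b \<in> carrier H" "c \<in> carrier H" "d \<in> carrier H" for b c d
    unfolding G_def using that by (auto intro!: lin)
  have G2: "(\<lambda>b. G a b c d) \<in> linear_maps k H N" if "a \<in> carrier H" "c \<in> carrier H" "d \<in> carrier H" for a c d
    unfolding G_def using that by (auto intro!: lin)
  have G3: "(\<lambda>c. G a b c d) \<in> linear_maps k H N" if "a \<in> carrier H" "b \<in> carrier H" "d \<in> carrier H" for a b d
    unfolding G_def using that by (auto intro!: lin)
  have G4: "(\<lambda>d. G a b c d) \<in> linear_maps k H N" if "a \<in> carrier H" "b \<in> carrier H" "c \<in> carrier H" for a b c
    unfolding G_def using that by (auto intro!: lin)
  \<comment> \<open>First evaluation, from right to left. The counit of \<open>r1\<close> makes room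
    for legs 2 to 5, which cancel to it.\<close>
  have "sweedler N F (S x) = sweedler N (\<lambda>x1 r1. \<epsilon> r1 \<odot>\<^bsub>N\<^esub> sweedler N F (S x1)) x"
    by (rule sweedler_counit_right[symmetric]) (auto intro!: lin F simp: x)
  also have "\<dots> = sweedler N (\<lambda>x1 r1. sweedler N (\<lambda>x2 r2. sweedler N (\<lambda>x3 r3. G x1 x2 x3 r3) r2) r1) x"
  proof (intro sweedler_cong refl)
    fix x1 r1 assume [simp]: "x1 \<in> carrier H" "r1 \<in> carrier H"
    have "sweedler N (\<lambda>x2 r2. sweedler N (\<lambda>x3 r3. G x1 x2 x3 r3) r2) r1 =
      sweedler N (\<lambda>x2 r2. sweedler N (\<lambda>u v. F (u \<otimes> (x2 \<otimes> S r2)) v) (S x1)) r1"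
    proof (rule sweedler_cong[OF refl])
      fix x2 r2 assume [simp]: "x2 \<in> carrier H" "r2 \<in> carrier H"
      \<comment> \<open>Regrouping makes legs 3 and 4 the two legs of \<open>m\<close>, so that x3
        S(p) collapses to the counit of \<open>m\<close> and only leg 5 of \<open>r2\<close>
        remains.\<close>
      have "sweedler N (\<lambda>x3 r3. G x1 x2 x3 r3) r2 =
        sweedler N (\<lambda>m q. sweedler N (\<lambda>x3 p. sweedler N (\<lambda>u v. F (u \<otimes> x2 \<otimes> S q) (v \<otimes> x3 \<otimes> S p)) (S x1)) m) r2"
        unfolding G_def by (rule sweedler_coassoc[symmetric]) (auto intro!: lin)
      also have "\<dots> = sweedler N (\<lambda>m q. \<epsilon> m \<odot>\<^bsub>N\<^esub> sweedler N (\<lambda>u v. F (u \<otimes> x2 \<otimes> S q) v) (S x1)) r2"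
      proof (intro sweedler_cong refl)
        fix m q assume [simp]: "m \<in> carrier H" "q \<in> carrier H"
        have "sweedler N (\<lambda>x3 p. sweedler N (\<lambda>u v. F (u \<otimes> x2 \<otimes> S q) (v \<otimes> x3 \<otimes> S p)) (S x1)) m =
          sweedler N (\<lambda>x3 p. sweedler N (\<lambda>u v. F (u \<otimes> x2 \<otimes> S q) (v \<otimes> (x3 \<otimes> S p))) (S x1)) m"
          by (simp add: M.m_assoc)
        also have "\<dots> = \<epsilon> m \<odot>\<^bsub>N\<^esub> sweedler N (\<lambda>u v. F (u \<otimes> x2 \<otimes> S q) (v \<otimes> \<one>)) (S x1)"
          by (rule sweedler_antipode_right[where g = "\<lambda>z. sweedler N (\<lambda>u v. F (u \<otimes> x2 \<otimes> S q) (v \<otimes> z)) (S x1)"])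
            (auto intro!: lin)
        finally show "sweedler N (\<lambda>x3 p. sweedler N (\<lambda>u v. F (u \<otimes> x2 \<otimes> S q) (v \<otimes> x3 \<otimes> S p)) (S x1)) m =
          \<epsilon> m \<odot>\<^bsub>N\<^esub> sweedler N (\<lambda>u v. F (u \<otimes> x2 \<otimes> S q) v) (S x1)" by simp
      qed
      also have "\<dots> = sweedler N (\<lambda>u v. F (u \<otimes> x2 \<otimes> S r2) v) (S x1)"
        by (rule sweedler_counit_left) (auto intro!: lin)
      finally show "sweedler N (\<lambda>x3 r3. G x1 x2 x3 r3) r2 = sweedler N (\<lambda>u v. F (u \<otimes> (x2 \<otimes> S r2)) v) (S x1)"
        by (simp add: M.m_assoc)
    qed
    also have "\<dots> = \<epsilon> r1 \<odot>\<^bsub>N\<^esub> sweedler N (\<lambda>u v. F (u \<otimes> \<one>) v) (S x1)"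
      by (rule sweedler_antipode_right[where g = "\<lambda>z. sweedler N (\<lambda>u v. F (u \<otimes> z) v) (S x1)"])
        (auto intro!: lin)
    finally show "\<epsilon> r1 \<odot>\<^bsub>N\<^esub> sweedler N F (S x1) =
      sweedler N (\<lambda>x2 r2. sweedler N (\<lambda>x3 r3. G x1 x2 x3 r3) r2) r1" by simp
  qed
  \<comment> \<open>Second evaluation: legs 2 and 3 become the legs of one \<open>m\<close>, and
    then \<open>x1\<close> and \<open>m\<close> the legs of one \<open>r1\<close>.\<close>
  also have "\<dots> = sweedler N (\<lambda>x1 r1. sweedler N (\<lambda>m r3. sweedler N (\<lambda>x2 x3. G x1 x2 x3 r3) m) r1) x"
    by (intro sweedler_cong refl sweedler_coassoc[symmetric]) (auto intro!: G1 G2 G3 G4)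
  also have "\<dots> = sweedler N (\<lambda>r1 r3. sweedler N (\<lambda>x1 m. sweedler N (\<lambda>x2 x3. G x1 x2 x3 r3) m) r1) x"
    by (rule sweedler_coassoc[symmetric]) (auto intro!: lin G1 G2 G3 G4 simp: x)
  also have "\<dots> = sweedler N (\<lambda>r1 r3. \<epsilon> r1 \<odot>\<^bsub>N\<^esub> sweedler N (\<lambda>p q. F (S q) (S p)) r3) x"
  proof (intro sweedler_cong refl)
    fix r1 r3 assume [simp]: "r1 \<in> carrier H" "r3 \<in> carrier H"
    have "sweedler N (\<lambda>x1 m. sweedler N (\<lambda>x2 x3. G x1 x2 x3 r3) m) r1 =
      sweedler N (\<lambda>x1 m. sweedler N (\<lambda>p q. sweedler N (\<lambda>u v. F (u \<otimes> S q) (v \<otimes> S p)) (S x1 \<otimes> m)) r3) r1"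
    proof (rule sweedler_cong[OF refl])
      fix x1 m assume [simp]: "x1 \<in> carrier H" "m \<in> carrier H"
      have "sweedler N (\<lambda>x2 x3. G x1 x2 x3 r3) m = sweedler N (\<lambda>p q. sweedler N (\<lambda>x2 x3.
          sweedler N (\<lambda>u v. F (u \<otimes> x2 \<otimes> S q) (v \<otimes> x3 \<otimes> S p)) (S x1)) m) r3"
        unfolding G_def by (rule sweedler_swap) auto
      also have "\<dots> = sweedler N (\<lambda>p q. sweedler N (\<lambda>u v. sweedler N (\<lambda>x2 x3.
          F (u \<otimes> x2 \<otimes> S q) (v \<otimes> x3 \<otimes> S p)) m) (S x1)) r3"
        by (intro sweedler_cong refl sweedler_swap) auto
      \<comment> \<open>The legs of S(x1) and those of \<open>m\<close> multiply to the coproduct of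
        the product S(x1) m, on which the antipode law for \<open>r1\<close> can act.\<close>
      also have "\<dots> = sweedler N (\<lambda>p q. sweedler N (\<lambda>u v. F (u \<otimes> S q) (v \<otimes> S p)) (S x1 \<otimes> m)) r3"
        by (intro sweedler_cong refl sweedler_mult[symmetric]) (auto intro!: lin)
      finally show "sweedler N (\<lambda>x2 x3. G x1 x2 x3 r3) m = \<dots>" .
    qed
    also have "\<dots> = \<epsilon> r1 \<odot>\<^bsub>N\<^esub> sweedler N (\<lambda>p q. sweedler N (\<lambda>u v. F (u \<otimes> S q) (v \<otimes> S p)) \<one>) r3"
      by (rule sweedler_antipode_left[where g = "\<lambda>z. sweedler N (\<lambda>p q. sweedler N (\<lambda>u v. F (u \<otimes> S q) (v \<otimes> S p)) z) r3"])
        (auto intro!: lin)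
    also have "sweedler N (\<lambda>p q. sweedler N (\<lambda>u v. F (u \<otimes> S q) (v \<otimes> S p)) \<one>) r3 = sweedler N (\<lambda>p q. F (S q) (S p)) r3"
    proof (intro sweedler_cong refl)
      fix p q assume [simp]: "p \<in> carrier H" "q \<in> carrier H"
      have "sweedler N (\<lambda>u v. F (u \<otimes> S q) (v \<otimes> S p)) \<one> = F (\<one> \<otimes> S q) (\<one> \<otimes> S p)"
        by (rule sweedler_one) (auto intro!: lin)
      then show "sweedler N (\<lambda>u v. F (u \<otimes> S q) (v \<otimes> S p)) \<one> = F (S q) (S p)" by simp
    qed
    finally show "sweedler N (\<lambda>x1 m. sweedler N (\<lambda>x2 x3. G x1 x2 x3 r3) m) r1 =
      \<epsilon> r1 \<odot>\<^bsub>N\<^esub> sweedler N (\<lambda>p q. F (S q) (S p)) r3" .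
  qed
  also have "\<dots> = sweedler N (\<lambda>a b. F (S b) (S a)) x"
    by (rule sweedler_counit_left) (auto intro!: lin simp: x)
  finally show ?thesis .
qed

section \<open>Sweedler sums over words\<close>

abbreviation word_prod :: "'b list \<Rightarrow> 'b"
  where "word_prod xs \<equiv> foldr (\<otimes>) xs \<one>"

lemma word_prod_closed [simp]: "xs \<in> words H n \<Longrightarrow> word_prod xs \<in> carrier H"
  by (induction n arbitrary: xs) (auto elim!: words_SucE)

lemma word_prod_append:
  "\<lbrakk>xs \<in> words H m; ys \<in> words H n\<rbrakk> \<Longrightarrow> word_prod (xs @ ys) = word_prod xs \<otimes> word_prod ys"
proof (induction m arbitrary: xs)
  case (Suc m)
  then obtain x xs' where "xs = x # xs'" "x \<in> carrier H" "xs' \<in> words H m" by (auto elim!: words_SucE)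
  with Suc show ?case
    using word_prod_closed[of xs' m] word_prod_closed[of ys n] by (simp add: M.m_assoc del: word_prod_closed)
next
  case 0
  then show ?case using word_prod_closed[of ys n] by (simp del: word_prod_closed)
qed

text \<open>The map \<open>g\<close> stays arbitrary in the induction, because peeling off a letter
  x replaces it by z \<mapsto> g (x z).\<close>

lemma word_prod_multilinear:
  "g \<in> linear_maps k H N \<Longrightarrow> (\<lambda>xs. g (word_prod xs)) \<in> multilinear_maps k H n N"
proof (induction n arbitrary: g)
  case 0
  then show ?case using linear_mapsD(1)[OF 0, of \<one>] by (auto intro!: multilinear_maps_0)
next
  case (Suc n)
  show ?case
  proof (rule multilinear_maps_ConsI)
    show "(\<lambda>x. g (word_prod (x # xs))) \<in> linear_maps k H N" if "xs \<in> words H n" for xs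
      using that by (auto intro!: linear_maps_compose[OF Suc.prems] linear_intros)
    have "(\<lambda>z. g (x \<otimes> z)) \<in> linear_maps k H N" if "x \<in> carrier H" for x
      using that by (auto intro!: linear_maps_compose[OF Suc.prems] linear_intros)
    from Suc.IH[OF this]
    show "(\<lambda>xs. g (word_prod (x # xs))) \<in> multilinear_maps k H n N" if "x \<in> carrier H" for x
      using that by simp
  qed
qed

text \<open>The number of letters is a separate argument, so that the congruence rule can place both
  collected words of legs in \<open>words H n\<close>.\<close>

primrec sweedler_words ::
  "nat \<Rightarrow> ('a, 'n, 'e) module_scheme \<Rightarrow> ('b list \<Rightarrow> 'b list \<Rightarrow> 'n) \<Rightarrow> 'b list \<Rightarrow> 'n"
  where
    "sweedler_words 0 N F hs = F [] []"
  | "sweedler_words (Suc n) N F hs =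
      sweedler N (\<lambda>a b. sweedler_words n N (\<lambda>as bs. F (a # as) (b # bs)) (tl hs)) (hd hs)"

lemma sweedler_words_cong:
  assumes "hs = hs'" "\<And>as bs. \<lbrakk>as \<in> words H n; bs \<in> words H n\<rbrakk> \<Longrightarrow> F as bs = G as bs"
  shows "sweedler_words n N F hs = sweedler_words n N G hs'"
  unfolding assms(1) using assms(2)
proof (induction n arbitrary: F G hs')
  case (Suc n)
  then show ?case unfolding sweedler_words.simps by (intro sweedler_cong refl Suc.IH) simp_all
qed simp

lemma sweedler_words_cong_strong [cong]:
  assumes "n = n'" "N = N'" "hs = hs'"
    "\<And>as bs. \<lbrakk>as \<in> words H n'; bs \<in> words H n'\<rbrakk> \<Longrightarrow> F as bs = G as bs"
  shows "sweedler_words n N F hs = sweedler_words n' N' G hs'"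
  unfolding assms(1,2) by (rule sweedler_words_cong) (use assms(3,4) in auto)

lemma sweedler_words_closed [simp]:
  "\<lbrakk>module k N; \<And>as bs. \<lbrakk>as \<in> words H n; bs \<in> words H n\<rbrakk> \<Longrightarrow> F as bs \<in> carrier N\<rbrakk> \<Longrightarrow>
    sweedler_words n N F hs \<in> carrier N"
  by (cases n) auto

lemma sweedler_words_compose:
  assumes N: "module k N" and P: "module k P" and g: "g \<in> linear_maps k N P"
    and F: "\<And>as bs. \<lbrakk>as \<in> words H n; bs \<in> words H n\<rbrakk> \<Longrightarrow> F as bs \<in> carrier N"
  shows "g (sweedler_words n N F hs) = sweedler_words n P (\<lambda>as bs. g (F as bs)) hs"
  using F
  by (induction n arbitrary: F hs) (auto simp: sweedler_compose[OF N P g] N)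

lemma sweedler_words_swap:
  assumes N: "module k N" and hs: "hs \<in> words H n" and x: "x \<in> carrier H"
    and F: "\<And>as bs c d. \<lbrakk>as \<in> words H n; bs \<in> words H n; c \<in> carrier H; d \<in> carrier H\<rbrakk> \<Longrightarrow>
      F as bs c d \<in> carrier N"
  shows "sweedler_words n N (\<lambda>as bs. sweedler N (F as bs) x) hs =
    sweedler N (\<lambda>c d. sweedler_words n N (\<lambda>as bs. F as bs c d) hs) x"
  using hs F
proof (induction n arbitrary: F hs)
  case (Suc n)
  then obtain h hs' where hs: "hs = h # hs'" "h \<in> carrier H" "hs' \<in> words H n" by (auto elim!: words_SucE)
  have "sweedler_words (Suc n) N (\<lambda>as bs. sweedler N (F as bs) x) hs = sweedler N (\<lambda>a b.
      sweedler N (\<lambda>c d. sweedler_words n N (\<lambda>as bs. F (a # as) (b # bs) c d) hs') x) h"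
    using hs Suc.prems by (auto intro!: sweedler_cong Suc.IH)
  also have "\<dots> = sweedler N (\<lambda>c d. sweedler N (\<lambda>a b. sweedler_words n N (\<lambda>as bs. F (a # as) (b # bs) c d) hs') h) x"
    using hs Suc.prems by (intro sweedler_swap N x) (auto intro!: sweedler_words_closed N)
  finally show ?case by (simp add: hs)
qed simp

lemma sweedler_words_parameter_linear:
  assumes X: "module k X" and N: "module k N" and "hs \<in> words H n"
    and "\<And>as bs. \<lbrakk>as \<in> words H n; bs \<in> words H n\<rbrakk> \<Longrightarrow> (\<lambda>x. F x as bs) \<in> linear_maps k X N"
  shows "(\<lambda>x. sweedler_words n N (F x) hs) \<in> linear_maps k X N"
  using assms(3,4)
  by (induction n arbitrary: F hs)
    (auto elim!: words_SucE intro!: sweedler_parameter_linear X N)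

lemma sweedler_parameter_multilinear:
  assumes N: "module k N" and h: "h \<in> carrier H"
    and F: "\<And>a b. \<lbrakk>a \<in> carrier H; b \<in> carrier H\<rbrakk> \<Longrightarrow> (\<lambda>xs. F xs a b) \<in> multilinear_maps k H m N"
  shows "(\<lambda>xs. sweedler N (F xs) h) \<in> multilinear_maps k H m N"
proof (rule multilinear_maps_slotI)
  fix i j us vs assume *: "m = i + Suc j" "us \<in> words H i" "vs \<in> words H j"
  show "(\<lambda>x. sweedler N (F (us @ x # vs)) h) \<in> linear_maps k H N"
    by (rule sweedler_parameter_linear[OF module_H N h])
      (rule multilinear_maps_slot[OF F[unfolded *(1)] *(2,3)])
qed (simp add: N)

lemma sweedler_words_parameter_multilinear:
  assumes N: "module k N" and hs: "hs \<in> words H n"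
    and F: "\<And>as bs. \<lbrakk>as \<in> words H n; bs \<in> words H n\<rbrakk> \<Longrightarrow> (\<lambda>xs. F xs as bs) \<in> multilinear_maps k H m N"
  shows "(\<lambda>xs. sweedler_words n N (F xs) hs) \<in> multilinear_maps k H m N"
proof (rule multilinear_maps_slotI)
  fix i j us vs assume *: "m = i + Suc j" "us \<in> words H i" "vs \<in> words H j"
  show "(\<lambda>x. sweedler_words n N (F (us @ x # vs)) hs) \<in> linear_maps k H N"
    by (rule sweedler_words_parameter_linear[OF module_H N hs])
      (rule multilinear_maps_slot[OF F[unfolded *(1)] *(2,3)])
qed (auto simp: N multilinear_mapsD(1)[OF F])

lemma sweedler_words_multilinear:
  assumes N: "module k N"
    and "\<And>bs. bs \<in> words H n \<Longrightarrow> (\<lambda>as. F as bs) \<in> multilinear_maps k H n N"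
    and "\<And>as. as \<in> words H n \<Longrightarrow> F as \<in> multilinear_maps k H n N"
  shows "sweedler_words n N F \<in> multilinear_maps k H n N"
  using assms(2,3)
proof (induction n arbitrary: F)
  case 0
  then show ?case using multilinear_mapsD(1)[OF 0(1), of "[]" "[]"] by (auto intro!: multilinear_maps_0)
next
  case (Suc n)
  note Fl = multilinear_maps_Cons[OF Suc.prems(1)] and Fr = multilinear_maps_Cons[OF Suc.prems(2)]
  show ?case
  proof (rule multilinear_maps_ConsI)
    fix xs assume xs: "xs \<in> words H n"
    show "(\<lambda>x. sweedler_words (Suc n) N F (x # xs)) \<in> linear_maps k H N"
      using Fl(1) Fr(1) by (auto intro!: sweedler_linear[OF N] bilinear_mapsI sweedler_words_parameter_linear N xs)
  next
    fix x assume x: "x \<in> carrier H"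
    show "(\<lambda>xs. sweedler_words (Suc n) N F (x # xs)) \<in> multilinear_maps k H n N"
      using Fl(2) Fr(2) by (auto intro!: sweedler_parameter_multilinear N x Suc.IH)
  qed
qed

lemma sweedler_words_append:
  "us \<in> words H m \<Longrightarrow> sweedler_words (m + n) N F (us @ vs) =
    sweedler_words m N (\<lambda>as bs. sweedler_words n N (\<lambda>cs ds. F (as @ cs) (bs @ ds)) vs) us"
  by (induction m arbitrary: F us) (auto elim!: words_SucE)

lemma sweedler_words_snoc:
  assumes "us \<in> words H n"
  shows "sweedler_words (Suc n) N F (us @ [x]) =
    sweedler_words n N (\<lambda>as bs. sweedler N (\<lambda>a b. F (as @ [a]) (bs @ [b])) x) us"
  using sweedler_words_append[OF assms, of "Suc 0" N F "[x]"] by simp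

text \<open>Coassociativity is inherited letter by letter. In each induction step the sum over the
  legs of the first letter is moved past the sums over the tail, where
  \<open>sweedler_coassoc\<close> can treat it.\<close>

lemma sweedler_words_coassoc:
  assumes N: "module k N" and "hs \<in> words H n"
    and "\<And>bs cs. \<lbrakk>bs \<in> words H n; cs \<in> words H n\<rbrakk> \<Longrightarrow> (\<lambda>as. F as bs cs) \<in> multilinear_maps k H n N"
    and "\<And>as cs. \<lbrakk>as \<in> words H n; cs \<in> words H n\<rbrakk> \<Longrightarrow> (\<lambda>bs. F as bs cs) \<in> multilinear_maps k H n N"
    and "\<And>as bs. \<lbrakk>as \<in> words H n; bs \<in> words H n\<rbrakk> \<Longrightarrow> (\<lambda>cs. F as bs cs) \<in> multilinear_maps k H n N"
  shows "sweedler_words n N (\<lambda>as bs. sweedler_words n N (\<lambda>cs ds. F cs ds bs) as) hs =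
    sweedler_words n N (\<lambda>as bs. sweedler_words n N (F as) bs) hs"
  using assms(2-5)
proof (induction n arbitrary: F hs)
  case (Suc n)
  then obtain h hs' where hs: "hs = h # hs'" "h \<in> carrier H" "hs' \<in> words H n" by (auto elim!: words_SucE)
  note F1 = multilinear_maps_Cons[OF Suc.prems(2)] and F2 = multilinear_maps_Cons[OF Suc.prems(3)]
    and F3 = multilinear_maps_Cons[OF Suc.prems(4)]
  have F_closed: "F (a # as) (b # bs) (c # cs) \<in> carrier N"
    if "a \<in> carrier H" "as \<in> words H n" "b \<in> carrier H" "bs \<in> words H n" "c \<in> carrier H" "cs \<in> words H n"
    for a as b bs c cs
    using that by (intro multilinear_mapsD(1)[OF Suc.prems(2)]) auto
  \<comment> \<open>The whole sum over the tail, as a trilinear function of the three legs of the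
    first letter; the induction hypothesis rebrackets it in \<open>G\<close>.\<close>
  define G where "G = (\<lambda>a b c. sweedler_words n N (\<lambda>as bs. sweedler_words n N
    (\<lambda>cs ds. F (a # cs) (b # ds) (c # bs)) as) hs')"
  have G: "G a b c = sweedler_words n N (\<lambda>as bs. sweedler_words n N (\<lambda>cs ds. F (a # as) (b # cs) (c # ds)) bs) hs'"
    if "a \<in> carrier H" "b \<in> carrier H" "c \<in> carrier H" for a b c
    unfolding G_def using that by (intro Suc.IH hs) (auto intro!: F1(2) F2(2) F3(2))
  have "sweedler_words (Suc n) N (\<lambda>as bs. sweedler_words (Suc n) N (\<lambda>cs ds. F cs ds bs) as) hs =
    sweedler N (\<lambda>a b. sweedler N (\<lambda>c d. G c d b) a) h"
    unfolding G_def using hs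
    by (auto intro!: sweedler_cong sweedler_words_swap N sweedler_words_closed F_closed)
  also have "\<dots> = sweedler N (\<lambda>a b. sweedler N (G a) b) h"
    unfolding G_def
    by (rule sweedler_coassoc[OF N hs(2)])
      (auto intro!: sweedler_words_parameter_linear N hs F1(1) F2(1) F3(1))
  also have "\<dots> = sweedler_words (Suc n) N (\<lambda>as bs. sweedler_words (Suc n) N (F as) bs) hs"
    using hs by (auto simp: G intro!: sweedler_cong sweedler_words_swap[symmetric] N sweedler_words_closed F_closed)
  finally show ?case .
qed simp

text \<open>Since \<open>\<epsilon>\<close> is multiplicative, the counit of the product hands one
  counit factor to every letter.\<close>

lemma sweedler_words_counit_left:
  assumes N: "module k N" and "g \<in> multilinear_maps k H n N" and "hs \<in> words H n"
  shows "sweedler_words n N (\<lambda>as bs. \<epsilon> (word_prod as) \<odot>\<^bsub>N\<^esub> g bs) hs = g hs"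
  using assms(2,3)
proof (induction n arbitrary: g hs)
  case (Suc n)
  then obtain h hs' where hs: "hs = h # hs'" "h \<in> carrier H" "hs' \<in> words H n" by (auto elim!: words_SucE)
  note g = multilinear_maps_Cons[OF Suc.prems(1)]
  have "sweedler_words (Suc n) N (\<lambda>as bs. \<epsilon> (word_prod as) \<odot>\<^bsub>N\<^esub> g bs) hs =
    sweedler N (\<lambda>a b. sweedler_words n N (\<lambda>as bs. \<epsilon> (word_prod as) \<odot>\<^bsub>N\<^esub> (\<epsilon> a \<odot>\<^bsub>N\<^esub> g (b # bs))) hs') h"
    by (auto simp: hs counit smult_smult_module[symmetric] smult_commute_module N multilinear_mapsD(1)[OF Suc.prems(1)]
       intro!: sweedler_cong sweedler_words_cong)
  also have "\<dots> = sweedler N (\<lambda>a b. \<epsilon> a \<odot>\<^bsub>N\<^esub> g (b # hs')) h"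
    by (intro sweedler_cong refl Suc.IH hs multilinear_maps_compose[where g = "\<lambda>x. _ \<odot>\<^bsub>N\<^esub> x" and N = N] g linear_intros N)
      simp_all
  also have "\<dots> = g (h # hs')"
    by (rule sweedler_counit_left[OF N g(1) hs(2)]) (rule hs)
  finally show ?case by (simp add: hs)
next
  case 0
  then show ?case by (auto simp: N multilinear_mapsD(1))
qed

text \<open>\<open>sweedler_mult\<close> iterated along the word. It trades a sum over one element
  of \<open>H\<close> for a letterwise sum, in either direction.\<close>

lemma sweedler_word_prod:
  assumes N: "module k N" and "F \<in> bilinear_maps N" and "hs \<in> words H n"
  shows "sweedler N F (word_prod hs) = sweedler_words n N (\<lambda>as bs. F (word_prod as) (word_prod bs)) hs"
  using assms(2,3)
proof (induction n arbitrary: F hs)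
  case 0
  then show ?case by (auto intro!: sweedler_one N)
next
  case (Suc n)
  then obtain h hs' where hs: "hs = h # hs'" "h \<in> carrier H" "hs' \<in> words H n" by (auto elim!: words_SucE)
  have "sweedler N F (word_prod hs) =
    sweedler N (\<lambda>a b. sweedler N (\<lambda>c d. F (a \<otimes> c) (b \<otimes> d)) (word_prod hs')) h"
    using hs by (auto intro!: sweedler_mult N Suc.prems)
  also have "\<dots> = sweedler N (\<lambda>a b. sweedler_words n N (\<lambda>as bs. F (a \<otimes> word_prod as) (b \<otimes> word_prod bs)) hs') h"
    by (intro sweedler_cong refl Suc.IH hs) (auto intro!: linear_intros bilinear_mapsD[OF Suc.prems(1)])
  finally show ?case by (simp add: hs)
qed

lemma sweedler_words_antipode:
  assumes N: "module k N" and g: "g \<in> linear_maps k H N" and hs: "hs \<in> words H n"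
  shows "sweedler_words n N (\<lambda>as bs. g (S (word_prod as) \<otimes> word_prod bs)) hs = \<epsilon> (word_prod hs) \<odot>\<^bsub>N\<^esub> g \<one>"
proof -
  have "sweedler_words n N (\<lambda>as bs. g (S (word_prod as) \<otimes> word_prod bs)) hs =
    sweedler N (\<lambda>a b. g (S a \<otimes> b)) (word_prod hs)"
    by (rule sweedler_word_prod[symmetric, OF N _ hs])
      (auto intro!: bilinear_mapsI linear_maps_compose[OF g] linear_intros)
  then show ?thesis using sweedler_antipode_left[OF N g] hs by simp
qed

text \<open>The cancellation behind both \<open>extra_extra_pure\<close> and
  \<open>extra_cyclic_pure\<close>. Every letter has four legs, collected in \<open>ps\<close>,
  \<open>qs\<close>, \<open>cs\<close>, \<open>ds\<close>. Rebracketing makes \<open>qs\<close> and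
  \<open>cs\<close> the two legs of one word \<open>us\<close>; the antipode law leaves only the
  counit of \<open>us\<close>, which the counit law absorbs.\<close>

lemma sweedler_words_antipode_cancel:
  assumes N: "module k N" and hs: "hs \<in> words H n"
    and B1: "\<And>ps ds. \<lbrakk>ps \<in> words H n; ds \<in> words H n\<rbrakk> \<Longrightarrow> (\<lambda>z. B z ps ds) \<in> linear_maps k H N"
    and B2: "\<And>z ds. \<lbrakk>z \<in> carrier H; ds \<in> words H n\<rbrakk> \<Longrightarrow> (\<lambda>ps. B z ps ds) \<in> multilinear_maps k H n N"
    and B3: "\<And>z ps. \<lbrakk>z \<in> carrier H; ps \<in> words H n\<rbrakk> \<Longrightarrow> (\<lambda>ds. B z ps ds) \<in> multilinear_maps k H n N"
  shows "sweedler_words n N (\<lambda>as bs. sweedler_words n N (\<lambda>ps qs. sweedler_words n N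
      (\<lambda>cs ds. B (S (word_prod qs) \<otimes> word_prod cs) ps ds) bs) as) hs = sweedler_words n N (B \<one>) hs"
proof -
  have l: "(\<lambda>qs. B (S (word_prod qs) \<otimes> word_prod cs) ps ds) \<in> multilinear_maps k H n N"
    if "ps \<in> words H n" "cs \<in> words H n" "ds \<in> words H n" for ps cs ds
    using that
    by (intro word_prod_multilinear[where g = "\<lambda>z. B (S z \<otimes> word_prod cs) ps ds"]
         linear_maps_compose[OF B1] linear_intros) auto
  have r: "(\<lambda>cs. B (S (word_prod qs) \<otimes> word_prod cs) ps ds) \<in> multilinear_maps k H n N"
    if "ps \<in> words H n" "qs \<in> words H n" "ds \<in> words H n" for ps qs ds
    using that
    by (intro word_prod_multilinear[where g = "\<lambda>z. B (S (word_prod qs) \<otimes> z) ps ds"]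
         linear_maps_compose[OF B1] linear_intros) auto
  have "sweedler_words n N (\<lambda>as bs. sweedler_words n N (\<lambda>ps qs. sweedler_words n N
      (\<lambda>cs ds. B (S (word_prod qs) \<otimes> word_prod cs) ps ds) bs) as) hs =
    sweedler_words n N (\<lambda>ps bs. sweedler_words n N (\<lambda>qs es. sweedler_words n N
      (\<lambda>cs ds. B (S (word_prod qs) \<otimes> word_prod cs) ps ds) es) bs) hs"
    by (rule sweedler_words_coassoc[OF N hs])
      (auto intro!: sweedler_words_multilinear sweedler_words_parameter_multilinear N l r B2 B3)
  also have "\<dots> = sweedler_words n N (\<lambda>ps bs. sweedler_words n N (\<lambda>us ds. sweedler_words n N
      (\<lambda>qs cs. B (S (word_prod qs) \<otimes> word_prod cs) ps ds) us) bs) hs"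
    by (rule sweedler_words_cong[OF refl], rule sweedler_words_coassoc[OF N, symmetric])
      (auto intro!: l r B3)
  also have "\<dots> = sweedler_words n N (\<lambda>ps bs. sweedler_words n N (\<lambda>us ds. \<epsilon> (word_prod us) \<odot>\<^bsub>N\<^esub> B \<one> ps ds) bs) hs"
    by (rule sweedler_words_cong[OF refl], rule sweedler_words_cong[OF refl],
        rule sweedler_words_antipode[OF N]) (auto intro!: B1)
  also have "\<dots> = sweedler_words n N (B \<one>) hs"
    by (intro sweedler_words_cong[OF refl] sweedler_words_counit_left[OF N] B3) auto
  finally show ?thesis .
qed

end

section \<open>The simplicial identities\<close>

locale hopf_character = hopf_algebra k H \<Delta> \<epsilon> S
  for k :: "('k, 'a) ring_scheme" and H :: "('k, 'h, 'b) module_scheme" (structure) and \<Delta> \<epsilon> S +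
  fixes \<delta> :: "'h \<Rightarrow> 'k"
  assumes character: "character k H \<delta>"
begin

lemmas char = characterD[OF character]

declare char(1,3) [simp]

lemmas char_intros = linear_intros character_smult_linear[OF character]

abbreviation "pure \<equiv> pure_tensor k H"
abbreviation "T \<equiv> tensor_power k H"
abbreviation "D \<equiv> face k H \<epsilon> \<delta>"
abbreviation "Z \<equiv> degeneracy k H"

lemma pure_multilinear: "pure \<in> multilinear_maps k H n (T n)"
  by (rule pure_tensor_multilinear) simp

text \<open>The degrees are written as \<open>i + Suc j\<close> and \<open>i + Suc (Suc j)\<close>,
  so that induction on \<open>i\<close> peels leading letters until the merged pair is at the
  front.\<close>

lemma multilinear_merge:
  "g \<in> multilinear_maps k H (i + Suc j) N \<Longrightarrow>
    (\<lambda>hs. g (take i hs @ [hs ! i \<otimes> hs ! Suc i] @ drop (Suc (Suc i)) hs)) \<in> multilinear_maps k H (i + Suc (Suc j)) N"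
proof (induction i arbitrary: g)
  case 0
  then have g: "g \<in> multilinear_maps k H (Suc j) N" by simp
  show ?case
    unfolding add_0
    by (intro multilinear_maps_ConsI)
      (auto intro!: linear_maps_compose[OF multilinear_maps_Cons(1)[OF g]] multilinear_maps_Cons(2)[OF g]
        linear_intros elim!: words_SucE)
next
  case (Suc i)
  then have g: "g \<in> multilinear_maps k H (Suc (i + Suc j)) N" by simp
  show ?case
    unfolding add_Suc
  proof (rule multilinear_maps_ConsI)
    fix xs assume "xs \<in> words H (i + Suc (Suc j))"
    then obtain us x y vs where "xs = us @ x # y # vs" "us \<in> words H i" "x \<in> carrier H" "y \<in> carrier H" "vs \<in> words H j"
      by (elim words_addE words_SucE) auto
    then show "(\<lambda>x. g (take (Suc i) (x # xs) @ [(x # xs) ! Suc i \<otimes> (x # xs) ! Suc (Suc i)] @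
        drop (Suc (Suc (Suc i))) (x # xs))) \<in> linear_maps k H N"
      using multilinear_maps_Cons(1)[OF g, of "us @ (x \<otimes> y) # vs"] words_appendI[of us H i "(x \<otimes> y) # vs" "Suc j"]
      by (simp add: words_length nth_append)
  next
    fix x assume x: "x \<in> carrier H"
    show "(\<lambda>xs. g (take (Suc i) (x # xs) @ [(x # xs) ! Suc i \<otimes> (x # xs) ! Suc (Suc i)] @
        drop (Suc (Suc (Suc i))) (x # xs))) \<in> multilinear_maps k H (i + Suc (Suc j)) N"
      using Suc.IH[OF multilinear_maps_Cons(2)[OF g x]] by simp
  qed
qed

lemma multilinear_insert_one:
  "g \<in> multilinear_maps k H (i + Suc j) N \<Longrightarrow>
    (\<lambda>hs. g (take i hs @ [\<one>] @ drop i hs)) \<in> multilinear_maps k H (i + j) N"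
proof (induction i arbitrary: g)
  case 0
  then have g: "g \<in> multilinear_maps k H (Suc j) N" by simp
  show ?case using multilinear_maps_Cons(2)[OF g, of \<one>] by simp
next
  case (Suc i)
  then have g: "g \<in> multilinear_maps k H (Suc (i + Suc j)) N" by simp
  show ?case
    unfolding add_Suc
  proof (rule multilinear_maps_ConsI)
    fix xs assume "xs \<in> words H (i + j)"
    then obtain us vs where "xs = us @ vs" "us \<in> words H i" "vs \<in> words H j"
      by (elim words_addE) auto
    then show "(\<lambda>x. g (take (Suc i) (x # xs) @ [\<one>] @ drop (Suc i) (x # xs))) \<in> linear_maps k H N"
      using multilinear_maps_Cons(1)[OF g, of "us @ \<one> # vs"] words_appendI[of us H i "\<one> # vs" "Suc j"]
      by (simp add: words_length)
  next
    fix x assume x: "x \<in> carrier H"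
    show "(\<lambda>xs. g (take (Suc i) (x # xs) @ [\<one>] @ drop (Suc i) (x # xs))) \<in> multilinear_maps k H (i + j) N"
      using Suc.IH[OF multilinear_maps_Cons(2)[OF g x]] by simp
  qed
qed

text \<open>The function is literally the one inside \<open>face_def\<close>, so that after
  unfolding the universal property of the tensor power applies directly.\<close>

lemma face_multilinear:
  assumes "1 \<le> n" "i \<le> n"
  shows "(\<lambda>hs. if i = 0 then \<epsilon> (hd hs) \<odot>\<^bsub>T (n - 1)\<^esub> pure (tl hs)
            else if i < n then pure (take (i - 1) hs @ [hs ! (i - 1) \<otimes> hs ! i] @ drop (i + 1) hs)
            else \<delta> (last hs) \<odot>\<^bsub>T (n - 1)\<^esub> pure (butlast hs)) \<in> multilinear_maps k H n (T (n - 1))"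
proof -
  obtain m where n: "n = Suc m" using assms by (cases n) auto
  consider "i = 0" | "i = Suc m" | p q where "i = Suc p" "m = p + Suc q"
    using assms n by (cases i) (auto dest!: less_imp_Suc_add simp: le_less)
  then show ?thesis
  proof cases
    case 1
    then show ?thesis
      unfolding n
      by (intro multilinear_maps_ConsI)
        (auto intro!: char_intros multilinear_maps_compose[where g = "\<lambda>x. _ \<odot>\<^bsub>T m\<^esub> x" and N = "T m"] pure_multilinear)
  next
    case 2
    then show ?thesis
      unfolding n
      by (intro multilinear_maps_snocI)
        (auto intro!: char_intros multilinear_maps_compose[where g = "\<lambda>x. _ \<odot>\<^bsub>T m\<^esub> x" and N = "T m"] pure_multilinear)
  next
    case 3
    then show ?thesis
      using multilinear_merge[OF pure_multilinear, of p q] by (simp add: n)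
  qed
qed

lemma face_linear: "\<lbrakk>1 \<le> n; i \<le> n\<rbrakk> \<Longrightarrow> D n i \<in> linear_maps k (T n) (T (n - 1))"
  unfolding face_def by (rule tensor_lift_linear) (simp_all add: face_multilinear del: One_nat_def)

lemma face_zero:
  assumes "x \<in> carrier H" "set xs \<subseteq> carrier H" "n = Suc (length xs)"
  shows "D n 0 (pure (x # xs)) = \<epsilon> x \<odot>\<^bsub>T (length xs)\<^esub> pure xs"
  unfolding face_def
  by (subst tensor_lift_pure[OF module_H module_tensor_power face_multilinear])
    (use assms in \<open>auto simp: words_def\<close>)

lemma face_last:
  assumes "x \<in> carrier H" "set xs \<subseteq> carrier H" "n = Suc (length xs)" "i = n"
  shows "D n i (pure (xs @ [x])) = \<delta> x \<odot>\<^bsub>T (length xs)\<^esub> pure xs"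
  unfolding face_def
  by (subst tensor_lift_pure[OF module_H module_tensor_power face_multilinear])
    (use assms in \<open>auto simp: words_def\<close>)

lemma face_merge:
  assumes "x \<in> carrier H" "y \<in> carrier H" "set us \<subseteq> carrier H" "set vs \<subseteq> carrier H"
    "i = Suc (length us)" "n = Suc (Suc (length us + length vs))"
  shows "D n i (pure (us @ x # y # vs)) = pure (us @ (x \<otimes> y) # vs)"
  unfolding face_def
  by (subst tensor_lift_pure[OF module_H module_tensor_power face_multilinear])
    (use assms in \<open>auto simp: words_def nth_append\<close>)

lemma degeneracy_multilinear:
  assumes "i \<le> n"
  shows "(\<lambda>hs. pure (take i hs @ [\<one>] @ drop i hs)) \<in> multilinear_maps k H n (T (n + 1))"
  using multilinear_insert_one[of pure i "n - i" "T (Suc n)"] pure_multilinear[of "Suc n"] assms by simp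

lemma degeneracy_linear: "i \<le> n \<Longrightarrow> Z n i \<in> linear_maps k (T n) (T (n + 1))"
  unfolding degeneracy_def by (rule tensor_lift_linear) (simp_all add: degeneracy_multilinear[simplified])

lemma degeneracy_pure:
  assumes "set us \<subseteq> carrier H" "set vs \<subseteq> carrier H" "i = length us" "n = length us + length vs"
  shows "Z n i (pure (us @ vs)) = pure (us @ \<one> # vs)"
  unfolding degeneracy_def
  by (subst tensor_lift_pure[OF module_H module_tensor_power degeneracy_multilinear])
    (use assms in \<open>auto simp: words_def\<close>)

lemma pure_closed [simp]: "\<lbrakk>set xs \<subseteq> carrier H; n = length xs\<rbrakk> \<Longrightarrow> pure xs \<in> carrier (T n)"
  by (rule pure_tensor_closed) (simp add: words_def)

text \<open>Degrees are variables tied together by equations among the premises, so that the rewrite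
  rule matches a degree in any arithmetic form.\<close>

lemma face_smult:
  "\<lbrakk>1 \<le> n; i \<le> n; r \<in> carrier k; set xs \<subseteq> carrier H; n = length xs; m = n - 1; n' = n\<rbrakk> \<Longrightarrow>
    D n i (r \<odot>\<^bsub>T n'\<^esub> pure xs) = r \<odot>\<^bsub>T m\<^esub> D n i (pure xs)"
  using linear_mapsD(3)[OF face_linear, of n i r "pure xs"] by (simp add: words_def)

lemma degeneracy_smult:
  "\<lbrakk>i \<le> n; r \<in> carrier k; set xs \<subseteq> carrier H; n = length xs; m = n + 1; n' = n\<rbrakk> \<Longrightarrow>
    Z n i (r \<odot>\<^bsub>T n'\<^esub> pure xs) = r \<odot>\<^bsub>T m\<^esub> Z n i (pure xs)"
  using linear_mapsD(3)[OF degeneracy_linear, of i n r "pure xs"] by (simp add: words_def)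

lemma words_split3:
  assumes "w \<in> words H n" "n = a + b + c"
  obtains us vs ws where "w = us @ vs @ ws" "length us = a" "length vs = b" "length ws = c"
    "set us \<subseteq> carrier H" "set vs \<subseteq> carrier H" "set ws \<subseteq> carrier H"
proof -
  have "w \<in> words H (a + (b + c))" using assms by (simp add: add.assoc)
  then show thesis using that by (elim words_addE) (auto simp: words_def)
qed

lemma length_Suc_carrierE:
  assumes "length xs = Suc n" "set xs \<subseteq> carrier H"
  obtains y ys where "xs = y # ys" "y \<in> carrier H" "set ys \<subseteq> carrier H" "length ys = n"
  using assms by (cases xs) auto

text \<open>Seven relative positions of the indices. Where the two faces meet at the left end, at
  the right end or on three consecutive letters, the identity is multiplicativity of
  \<open>\<epsilon>\<close>, multiplicativity of \<open>\<delta>\<close>, or associativity;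
  elsewhere they act on disjoint letters.\<close>

lemma face_face_pure:
  assumes "2 \<le> n" "i < j" "j \<le> n" "w \<in> words H n"
  shows "D (n - 1) i (D n j (pure w)) = D (n - 1) (j - 1) (D n i (pure w))"
proof -
  obtain m where n: "n = Suc (Suc m)" using assms(1) by (metis Suc_le_D numeral_2_eq_2 Suc_le_mono)
  have "i = 0 \<and> j = n \<or> i = 0 \<and> j = 1 \<or> i = 0 \<and> 1 < j \<and> j < n \<or> 0 < i \<and> j = n \<and> i = n - 1 \<or>
    0 < i \<and> j = n \<and> i < n - 1 \<or> 0 < i \<and> j = i + 1 \<and> j < n \<or> 0 < i \<and> i + 1 < j \<and> j < n"
    using assms by (cases "i = 0"; cases "j = n"; cases "j = i + 1"; auto)
  then consider "i = 0" "j = n" | "i = 0" "j = 1" | "i = 0" "1 < j" "j < n" | "0 < i" "j = n" "i = n - 1"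
    | "0 < i" "j = n" "i < n - 1" | "0 < i" "j = i + 1" "j < n" | "0 < i" "i + 1 < j" "j < n"
    by blast
  then show ?thesis
  proof cases
    case 1
    obtain x us y where w: "w = x # us @ [y]" "length us = m" "x \<in> carrier H" "y \<in> carrier H" "set us \<subseteq> carrier H"
    proof -
      have split: "n = Suc 0 + m + Suc 0" using n by simp
      show thesis by (rule words_split3[OF assms(4) split]) (auto simp: length_Suc_conv intro!: that)
    qed
    show ?thesis
      using w 1 n face_last[of y "x # us" n n] face_last[of y us "Suc m" "Suc m"]
      by (simp add: face_zero face_smult smult_commute_module)
  next
    case 2
    obtain x y vs where w: "w = x # y # vs" "length vs = m" "x \<in> carrier H" "y \<in> carrier H" "set vs \<subseteq> carrier H"
    proof -
      have split: "n = Suc 0 + Suc 0 + m" using n by simp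
      show thesis by (rule words_split3[OF assms(4) split]) (auto simp: length_Suc_conv intro!: that)
    qed
    show ?thesis
      using w 2 n face_merge[of x y "[]" vs 1 n]
      by (simp add: face_zero face_smult smult_smult_module counit)
  next
    case 3
    then obtain p q where pq: "j = Suc (Suc p)" "m = p + Suc q"
      using n less_imp_Suc_add[OF 3(2)] less_imp_Suc_add[OF 3(3)] by auto
    obtain us xy vs where w: "w = us @ xy @ vs" "length us = Suc p" "length xy = 2" "length vs = q"
      "set us \<subseteq> carrier H" "set xy \<subseteq> carrier H" "set vs \<subseteq> carrier H"
      using words_split3[OF assms(4), of "Suc p" 2 q] n pq by auto
    obtain u us' where us: "us = u # us'" "u \<in> carrier H" "set us' \<subseteq> carrier H" "length us' = p"
      using length_Suc_carrierE[OF w(2,5)] .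
    obtain x y where xy: "xy = [x, y]" "x \<in> carrier H" "y \<in> carrier H"
      using w(3,6) by (auto simp: numeral_2_eq_2 length_Suc_conv)
    show ?thesis
      using w 3 n pq us xy face_merge[of x y "u # us'" vs j n] face_merge[of x y us' vs "j - 1" "n - 1"]
      by (simp add: face_zero face_smult)
  next
    case 4
    obtain us x y where w: "w = us @ [x, y]" "length us = m" "x \<in> carrier H" "y \<in> carrier H" "set us \<subseteq> carrier H"
    proof -
      have split: "n = m + Suc 0 + Suc 0" using n by simp
      show thesis by (rule words_split3[OF assms(4) split]) (auto simp: length_Suc_conv intro!: that)
    qed
    show ?thesis
      using w 4 n face_last[of y "us @ [x]" n n] face_last[of x us "Suc m" "Suc m"]
        face_last[of "x \<otimes> y" us "Suc m" "Suc m"] face_merge[of x y us "[]" "Suc m" n]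
      by (simp add: face_smult smult_smult_module char R.m_comm)
  next
    case 5
    then obtain p q where pq: "i = Suc p" "m = p + Suc q"
      using n less_imp_Suc_add[OF 5(1)] less_imp_Suc_add[OF 5(3)] by auto
    obtain us xy vz where w: "w = us @ xy @ vz" "length us = p" "length xy = 2" "length vz = Suc q"
      "set us \<subseteq> carrier H" "set xy \<subseteq> carrier H" "set vz \<subseteq> carrier H"
      using words_split3[OF assms(4), of p 2 "Suc q"] n pq by auto
    obtain vs z where vz: "vz = vs @ [z]" "length vs = q" "set vs \<subseteq> carrier H" "z \<in> carrier H"
      using w(4,7) by (cases vz rule: rev_cases) auto
    obtain x y where xy: "xy = [x, y]" "x \<in> carrier H" "y \<in> carrier H"
      using w(3,6) by (auto simp: numeral_2_eq_2 length_Suc_conv)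
    show ?thesis
      using w 5 n pq vz xy face_merge[of x y us "vs @ [z]" i n] face_merge[of x y us vs i "n - 1"]
        face_last[of z "us @ x # y # vs" n n] face_last[of z "us @ (x \<otimes> y) # vs" "n - 1" "n - 1"]
      by (simp add: face_smult)
  next
    case 6
    then obtain p q where pq: "i = Suc p" "m = p + Suc q"
      using n less_imp_Suc_add[OF 6(1)] less_imp_Suc_add[OF 6(3)] 6(2) by auto
    obtain us xyz vs where w: "w = us @ xyz @ vs" "length us = p" "length xyz = 3" "length vs = q"
      "set us \<subseteq> carrier H" "set xyz \<subseteq> carrier H" "set vs \<subseteq> carrier H"
      using words_split3[OF assms(4), of p 3 q] n pq by auto
    obtain x y z where xyz: "xyz = [x, y, z]" "x \<in> carrier H" "y \<in> carrier H" "z \<in> carrier H"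
      using w(3,6) by (auto simp: numeral_3_eq_3 length_Suc_conv)
    show ?thesis
      using w 6 n pq xyz face_merge[of x y us "z # vs" i n] face_merge[of y z "us @ [x]" vs j n]
        face_merge[of "x \<otimes> y" z us vs i "n - 1"] face_merge[of x "y \<otimes> z" us vs i "n - 1"]
      by (simp add: M.m_assoc)
  next
    case 7
    \<comment> \<open>The letters before, between and after the two disjoint pairs number
      \<open>p\<close>, \<open>q\<close> and \<open>r\<close>.\<close>
    then obtain p q r where pq: "i = Suc p" "j = Suc (Suc (Suc (p + q)))" "m = Suc (Suc (p + q + r))"
    proof -
      have "i = Suc (i - 1)" "j = Suc (Suc (Suc ((i - 1) + (j - i - 2))))"
        "m = Suc (Suc ((i - 1) + (j - i - 2) + (n - j - 1)))"
        using 7 n by linarith+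
      then show thesis by (rule that)
    qed
    obtain us xyv w' where w: "w = us @ xyv @ w'" "length us = p" "length xyv = Suc (Suc q)" "length w' = Suc (Suc r)"
      "set us \<subseteq> carrier H" "set xyv \<subseteq> carrier H" "set w' \<subseteq> carrier H"
      using words_split3[OF assms(4), of p "Suc (Suc q)" "Suc (Suc r)"] n pq by auto
    obtain x y vs where xy: "xyv = x # y # vs" "x \<in> carrier H" "y \<in> carrier H" "set vs \<subseteq> carrier H" "length vs = q"
      using w(3,6) by (auto simp: length_Suc_conv)
    obtain a b ws where ab: "w' = a # b # ws" "a \<in> carrier H" "b \<in> carrier H" "set ws \<subseteq> carrier H" "length ws = r"
      using w(4,7) by (auto simp: length_Suc_conv)
    show ?thesis
      using w n pq xy ab face_merge[of x y us "vs @ a # b # ws" i n] face_merge[of a b "us @ x # y # vs" ws j n]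
        face_merge[of a b "us @ (x \<otimes> y) # vs" ws "j - 1" "n - 1"]
        face_merge[of x y us "vs @ (a \<otimes> b) # ws" i "n - 1"]
      by simp
  qed
qed

lemma degeneracy_degeneracy_pure:
  assumes "i \<le> j" "j \<le> n" "w \<in> words H n"
  shows "Z (n + 1) i (Z n j (pure w)) = Z (n + 1) (j + 1) (Z n i (pure w))"
proof -
  have split: "n = i + (j - i) + (n - j)"
    using assms(1,2) by simp
  obtain us vs ws where w: "w = us @ vs @ ws" "length us = i" "length vs = j - i" "length ws = n - j"
      "set us \<subseteq> carrier H" "set vs \<subseteq> carrier H" "set ws \<subseteq> carrier H"
    using words_split3[OF assms(3) split] by blast
  show ?thesis
    using assms(1,2) w degeneracy_pure[of us "vs @ ws" i n] degeneracy_pure[of "us @ vs" ws j n]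
      degeneracy_pure[of us "vs @ \<one> # ws" i "n + 1"] degeneracy_pure[of "us @ \<one> # vs" ws "j + 1" "n + 1"]
    by simp
qed

lemma face_degeneracy_less_pure:
  assumes "i < j" "j \<le> n" "w \<in> words H n"
  shows "D (n + 1) i (Z n j (pure w)) = Z (n - 1) (j - 1) (D n i (pure w))"
proof (cases i)
  case 0
  have split: "n = 1 + (j - 1) + (n - j)"
    using assms(1,2) by simp
  obtain us vs ws where w: "w = us @ vs @ ws" "length us = 1" "length vs = j - 1" "length ws = n - j"
      "set us \<subseteq> carrier H" "set vs \<subseteq> carrier H" "set ws \<subseteq> carrier H"
    using words_split3[OF assms(3) split] by blast
  obtain x where x: "us = [x]" "x \<in> carrier H" using w by (auto simp: length_Suc_conv)
  show ?thesis
    using assms(1,2) w x 0 degeneracy_pure[of "x # vs" ws j n] degeneracy_pure[of vs ws "j - 1" "n - 1"]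
    by (simp add: face_zero degeneracy_smult)
next
  case (Suc p)
  obtain q where j: "j = Suc (Suc (p + q))"
    using less_imp_Suc_add[OF assms(1)] Suc by auto
  obtain r where n: "n = j + r"
    using assms(2) le_Suc_ex by blast
  have split: "n = p + Suc (Suc q) + r" using n j by simp
  obtain us vs ws where w: "w = us @ vs @ ws" "length us = p" "length vs = Suc (Suc q)" "length ws = r"
      "set us \<subseteq> carrier H" "set vs \<subseteq> carrier H" "set ws \<subseteq> carrier H"
    using words_split3[OF assms(3) split] by blast
  obtain x y vs' where x: "vs = x # y # vs'" "x \<in> carrier H" "y \<in> carrier H" "set vs' \<subseteq> carrier H"
    "length vs' = q"
    using w(3,6) by (auto simp: length_Suc_conv)
  show ?thesis
    using w x Suc j n degeneracy_pure[of "us @ x # y # vs'" ws j n]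
      degeneracy_pure[of "us @ (x \<otimes> y) # vs'" ws "j - 1" "n - 1"]
      face_merge[of x y us "vs' @ \<one> # ws" i "n + 1"] face_merge[of x y us "vs' @ ws" i n]
    by simp
qed

text \<open>The inserted \<open>\<one>\<close> is absorbed by its neighbour or, at an end of the
  word, by \<open>\<epsilon>\<close> or \<open>\<delta>\<close>, both of which send it to the unit
  of \<open>k\<close>.\<close>

lemma face_degeneracy_same_pure:
  assumes "j \<le> n" "i = j \<or> i = j + 1" "w \<in> words H n"
  shows "D (n + 1) i (Z n j (pure w)) = pure w"
proof -
  obtain us vs where w: "w = us @ vs" "length us = j" "length vs = n - j" "set us \<subseteq> carrier H" "set vs \<subseteq> carrier H"
  proof -
    have split: "n = j + (n - j) + 0" using assms(1) by simp
    show thesis by (rule words_split3[OF assms(3) split]) (auto intro!: that)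
  qed
  have Z: "Z n j (pure w) = pure (us @ \<one> # vs)"
    using w assms(1) degeneracy_pure[of us vs j n] by simp
  from assms(2) show ?thesis
  proof
    assume i: "i = j"
    show ?thesis
    proof (cases us rule: rev_cases)
      case Nil
      then show ?thesis unfolding Z using w i by (simp add: face_zero)
    next
      case (snoc us' x)
      then show ?thesis unfolding Z using w i assms(1) face_merge[of x \<one> us' vs i "n + 1"] by simp
    qed
  next
    assume i: "i = j + 1"
    show ?thesis
    proof (cases vs)
      case Nil
      then show ?thesis unfolding Z using w i assms(1) face_last[of \<one> us "n + 1" i] by simp
    next
      case (Cons y vs')
      then have "n = Suc (j + length vs')" using w assms(1) by simp
      with Cons show ?thesis unfolding Z using w i face_merge[of \<one> y us vs' i "n + 1"] by simp
    qed
  qed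
qed

lemma face_degeneracy_greater_pure:
  assumes "j + 1 < i" "i \<le> n + 1" "w \<in> words H n"
  shows "D (n + 1) i (Z n j (pure w)) = Z (n - 1) j (D n (i - 1) (pure w))"
proof (cases "i = n + 1")
  case True
  obtain q where n: "n = Suc (j + q)"
    using less_imp_Suc_add[OF assms(1)] True by auto
  have split: "n = j + q + Suc 0" using n by simp
  obtain us vs ws where w: "w = us @ vs @ ws" "length us = j" "length vs = q" "length ws = Suc 0"
      "set us \<subseteq> carrier H" "set vs \<subseteq> carrier H" "set ws \<subseteq> carrier H"
    using words_split3[OF assms(3) split] by blast
  obtain z where z: "ws = [z]" "z \<in> carrier H" using w by (auto simp: length_Suc_conv)
  show ?thesis
    using w z n True degeneracy_pure[of us "vs @ [z]" j n] degeneracy_pure[of us vs j "n - 1"]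
      face_last[of z "us @ \<one> # vs" "n + 1" i] face_last[of z "us @ vs" n n]
    by (simp add: degeneracy_smult)
next
  case False
  obtain q where i: "i = Suc (Suc (j + q))"
    using less_imp_Suc_add[OF assms(1)] by auto
  obtain r where n: "n = i + r"
    using assms(2) False le_Suc_ex[of i n] by auto
  have split: "n = j + q + Suc (Suc r)" using n i by simp
  obtain us vs ws where w: "w = us @ vs @ ws" "length us = j" "length vs = q" "length ws = Suc (Suc r)"
      "set us \<subseteq> carrier H" "set vs \<subseteq> carrier H" "set ws \<subseteq> carrier H"
    using words_split3[OF assms(3) split] by blast
  obtain x y ws' where x: "ws = x # y # ws'" "x \<in> carrier H" "y \<in> carrier H" "set ws' \<subseteq> carrier H"
    "length ws' = r"
    using w(4,7) by (auto simp: length_Suc_conv)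
  show ?thesis
    using w x n i degeneracy_pure[of us "vs @ x # y # ws'" j n]
      degeneracy_pure[of us "vs @ (x \<otimes> y) # ws'" j "n - 1"]
      face_merge[of x y "us @ \<one> # vs" ws' i "n + 1"] face_merge[of x y "us @ vs" ws' "i - 1" n]
    by simp
qed

text \<open>This supplies the simplicial identities as facts for arbitrary tensors; the cyclic
  relations are later derived from them without returning to words.\<close>

sublocale simplicial_module k T D Z
proof (rule simplicial_module.intro)
  fix n i j t
  show "module k (T n)" by simp
  show "D n i \<in> linear_maps k (T n) (T (n - 1))" if "1 \<le> n" "i \<le> n"
    using that by (rule face_linear)
  show "Z n i \<in> linear_maps k (T n) (T (n + 1))" if "i \<le> n"
    using that by (rule degeneracy_linear)
  assume t: "t \<in> carrier (T n)"
  note ext = tensor_power_ext[OF module_H module_tensor_power _ _ _ t]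
  show "D (n - 1) i (D n j t) = D (n - 1) (j - 1) (D n i t)" if "2 \<le> n" "i < j" "j \<le> n"
  proof -
    have *: "1 \<le> n - 1" "i \<le> n - 1" "j - 1 \<le> n - 1" "1 \<le> n" "i \<le> n"
      using that by linarith+
    show ?thesis
      by (rule ext[where f = "\<lambda>t. D (n - 1) i (D n j t)" and g = "\<lambda>t. D (n - 1) (j - 1) (D n i t)"])
        (use that linear_maps_compose[OF face_linear face_linear, of n i j]
          linear_maps_compose[OF face_linear face_linear, of n "j - 1" i]
          face_face_pure[OF that] * in auto)
  qed
  show "Z (n + 1) i (Z n j t) = Z (n + 1) (j + 1) (Z n i t)" if "i \<le> j" "j \<le> n"
    by (rule ext[where f = "\<lambda>t. Z (n + 1) i (Z n j t)" and g = "\<lambda>t. Z (n + 1) (j + 1) (Z n i t)"])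
      (use that linear_maps_compose[OF degeneracy_linear degeneracy_linear, of i n j]
        linear_maps_compose[OF degeneracy_linear degeneracy_linear, of "j + 1" n i]
        degeneracy_degeneracy_pure[OF that] in auto)
  show "D (n + 1) i (Z n j t) = Z (n - 1) (j - 1) (D n i t)" if "i < j" "j \<le> n"
    by (rule ext[where f = "\<lambda>t. D (n + 1) i (Z n j t)" and g = "\<lambda>t. Z (n - 1) (j - 1) (D n i t)"])
      (use that linear_maps_compose[OF face_linear degeneracy_linear, of n i j]
        linear_maps_compose[OF degeneracy_linear face_linear, of "j - 1" n i]
        face_degeneracy_less_pure[OF that] in auto)
  show "D (n + 1) i (Z n j t) = t" if "j \<le> n" "i = j \<or> i = j + 1"
    by (rule ext[where f = "\<lambda>t. D (n + 1) i (Z n j t)" and g = "\<lambda>t. t"])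
      (use that linear_maps_compose[OF face_linear degeneracy_linear, of n i j] linear_maps_ident
        face_degeneracy_same_pure[OF that] in auto)
  show "D (n + 1) i (Z n j t) = Z (n - 1) j (D n (i - 1) t)" if "j + 1 < i" "i \<le> n + 1"
    by (rule ext[where f = "\<lambda>t. D (n + 1) i (Z n j t)" and g = "\<lambda>t. Z (n - 1) j (D n (i - 1) t)"])
      (use that linear_maps_compose[OF face_linear degeneracy_linear, of n i j]
        linear_maps_compose[OF degeneracy_linear face_linear, of j n "i - 1"]
        face_degeneracy_greater_pure[OF that] in auto)
qed

end

section \<open>The extra degeneracy\<close>

context hopf_algebra
begin

text \<open>\<open>cyclic_word\<close> reads one word a1, b1, ..., an, bn, whereas Sweedler sums
  keep the first and the second legs apart; this operation and its inverses \<open>evens\<close>,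
  \<open>odds\<close> pass between the two conventions.\<close>

primrec interleave :: "'b list \<Rightarrow> 'b list \<Rightarrow> 'b list"
  where
    "interleave [] bs = []"
  | "interleave (a # as) bs = a # hd bs # interleave as (tl bs)"

text \<open>Together with \<open>odds\<close>, these are exactly the two lists inside
  \<open>cyclic_word_def\<close>, which thereby becomes a function of a pair of words.\<close>

definition evens :: "nat \<Rightarrow> 'b list \<Rightarrow> 'b list"
  where "evens n w = map (\<lambda>i. w ! (2 * i)) [0..<n]"

definition odds :: "nat \<Rightarrow> 'b list \<Rightarrow> 'b list"
  where "odds n w = map (\<lambda>i. w ! (2 * i + 1)) [0..<n]"

lemma evens_simps [simp]: "evens 0 w = []" "evens (Suc n) (a # b # w) = a # evens n w"
  by (simp_all add: evens_def upt_conv_Cons map_Suc_upt[symmetric] comp_def del: upt_Suc)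

lemma odds_simps [simp]: "odds 0 w = []" "odds (Suc n) (a # b # w) = b # odds n w"
  by (simp_all add: odds_def upt_conv_Cons map_Suc_upt[symmetric] comp_def del: upt_Suc)

lemma interleave_closed: "\<lbrakk>as \<in> words H n; bs \<in> words H n\<rbrakk> \<Longrightarrow> interleave as bs \<in> words H (2 * n)"
  by (induction n arbitrary: as bs) (auto elim!: words_SucE)

lemma evens_interleave: "\<lbrakk>as \<in> words H n; bs \<in> words H n\<rbrakk> \<Longrightarrow> evens n (interleave as bs) = as"
  by (induction n arbitrary: as bs) (auto elim!: words_SucE)

lemma odds_interleave: "\<lbrakk>as \<in> words H n; bs \<in> words H n\<rbrakk> \<Longrightarrow> odds n (interleave as bs) = bs"
  by (induction n arbitrary: as bs) (auto elim!: words_SucE)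

lemma evens_closed: "w \<in> words H (2 * n) \<Longrightarrow> evens n w \<in> words H n"
  by (induction n arbitrary: w) (auto elim!: words_SucE)

lemma odds_closed: "w \<in> words H (2 * n) \<Longrightarrow> odds n w \<in> words H n"
  by (induction n arbitrary: w) (auto elim!: words_SucE)

lemma evens_odds_multilinear:
  assumes "\<And>bs. bs \<in> words H n \<Longrightarrow> (\<lambda>as. F as bs) \<in> multilinear_maps k H n N"
    and "\<And>as. as \<in> words H n \<Longrightarrow> F as \<in> multilinear_maps k H n N"
  shows "(\<lambda>w. F (evens n w) (odds n w)) \<in> multilinear_maps k H (2 * n) N"
  using assms
proof (induction n arbitrary: F)
  case 0
  then show ?case
    using multilinear_mapsD(1)[OF 0(1), of "[]" "[]"] by (auto intro!: multilinear_maps_0)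
next
  case (Suc n)
  note Fl = multilinear_maps_Cons[OF Suc.prems(1)] and Fr = multilinear_maps_Cons[OF Suc.prems(2)]
  have two: "2 * Suc n = Suc (Suc (2 * n))" by simp
  show ?case
    unfolding two
  proof (intro multilinear_maps_ConsI)
    show "(\<lambda>x. F (evens (Suc n) (x # xs)) (odds (Suc n) (x # xs))) \<in> linear_maps k H N"
      if "xs \<in> words H (Suc (2 * n))" for xs
      using that by (auto elim!: words_SucE intro!: Fl(1) evens_closed odds_closed)
    show "(\<lambda>y. F (evens (Suc n) (x # y # xs)) (odds (Suc n) (x # y # xs))) \<in> linear_maps k H N"
      if "x \<in> carrier H" "xs \<in> words H (2 * n)" for x xs
      using that by (auto intro!: Fr(1) evens_closed odds_closed)
    show "(\<lambda>xs. F (evens (Suc n) (x # y # xs)) (odds (Suc n) (x # y # xs))) \<in> multilinear_maps k H (2 * n) N"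
      if "x \<in> carrier H" "y \<in> carrier H" for x y
      using that by (auto intro!: Suc.IH Fl(2) Fr(2))
  qed
qed

lemma interleave_multilinear:
  "g \<in> multilinear_maps k H (2 * n) N \<Longrightarrow> bs \<in> words H n \<Longrightarrow>
    (\<lambda>as. g (interleave as bs)) \<in> multilinear_maps k H n N"
  "g \<in> multilinear_maps k H (2 * n) N \<Longrightarrow> as \<in> words H n \<Longrightarrow>
    (\<lambda>bs. g (interleave as bs)) \<in> multilinear_maps k H n N"
proof (induction n arbitrary: g as bs)
  case 0
  { case 1 then show ?case using multilinear_mapsD(1)[OF 1(1), of "[]"] by (auto intro!: multilinear_maps_0) }
  { case 2 then show ?case using multilinear_mapsD(1)[OF 2(1), of "[]"] by (auto intro!: multilinear_maps_0) }
next
  case (Suc n)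
  {
    case 1
    then have g: "g \<in> multilinear_maps k H (Suc (Suc (2 * n))) N" by simp
    show ?case
      using 1(2)
      by (intro multilinear_maps_ConsI)
        (auto elim!: words_SucE intro!: multilinear_maps_Cons(1)[OF g] multilinear_maps_Cons(2)[OF multilinear_maps_Cons(2)[OF g]]
          Suc.IH(1) interleave_closed)
  }
  {
    case 2
    then have g: "g \<in> multilinear_maps k H (Suc (Suc (2 * n))) N" by simp
    show ?case
      using 2(2)
      by (intro multilinear_maps_ConsI)
        (auto elim!: words_SucE intro!: multilinear_maps_Cons(1)[OF multilinear_maps_Cons(2)[OF g]]
          multilinear_maps_Cons(2)[OF multilinear_maps_Cons(2)[OF g]] Suc.IH(2) interleave_closed)
  }
qed

lemma tensor_lift_pure_tensor:
  assumes "t \<in> carrier (tensor_power k H n)"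
  shows "tensor_lift k (tensor_power k H n) (pure_tensor k H) t = t"
  by (rule tensor_lift_unique[OF module_H module_tensor_power pure_tensor_multilinear[OF module_H], symmetric])
    (simp_all add: linear_maps_ident assms)

lemma pure_tensor_append_closed:
  "\<lbrakk>xs \<in> words H 2; ys \<in> words H (2 * n)\<rbrakk> \<Longrightarrow> pure_tensor k H (xs @ ys) \<in> carrier (tensor_power k H (2 * Suc n))"
  by (rule pure_tensor_closed) (auto simp: words_def)

lemma comult_word_closed: "hs \<in> words H n \<Longrightarrow> comult_word k H \<Delta> hs \<in> carrier (tensor_power k H (2 * n))"
proof (induction n arbitrary: hs)
  case (Suc n)
  then obtain h hs' where hs: "hs = h # hs'" "h \<in> carrier H" "hs' \<in> words H n" by (auto elim!: words_SucE)
  show ?case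
    unfolding hs comult_word.simps tensor_append_def list.size words_length[OF hs(3)] add_Suc_right add_0_right
    by (rule tensor_lift_closed[OF module_H module_tensor_power _ comult_closed[OF hs(2)]],
        rule tensor_lift_closed[OF module_H module_tensor_power _ Suc.IH[OF hs(3)]], rule pure_tensor_append_closed)
qed simp

text \<open>\<open>comult_word\<close> is a tower of lifts through \<open>tensor_append\<close>. By
  linearity \<open>g\<close> passes through both lifts of the top layer, the first letter
  contributes a two-letter block, and the induction hypothesis evaluates the tail.\<close>

lemma tensor_lift_comult_word:
  assumes N: "module k N"
  shows "\<lbrakk>g \<in> multilinear_maps k H (2 * n) N; hs \<in> words H n\<rbrakk> \<Longrightarrow>
    tensor_lift k N g (comult_word k H \<Delta> hs) = sweedler_words n N (\<lambda>as bs. g (interleave as bs)) hs"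
proof (induction n arbitrary: g hs)
  case 0
  then show ?case using tensor_lift_pure[OF module_H N, of g 0 "[]"] by simp
next
  case (Suc n)
  then obtain h hs' where hs: "hs = h # hs'" "h \<in> carrier H" "hs' \<in> words H n" by (auto elim!: words_SucE)
  let ?T = "tensor_power k H (2 * Suc n)"
  have g: "g \<in> multilinear_maps k H (Suc (Suc (2 * n))) N" using Suc.prems(1) by simp
  note lg = tensor_lift_linear[OF module_H N Suc.prems(1)]
  note w = comult_word_closed[OF hs(3)]
  have "tensor_lift k N g (comult_word k H \<Delta> hs) = tensor_lift k N (\<lambda>xs. tensor_lift k N g
      (tensor_lift k ?T (\<lambda>ys. pure_tensor k H (xs @ ys)) (comult_word k H \<Delta> hs'))) (\<Delta> h)"
    unfolding hs comult_word.simps tensor_append_def list.size words_length[OF hs(3)] add_Suc_right add_0_right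
    by (rule tensor_lift_compose[OF module_H module_tensor_power N lg _ comult_closed[OF hs(2)]],
        rule tensor_lift_closed[OF module_H module_tensor_power _ w], rule pure_tensor_append_closed)
  also have "\<dots> = tensor_lift k N (\<lambda>xs. sweedler_words n N (\<lambda>as bs. g (xs ! 0 # xs ! 1 # interleave as bs)) hs') (\<Delta> h)"
  proof (rule tensor_lift_cong[OF module_H N comult_closed[OF hs(2)]])
    fix xs assume xs: "xs \<in> words H 2"
    have g2: "(\<lambda>ys. g (xs ! 0 # xs ! 1 # ys)) \<in> multilinear_maps k H (2 * n) N"
      using words_2[OF xs] by (intro multilinear_maps_Cons(2)[OF multilinear_maps_Cons(2)[OF g]]) auto
    have gxs: "g (xs @ ys) = g (xs ! 0 # xs ! 1 # ys)" for ys
      using words_2[OF xs] by (metis append_Cons append_Nil)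
    have "tensor_lift k N g (tensor_lift k ?T (\<lambda>ys. pure_tensor k H (xs @ ys)) (comult_word k H \<Delta> hs')) =
        tensor_lift k N (\<lambda>ys. tensor_lift k N g (pure_tensor k H (xs @ ys))) (comult_word k H \<Delta> hs')"
      by (rule tensor_lift_compose[OF module_H module_tensor_power N lg _ w])
        (rule pure_tensor_append_closed[OF xs])
    also have "\<dots> = tensor_lift k N (\<lambda>ys. g (xs ! 0 # xs ! 1 # ys)) (comult_word k H \<Delta> hs')"
    proof (rule tensor_lift_cong[OF module_H N w])
      fix ys assume "ys \<in> words H (2 * n)"
      then have "xs @ ys \<in> words H (2 * Suc n)" using xs by (auto simp: words_def)
      then show "tensor_lift k N g (pure_tensor k H (xs @ ys)) = g (xs ! 0 # xs ! 1 # ys)"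
        using tensor_lift_pure[OF module_H N Suc.prems(1)] gxs by simp
    qed (rule multilinear_mapsD(1)[OF g2])
    also have "\<dots> = sweedler_words n N (\<lambda>as bs. g (xs ! 0 # xs ! 1 # interleave as bs)) hs'"
      by (rule Suc.IH[OF g2 hs(3)])
    finally show "tensor_lift k N g (tensor_lift k ?T (\<lambda>ys. pure_tensor k H (xs @ ys)) (comult_word k H \<Delta> hs')) = \<dots>" .
    show "sweedler_words n N (\<lambda>as bs. g (xs ! 0 # xs ! 1 # interleave as bs)) hs' \<in> carrier N"
      by (intro sweedler_words_closed N multilinear_mapsD(1)[OF g2] interleave_closed)
  qed
  also have "\<dots> = sweedler N (\<lambda>a b. sweedler_words n N (\<lambda>as bs. g (a # b # interleave as bs)) hs') h"
    by (rule sweedler_tensor_lift[OF N hs(2)])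
      (auto intro!: sweedler_words_closed N multilinear_mapsD(1)[OF g] interleave_closed)
  finally show ?case by (simp add: hs)
qed

text \<open>Lifting \<open>pure_tensor\<close> is the identity, so the previous lemma with
  \<open>g\<close> equal to \<open>pure_tensor\<close> displays \<open>comult_word\<close> as a
  Sweedler sum whose multilinearity is known.\<close>

lemma comult_word_multilinear: "comult_word k H \<Delta> \<in> multilinear_maps k H n (tensor_power k H (2 * n))"
proof (rule multilinear_maps_cong[OF module_H])
  let ?T = "tensor_power k H (2 * n)"
  note pm = pure_tensor_multilinear[OF module_H, of "2 * n"]
  show "sweedler_words n ?T (\<lambda>as bs. pure_tensor k H (interleave as bs)) \<in> multilinear_maps k H n ?T"
    by (rule sweedler_words_multilinear) (auto intro!: interleave_multilinear pm)
  show "comult_word k H \<Delta> xs = sweedler_words n ?T (\<lambda>as bs. pure_tensor k H (interleave as bs)) xs"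
    if "xs \<in> words H n" for xs
    using tensor_lift_comult_word[OF module_tensor_power pm that] tensor_lift_pure_tensor[OF comult_word_closed[OF that]]
    by simp
qed

end

section \<open>The operator \<open>E\<close> and its relations with faces and degeneracies\<close>

locale hopf_pair = hopf_character k H \<Delta> \<epsilon> S \<delta>
  for k :: "('k, 'a) ring_scheme" and H :: "('k, 'h, 'b) module_scheme" (structure) and \<Delta> \<epsilon> S \<delta> +
  fixes \<sigma> :: 'h
  assumes grouplike: "grouplike k H \<Delta> \<epsilon> \<sigma>"
begin

lemma grouplikeD [simp]: "\<sigma> \<in> carrier H" "\<epsilon> \<sigma> = \<one>\<^bsub>k\<^esub>"
  using grouplike by (auto simp: grouplike_def)

lemma sweedler_grouplike: "\<lbrakk>module k N; F \<in> bilinear_maps N\<rbrakk> \<Longrightarrow> sweedler N F \<sigma> = F \<sigma> \<sigma>"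
  by (rule sweedler_pure) (use grouplike in \<open>auto simp: grouplike_def\<close>)

text \<open>At a grouplike element the antipode law has a single term. It evaluates the head
  S_\<sigma>(\<sigma>) that is left in \<open>extra_extra_pure\<close>.\<close>

lemma grouplike_antipode: "\<sigma> \<otimes> S \<sigma> = \<one>"
proof -
  have "sweedler H (\<lambda>a b. a \<otimes> S b) \<sigma> = \<sigma> \<otimes> S \<sigma>"
    by (rule sweedler_grouplike) (auto intro!: linear_intros)
  then show ?thesis
    using sweedler_antipode_right[OF module_H linear_maps_ident, of \<sigma>] by simp
qed

abbreviation \<open>S\<sigma> h \<equiv> \<sigma> \<otimes> S h\<close>

text \<open>\<open>S\<close> reverses the two legs, while the grouplike \<open>\<sigma>\<close>
  multiplies each of them once.\<close>

lemma sweedler_sigma_antipode: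
  assumes N: "module k N" and F: "F \<in> bilinear_maps N" and y: "y \<in> carrier H"
  shows "sweedler N F (S\<sigma> y) = sweedler N (\<lambda>a b. F (S\<sigma> b) (S\<sigma> a)) y"
proof -
  note lin = linear_intros bilinear_mapsD[OF F] N
  have "sweedler N F (S\<sigma> y) = sweedler N (\<lambda>a b. sweedler N (\<lambda>c d. F (a \<otimes> c) (b \<otimes> d)) (S y)) \<sigma>"
    by (rule sweedler_mult[OF N F]) (simp_all add: y)
  also have "\<dots> = sweedler N (\<lambda>c d. F (\<sigma> \<otimes> c) (\<sigma> \<otimes> d)) (S y)"
    by (rule sweedler_grouplike) (auto intro!: lin simp: y)
  also have "\<dots> = sweedler N (\<lambda>a b. F (S\<sigma> b) (S\<sigma> a)) y"
    by (rule sweedler_antipode) (auto intro!: lin simp: y)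
  finally show ?thesis .
qed

lemma pure_head_linear:
  "\<lbrakk>f \<in> linear_maps k X H; vs \<in> words H n\<rbrakk> \<Longrightarrow> (\<lambda>x. pure (f x # vs)) \<in> linear_maps k X (T (Suc n))"
  by (rule linear_maps_compose[OF multilinear_maps_Cons(1)[OF pure_multilinear]])

lemma pure_second_linear:
  "\<lbrakk>f \<in> linear_maps k X H; u \<in> carrier H; vs \<in> words H n\<rbrakk> \<Longrightarrow>
    (\<lambda>x. pure (u # f x # vs)) \<in> linear_maps k X (T (Suc (Suc n)))"
  by (rule linear_maps_compose[OF multilinear_maps_Cons(1)[OF multilinear_maps_Cons(2)[OF pure_multilinear]]])

lemma pure_tail_multilinear:
  "u \<in> carrier H \<Longrightarrow> (\<lambda>vs. pure (u # vs)) \<in> multilinear_maps k H n (T (Suc n))"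
  by (rule multilinear_maps_Cons(2)[OF pure_multilinear])

lemma pure_tail2_multilinear:
  "\<lbrakk>u \<in> carrier H; v \<in> carrier H\<rbrakk> \<Longrightarrow> (\<lambda>vs. pure (u # v # vs)) \<in> multilinear_maps k H n (T (Suc (Suc n)))"
  by (rule multilinear_maps_Cons(2)[OF multilinear_maps_Cons(2)[OF pure_multilinear]])

definition extra_word :: "'h list \<Rightarrow> 'h list \<Rightarrow> ('h list \<Rightarrow> 'k) set"
  where "extra_word as bs = pure (S\<sigma> (word_prod as) # bs)"

definition extra_degeneracy :: "nat \<Rightarrow> ('h list \<Rightarrow> 'k) set \<Rightarrow> ('h list \<Rightarrow> 'k) set"
  where "extra_degeneracy n = tensor_lift k (T (Suc n)) (sweedler_words n (T (Suc n)) extra_word)"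

abbreviation "E \<equiv> extra_degeneracy"

lemma extra_word_multilinear:
  "bs \<in> words H n \<Longrightarrow> (\<lambda>as. extra_word as bs) \<in> multilinear_maps k H m (T (Suc n))"
  "as \<in> words H m \<Longrightarrow> extra_word as \<in> multilinear_maps k H n (T (Suc n))"
  unfolding extra_word_def
  by (intro word_prod_multilinear[where g = "\<lambda>z. pure (S\<sigma> z # bs)"] pure_head_linear linear_intros; simp)
    (intro pure_tail_multilinear; simp)

lemma extra_word_closed [simp]:
  "\<lbrakk>as \<in> words H m; bs \<in> words H n\<rbrakk> \<Longrightarrow> extra_word as bs \<in> carrier (T (Suc n))"
  by (rule multilinear_mapsD(1)[OF extra_word_multilinear(2)])

lemma extra_sweedler_multilinear:
  "sweedler_words n (T (Suc n)) extra_word \<in> multilinear_maps k H n (T (Suc n))"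
  by (rule sweedler_words_multilinear) (simp_all add: extra_word_multilinear)

lemma extra_linear: "E n \<in> linear_maps k (T n) (T (Suc n))"
  unfolding extra_degeneracy_def by (rule tensor_lift_linear) (simp_all add: extra_sweedler_multilinear)

lemma extra_pure: "hs \<in> words H n \<Longrightarrow> E n (pure hs) = sweedler_words n (T (Suc n)) extra_word hs"
  unfolding extra_degeneracy_def
  by (rule tensor_lift_pure[OF module_H module_tensor_power extra_sweedler_multilinear])

lemma words_set: "xs \<in> words H n \<Longrightarrow> set xs \<subseteq> carrier H"
  by (simp add: words_def)

text \<open>Since \<epsilon>(\<sigma>) = 1 and \<epsilon> S = \<epsilon>, the counit of the head is
  the counit of the product of all first legs, and the counit law removes them.\<close>

lemma face_zero_extra_pure:
  assumes hs: "hs \<in> words H n"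
  shows "D (Suc n) 0 (E n (pure hs)) = pure hs"
proof -
  have "D (Suc n) 0 (E n (pure hs)) = sweedler_words n (T n) (\<lambda>as bs. D (Suc n) 0 (extra_word as bs)) hs"
    unfolding extra_pure[OF hs] using face_linear[of "Suc n" 0]
    by (intro sweedler_words_compose) simp_all
  also have "\<dots> = sweedler_words n (T n) (\<lambda>as bs. \<epsilon> (word_prod as) \<odot>\<^bsub>T n\<^esub> pure bs) hs"
  proof (rule sweedler_words_cong[OF refl])
    fix as bs assume *: "as \<in> words H n" "bs \<in> words H n"
    show "D (Suc n) 0 (extra_word as bs) = \<epsilon> (word_prod as) \<odot>\<^bsub>T n\<^esub> pure bs"
      using * word_prod_closed[OF *(1)] by (simp add: extra_word_def face_zero words_set words_length counit counit_antipode)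
  qed
  also have "\<dots> = pure hs"
    by (rule sweedler_words_counit_left[OF module_tensor_power pure_multilinear hs])
  finally show ?thesis .
qed

text \<open>Antimultiplicativity makes S(a), for the first leg \<open>a\<close> of \<open>h\<close>,
  the rightmost factor of the head. Merging puts it next to the second leg \<open>b\<close>, and the
  antipode law applies.\<close>

lemma face_one_extra_pure:
  assumes h: "h \<in> carrier H" and hs: "hs \<in> words H n"
  shows "D (Suc (Suc n)) 1 (E (Suc n) (pure (h # hs))) = E n (D (Suc n) 0 (pure (h # hs)))"
proof -
  have "D (Suc (Suc n)) 1 (E (Suc n) (pure (h # hs))) = sweedler_words (Suc n) (T (Suc n)) (\<lambda>as bs. D (Suc (Suc n)) 1 (extra_word as bs)) (h # hs)"
    using face_linear[of "Suc (Suc n)" 1] h hs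
    by (subst extra_pure, simp, intro sweedler_words_compose) simp_all
  also have "\<dots> = sweedler (T (Suc n)) (\<lambda>a b. sweedler_words n (T (Suc n)) (\<lambda>as bs. pure ((S\<sigma> (word_prod as) \<otimes> (S a \<otimes> b)) # bs)) hs) h"
    unfolding sweedler_words.simps list.sel
  proof (intro sweedler_cong sweedler_words_cong refl)
    fix a b as bs assume *: "a \<in> carrier H" "b \<in> carrier H" "as \<in> words H n" "bs \<in> words H n"
    then show "D (Suc (Suc n)) 1 (extra_word (a # as) (b # bs)) = pure ((S\<sigma> (word_prod as) \<otimes> (S a \<otimes> b)) # bs)"
      using word_prod_closed[OF *(3)] face_merge[of "S\<sigma> (word_prod (a # as))" b "[]" bs 1 "Suc (Suc n)"]
      by (simp add: extra_word_def words_set words_length antipode_mult M.m_assoc)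
  qed
  also have "\<dots> = \<epsilon> h \<odot>\<^bsub>T (Suc n)\<^esub> sweedler_words n (T (Suc n)) (\<lambda>as bs. pure ((S\<sigma> (word_prod as) \<otimes> \<one>) # bs)) hs"
    by (rule sweedler_antipode_left[where g = "\<lambda>z. sweedler_words n (T (Suc n)) (\<lambda>as bs. pure ((S\<sigma> (word_prod as) \<otimes> z) # bs)) hs"])
      (auto intro!: sweedler_words_parameter_linear pure_head_linear linear_intros h hs)
  also have "\<dots> = \<epsilon> h \<odot>\<^bsub>T (Suc n)\<^esub> E n (pure hs)"
    using hs by (simp add: extra_pure extra_word_def[abs_def])
  also have "\<dots> = E n (D (Suc n) 0 (pure (h # hs)))"
    using h hs by (simp add: face_zero words_set words_length linear_mapsD(3)[OF extra_linear])
  finally show ?thesis .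
qed

text \<open>Multiplicativity of \<open>\<Delta>\<close> joins the legs of \<open>x\<close> and
  \<open>y\<close> into those of \<open>x \<otimes> y\<close>; the head only sees the product of all
  first legs, which associativity leaves unchanged.\<close>

lemma face_merge_extra_pure:
  assumes us: "us \<in> words H p" and x: "x \<in> carrier H" and y: "y \<in> carrier H" and vs: "vs \<in> words H q"
  shows "D (Suc (p + Suc (Suc q))) (Suc (Suc p)) (E (p + Suc (Suc q)) (pure (us @ x # y # vs))) =
    E (p + Suc q) (pure (us @ (x \<otimes> y) # vs))"
proof -
  let ?n = "p + Suc (Suc q)" and ?M = "T (Suc (p + Suc q))"
  have w: "us @ x # y # vs \<in> words H ?n" "us @ (x \<otimes> y) # vs \<in> words H (p + Suc q)"
    using us x y vs by (auto simp: words_def)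
  have "D (Suc ?n) (Suc (Suc p)) (E ?n (pure (us @ x # y # vs))) =
      sweedler_words ?n ?M (\<lambda>as bs. D (Suc ?n) (Suc (Suc p)) (extra_word as bs)) (us @ x # y # vs)"
    unfolding extra_pure[OF w(1)] using face_linear[of "Suc ?n" "Suc (Suc p)"]
    by (intro sweedler_words_compose) simp_all
  also have "\<dots> = sweedler_words p ?M (\<lambda>as bs. sweedler ?M (\<lambda>a b. sweedler ?M (\<lambda>c d.
      sweedler_words q ?M (\<lambda>cs ds. extra_word (as @ (a \<otimes> c) # cs) (bs @ (b \<otimes> d) # ds)) vs) y) x) us"
    unfolding sweedler_words_append[OF us] sweedler_words.simps list.sel
  proof (intro sweedler_cong sweedler_words_cong refl)
    fix as bs a b c d cs ds
    assume *: "as \<in> words H p" "bs \<in> words H p" "a \<in> carrier H" "b \<in> carrier H" "c \<in> carrier H" "d \<in> carrier H"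
      "cs \<in> words H q" "ds \<in> words H q"
    have 1: "word_prod (as @ a # c # cs) = word_prod (as @ (a \<otimes> c) # cs)"
      using * word_prod_append[OF *(1), of "a # c # cs" "Suc (Suc q)"] word_prod_append[OF *(1), of "(a \<otimes> c) # cs" "Suc q"]
        word_prod_closed[OF *(7)] by (simp add: M.m_assoc)
    have 2: "word_prod (as @ (a \<otimes> c) # cs) \<in> carrier H"
      by (rule word_prod_closed[of _ "p + Suc q"]) (use * in \<open>auto simp: words_def\<close>)
    show "D (Suc ?n) (Suc (Suc p)) (extra_word (as @ a # c # cs) (bs @ b # d # ds)) =
        extra_word (as @ (a \<otimes> c) # cs) (bs @ (b \<otimes> d) # ds)"
      unfolding extra_word_def 1
      using * 2 face_merge[of b d "S\<sigma> (word_prod (as @ (a \<otimes> c) # cs)) # bs" ds "Suc (Suc p)" "Suc ?n"]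
      by (simp add: words_set words_length)
  qed
  also have "\<dots> = sweedler_words p ?M (\<lambda>as bs. sweedler ?M (\<lambda>a b.
      sweedler_words q ?M (\<lambda>cs ds. extra_word (as @ a # cs) (bs @ b # ds)) vs) (x \<otimes> y)) us"
  proof (rule sweedler_words_cong[OF refl], rule sweedler_mult[OF module_tensor_power _ x y, symmetric], rule bilinear_mapsI)
    fix as bs assume *: "as \<in> words H p" "bs \<in> words H p"
    have w: "ys @ z # zs \<in> words H (p + Suc q)" if "ys \<in> words H p" "z \<in> carrier H" "zs \<in> words H q" for ys z zs
      using that by (auto simp: words_def)
    show "(\<lambda>b. sweedler_words q ?M (\<lambda>cs ds. extra_word (as @ a # cs) (bs @ b # ds)) vs) \<in> linear_maps k H ?M"
      if a: "a \<in> carrier H" for a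
    proof (rule sweedler_words_parameter_linear[OF module_H module_tensor_power vs])
      fix cs ds assume "cs \<in> words H q" "ds \<in> words H q"
      with * a w show "(\<lambda>b. extra_word (as @ a # cs) (bs @ b # ds)) \<in> linear_maps k H ?M"
        by (intro multilinear_maps_slot[OF extra_word_multilinear(2)]) auto
    qed
    show "(\<lambda>a. sweedler_words q ?M (\<lambda>cs ds. extra_word (as @ a # cs) (bs @ b # ds)) vs) \<in> linear_maps k H ?M"
      if b: "b \<in> carrier H" for b
    proof (rule sweedler_words_parameter_linear[OF module_H module_tensor_power vs])
      fix cs ds assume "cs \<in> words H q" "ds \<in> words H q"
      with * b w show "(\<lambda>a. extra_word (as @ a # cs) (bs @ b # ds)) \<in> linear_maps k H ?M"
        by (intro multilinear_maps_slot[OF extra_word_multilinear(1)]) auto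
    qed
  qed
  also have "\<dots> = E (p + Suc q) (pure (us @ (x \<otimes> y) # vs))"
    unfolding extra_pure[OF w(2)] sweedler_words_append[OF us] by simp
  finally show ?thesis .
qed

text \<open>An inserted \<open>\<one>\<close> has the single pair of legs \<open>\<one>\<close>,
  \<open>\<one>\<close>: its first leg disappears in the product in the head and its second is the
  inserted letter.\<close>

lemma degeneracy_extra_pure:
  assumes us: "us \<in> words H p" and vs: "vs \<in> words H q"
  shows "Z (Suc (p + q)) (Suc p) (E (p + q) (pure (us @ vs))) = E (p + Suc q) (pure (us @ \<one> # vs))"
proof -
  let ?M = "T (Suc (p + Suc q))"
  have w: "us @ vs \<in> words H (p + q)" "us @ \<one> # vs \<in> words H (p + Suc q)"
    using us vs by (auto simp: words_def)
  have "Z (Suc (p + q)) (Suc p) (E (p + q) (pure (us @ vs))) =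
      sweedler_words (p + q) ?M (\<lambda>as bs. Z (Suc (p + q)) (Suc p) (extra_word as bs)) (us @ vs)"
    unfolding extra_pure[OF w(1)] using degeneracy_linear[of "Suc p" "Suc (p + q)"]
    by (intro sweedler_words_compose) simp_all
  also have "\<dots> = sweedler_words p ?M (\<lambda>as bs.
      sweedler_words q ?M (\<lambda>cs ds. extra_word (as @ \<one> # cs) (bs @ \<one> # ds)) vs) us"
    unfolding sweedler_words_append[OF us]
  proof (intro sweedler_words_cong refl)
    fix as bs cs ds
    assume *: "as \<in> words H p" "bs \<in> words H p" "cs \<in> words H q" "ds \<in> words H q"
    have 1: "word_prod (as @ \<one> # cs) = word_prod (as @ cs)"
      using * word_prod_append[OF *(1), of "\<one> # cs" "Suc q"] word_prod_append[OF *(1,3)] word_prod_closed[OF *(3)] by simp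
    have 2: "word_prod (as @ cs) \<in> carrier H"
      by (rule word_prod_closed[of _ "p + q"]) (use * in \<open>auto simp: words_def\<close>)
    show "Z (Suc (p + q)) (Suc p) (extra_word (as @ cs) (bs @ ds)) = extra_word (as @ \<one> # cs) (bs @ \<one> # ds)"
      unfolding extra_word_def 1
      using * 2 degeneracy_pure[of "S\<sigma> (word_prod (as @ cs)) # bs" ds "Suc p" "Suc (p + q)"]
      by (simp add: words_set words_length)
  qed
  also have "\<dots> = sweedler_words p ?M (\<lambda>as bs. sweedler ?M (\<lambda>a b.
      sweedler_words q ?M (\<lambda>cs ds. extra_word (as @ a # cs) (bs @ b # ds)) vs) \<one>) us"
  proof (rule sweedler_words_cong[OF refl], rule sweedler_one[OF module_tensor_power, symmetric], rule bilinear_mapsI)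
    fix as bs assume *: "as \<in> words H p" "bs \<in> words H p"
    have w: "ys @ z # zs \<in> words H (p + Suc q)" if "ys \<in> words H p" "z \<in> carrier H" "zs \<in> words H q" for ys z zs
      using that by (auto simp: words_def)
    show "(\<lambda>b. sweedler_words q ?M (\<lambda>cs ds. extra_word (as @ a # cs) (bs @ b # ds)) vs) \<in> linear_maps k H ?M"
      if a: "a \<in> carrier H" for a
    proof (rule sweedler_words_parameter_linear[OF module_H module_tensor_power vs])
      fix cs ds assume "cs \<in> words H q" "ds \<in> words H q"
      with * a w show "(\<lambda>b. extra_word (as @ a # cs) (bs @ b # ds)) \<in> linear_maps k H ?M"
        by (intro multilinear_maps_slot[OF extra_word_multilinear(2)]) auto
    qed
    show "(\<lambda>a. sweedler_words q ?M (\<lambda>cs ds. extra_word (as @ a # cs) (bs @ b # ds)) vs) \<in> linear_maps k H ?M"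
      if b: "b \<in> carrier H" for b
    proof (rule sweedler_words_parameter_linear[OF module_H module_tensor_power vs])
      fix cs ds assume "cs \<in> words H q" "ds \<in> words H q"
      with * b w show "(\<lambda>a. extra_word (as @ a # cs) (bs @ b # ds)) \<in> linear_maps k H ?M"
        by (intro multilinear_maps_slot[OF extra_word_multilinear(1)]) auto
    qed
  qed
  also have "\<dots> = E (p + Suc q) (pure (us @ \<one> # vs))"
    unfolding extra_pure[OF w(2)] sweedler_words_append[OF us] by simp
  finally show ?thesis .
qed

text \<open>Because S_\<sigma> reverses legs, the second leg \<open>q\<close> of \<open>y\<close>
  enters the new head, immediately before the first legs of \<open>bs\<close>. This adjacency
  prepares the cancellation in the next lemma and in \<open>extra_cyclic_pure\<close>.\<close>

lemma extra_sigma_antipode_pure: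
  assumes y: "y \<in> carrier H" and bs: "bs \<in> words H n"
  shows "E (Suc n) (pure (S\<sigma> y # bs)) = sweedler (T (Suc (Suc n))) (\<lambda>p q.
    sweedler_words n (T (Suc (Suc n))) (\<lambda>cs ds. pure (S\<sigma> (S\<sigma> q \<otimes> word_prod cs) # S\<sigma> p # ds)) bs) y"
proof -
  have "E (Suc n) (pure (S\<sigma> y # bs)) = sweedler (T (Suc (Suc n))) (\<lambda>u v.
    sweedler_words n (T (Suc (Suc n))) (\<lambda>cs ds. pure (S\<sigma> (u \<otimes> word_prod cs) # v # ds)) bs) (S\<sigma> y)"
    using y bs by (simp add: extra_pure extra_word_def)
  also have "\<dots> = sweedler (T (Suc (Suc n))) (\<lambda>p q.
    sweedler_words n (T (Suc (Suc n))) (\<lambda>cs ds. pure (S\<sigma> (S\<sigma> q \<otimes> word_prod cs) # S\<sigma> p # ds)) bs) y"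
    by (rule sweedler_sigma_antipode)
      (auto intro!: linear_intros sweedler_words_parameter_linear pure_head_linear pure_second_linear y bs)
  finally show ?thesis .
qed

text \<open>The new head is S_\<sigma>(\<sigma> S(q) c), where q and c are products of neighbouring
  legs of the same word. They cancel, and the remaining S_\<sigma>(\<sigma>) is
  \<open>\<one>\<close>.\<close>

lemma extra_extra_pure:
  assumes hs: "hs \<in> words H n"
  shows "E (Suc n) (E n (pure hs)) = Z (Suc n) 0 (E n (pure hs))"
proof -
  let ?M = "T (Suc (Suc n))"
  have "E (Suc n) (E n (pure hs)) = sweedler_words n ?M (\<lambda>as bs. E (Suc n) (extra_word as bs)) hs"
    unfolding extra_pure[OF hs] by (intro sweedler_words_compose extra_linear) simp_all
  also have "\<dots> = sweedler_words n ?M (\<lambda>as bs. sweedler_words n ?M (\<lambda>ps qs. sweedler_words n ?M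
      (\<lambda>cs ds. pure (S\<sigma> (\<sigma> \<otimes> (S (word_prod qs) \<otimes> word_prod cs)) # S\<sigma> (word_prod ps) # ds)) bs) as) hs"
  proof (rule sweedler_words_cong[OF refl])
    fix as bs assume *: "as \<in> words H n" "bs \<in> words H n"
    have "E (Suc n) (extra_word as bs) = sweedler ?M (\<lambda>p q.
        sweedler_words n ?M (\<lambda>cs ds. pure (S\<sigma> (S\<sigma> q \<otimes> word_prod cs) # S\<sigma> p # ds)) bs) (word_prod as)"
      unfolding extra_word_def by (rule extra_sigma_antipode_pure[OF word_prod_closed[OF *(1)] *(2)])
    also have "\<dots> = sweedler_words n ?M (\<lambda>ps qs. sweedler_words n ?M
      (\<lambda>cs ds. pure (S\<sigma> (S\<sigma> (word_prod qs) \<otimes> word_prod cs) # S\<sigma> (word_prod ps) # ds)) bs) as"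
      by (rule sweedler_word_prod)
        (auto intro!: linear_intros sweedler_words_parameter_linear pure_head_linear pure_second_linear *)
    also have "\<dots> = sweedler_words n ?M (\<lambda>ps qs. sweedler_words n ?M
      (\<lambda>cs ds. pure (S\<sigma> (\<sigma> \<otimes> (S (word_prod qs) \<otimes> word_prod cs)) # S\<sigma> (word_prod ps) # ds)) bs) as"
    proof (intro sweedler_words_cong refl)
      fix ps qs cs ds assume "qs \<in> words H n" "cs \<in> words H n"
      then have "word_prod qs \<in> carrier H" "word_prod cs \<in> carrier H" by (auto intro!: word_prod_closed)
      then show "pure (S\<sigma> (S\<sigma> (word_prod qs) \<otimes> word_prod cs) # S\<sigma> (word_prod ps) # ds) =
        pure (S\<sigma> (\<sigma> \<otimes> (S (word_prod qs) \<otimes> word_prod cs)) # S\<sigma> (word_prod ps) # ds)"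
        by (simp add: M.m_assoc)
    qed
    finally show "E (Suc n) (extra_word as bs) = \<dots>" .
  qed
  also have "\<dots> = sweedler_words n ?M (\<lambda>ps ds. pure (S\<sigma> (\<sigma> \<otimes> \<one>) # S\<sigma> (word_prod ps) # ds)) hs"
    by (rule sweedler_words_antipode_cancel[where B = "\<lambda>z ps ds. pure (S\<sigma> (\<sigma> \<otimes> z) # S\<sigma> (word_prod ps) # ds)"])
      (auto intro!: hs linear_intros pure_head_linear pure_second_linear pure_tail2_multilinear
        word_prod_multilinear[where g = "\<lambda>w. pure (_ # S\<sigma> w # _)"])
  also have "\<dots> = sweedler_words n ?M (\<lambda>as bs. Z (Suc n) 0 (extra_word as bs)) hs"
  proof (intro sweedler_words_cong refl)
    fix as bs assume *: "as \<in> words H n" "bs \<in> words H n"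
    then show "pure (S\<sigma> (\<sigma> \<otimes> \<one>) # S\<sigma> (word_prod as) # bs) = Z (Suc n) 0 (extra_word as bs)"
      using degeneracy_pure[of "[]" "S\<sigma> (word_prod as) # bs" 0 "Suc n"] word_prod_closed[OF *(1)]
      by (simp add: extra_word_def grouplike_antipode words_set words_length)
  qed
  also have "\<dots> = Z (Suc n) 0 (E n (pure hs))"
    unfolding extra_pure[OF hs] using degeneracy_linear[of 0 "Suc n"]
    by (intro sweedler_words_compose[symmetric]) simp_all
  finally show ?thesis .
qed

lemma face_zero_extra: assumes t: "t \<in> carrier (T n)" shows "D (Suc n) 0 (E n t) = t"
  by (rule tensor_power_ext[OF module_H module_tensor_power _ _ _ t, where f = "\<lambda>t. D (Suc n) 0 (E n t)" and g = "\<lambda>t. t"])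
    (use linear_maps_compose[OF face_linear extra_linear, of n 0] linear_maps_ident in \<open>auto simp: face_zero_extra_pure\<close>)

lemma face_extra:
  assumes i: "1 \<le> i" "i \<le> n" and t: "t \<in> carrier (T n)"
  shows "D (Suc n) i (E n t) = E (n - 1) (D n (i - 1) t)"
proof (rule tensor_power_ext[OF module_H module_tensor_power _ _ _ t, where f = "\<lambda>t. D (Suc n) i (E n t)"
      and g = "\<lambda>t. E (n - 1) (D n (i - 1) t)"])
  obtain m where n: "n = Suc m" using i by (cases n) auto
  have "D (Suc n) i \<in> linear_maps k (T (Suc n)) (T n)"
    using face_linear[of "Suc n" i] i by simp
  then show "(\<lambda>t. D (Suc n) i (E n t)) \<in> linear_maps k (T n) (T n)"
    by (rule linear_maps_compose[OF _ extra_linear])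
  have "D n (i - 1) \<in> linear_maps k (T n) (T m)"
    using face_linear[of n "i - 1"] i n by simp
  from linear_maps_compose[OF extra_linear this]
  show "(\<lambda>t. E (n - 1) (D n (i - 1) t)) \<in> linear_maps k (T n) (T n)" by (simp add: n)
  fix w assume w: "w \<in> words H n"
  show "D (Suc n) i (E n (pure w)) = E (n - 1) (D n (i - 1) (pure w))"
  \<comment> \<open>The face with index 1 touches the head and needs the antipode law; a higher
    index merges two second legs and corresponds to a merge in \<open>w\<close>.\<close>
  proof (cases "i = 1")
    case True
    then show ?thesis using face_one_extra_pure w by (auto simp: n elim!: words_SucE)
  next
    case False
    with i obtain p where p: "i = Suc (Suc p)" by (metis One_nat_def Suc_le_D le_SucE le_zero_eq nat.exhaust)
    obtain q where q: "n = p + Suc (Suc q)"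
      using i p le_Suc_ex[of i n] by auto
    obtain us x y vs where *: "w = us @ x # y # vs" "us \<in> words H p" "x \<in> carrier H" "y \<in> carrier H" "vs \<in> words H q"
      using w unfolding q by (elim words_addE words_SucE) auto
    then show ?thesis
      using face_merge_extra_pure[OF *(2-5)] face_merge[of x y us vs "Suc p" n]
      by (simp add: p q words_set words_length)
  qed
qed

lemma degeneracy_extra:
  assumes i: "1 \<le> i" "i \<le> Suc n" and t: "t \<in> carrier (T n)"
  shows "Z (Suc n) i (E n t) = E (Suc n) (Z n (i - 1) t)"
proof (rule tensor_power_ext[OF module_H module_tensor_power _ _ _ t, where f = "\<lambda>t. Z (Suc n) i (E n t)"
      and g = "\<lambda>t. E (Suc n) (Z n (i - 1) t)"])
  have "Z (Suc n) i \<in> linear_maps k (T (Suc n)) (T (Suc (Suc n)))"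
    using degeneracy_linear[of i "Suc n"] i by simp
  then show "(\<lambda>t. Z (Suc n) i (E n t)) \<in> linear_maps k (T n) (T (Suc (Suc n)))"
    by (rule linear_maps_compose[OF _ extra_linear])
  have "Z n (i - 1) \<in> linear_maps k (T n) (T (Suc n))"
    using degeneracy_linear[of "i - 1" n] i by simp
  from linear_maps_compose[OF extra_linear this]
  show "(\<lambda>t. E (Suc n) (Z n (i - 1) t)) \<in> linear_maps k (T n) (T (Suc (Suc n)))" .
  obtain p where p: "i = Suc p" using i by (cases i) auto
  obtain q where q: "n = p + q" using i p le_Suc_ex[of p n] by auto
  fix w assume w: "w \<in> words H n"
  obtain us vs where *: "w = us @ vs" "us \<in> words H p" "vs \<in> words H q"
    using w unfolding q by (elim words_addE) auto
  then show "Z (Suc n) i (E n (pure w)) = E (Suc n) (Z n (i - 1) (pure w))"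
    using degeneracy_extra_pure[OF *(2,3)] degeneracy_pure[of us vs p n]
    by (simp add: p q words_set words_length)
qed

lemma extra_extra: assumes t: "t \<in> carrier (T n)" shows "E (Suc n) (E n t) = Z (Suc n) 0 (E n t)"
  by (rule tensor_power_ext[OF module_H module_tensor_power _ _ _ t, where f = "\<lambda>t. E (Suc n) (E n t)" and g = "\<lambda>t. Z (Suc n) 0 (E n t)"])
    (use linear_maps_compose[OF degeneracy_linear extra_linear, of 0 n] linear_maps_compose[OF extra_linear extra_linear]
      in \<open>auto simp: extra_extra_pure\<close>)

section \<open>The cyclic operator in terms of \<open>E\<close>\<close>

abbreviation "\<tau> \<equiv> cyclic_operator k H \<Delta> S \<delta> \<sigma>"

lemma cyclic_word_multilinear: "cyclic_word k H S \<delta> \<sigma> (Suc m) \<in> multilinear_maps k H (2 * Suc m) (T (Suc m))"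
proof -
  let ?F = "\<lambda>as bs. \<delta> (last bs) \<odot>\<^bsub>T (Suc m)\<^esub> pure (S\<sigma> (word_prod as) # butlast bs)"
  have "cyclic_word k H S \<delta> \<sigma> (Suc m) = (\<lambda>w. ?F (evens (Suc m) w) (odds (Suc m) w))"
    by (simp add: fun_eq_iff cyclic_word_def evens_def odds_def Let_def del: upt_Suc)
  also have "\<dots> \<in> multilinear_maps k H (2 * Suc m) (T (Suc m))"
  proof (rule evens_odds_multilinear)
    fix bs assume "bs \<in> words H (Suc m)"
    then obtain b bs' where "bs = bs' @ [b]" "b \<in> carrier H" "bs' \<in> words H m"
      by (auto elim: words_snocE)
    then show "(\<lambda>as. ?F as bs) \<in> multilinear_maps k H (Suc m) (T (Suc m))"
      by (intro word_prod_multilinear[where g = "\<lambda>z. \<delta> (last bs) \<odot>\<^bsub>T (Suc m)\<^esub> pure (S\<sigma> z # butlast bs)"])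
        (auto intro!: linear_intros pure_head_linear)
  next
    fix as assume "as \<in> words H (Suc m)"
    note [simp] = word_prod_closed[OF this]
    show "?F as \<in> multilinear_maps k H (Suc m) (T (Suc m))"
    proof (rule multilinear_maps_snocI)
      show "(\<lambda>x. ?F as (xs @ [x])) \<in> linear_maps k H (T (Suc m))" if "xs \<in> words H m" for xs
        using that by (auto intro!: char_intros)
      show "(\<lambda>xs. ?F as (xs @ [x])) \<in> multilinear_maps k H m (T (Suc m))" if "x \<in> carrier H" for x
        using that multilinear_maps_compose[OF linear_maps_smult[OF module_tensor_power linear_maps_ident, of "\<delta> x" "Suc m"]
           pure_tail_multilinear, of "S\<sigma> (word_prod as)"] by simp
    qed
  qed
  finally show ?thesis .
qed

lemma cyclic_linear_Suc: "\<tau> (Suc m) \<in> linear_maps k (T (Suc m)) (T (Suc m))"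
proof -
  have "(\<lambda>t. tensor_lift k (T (Suc m)) (cyclic_word k H S \<delta> \<sigma> (Suc m))
      (tensor_lift k (T (2 * Suc m)) (comult_word k H \<Delta>) t)) \<in> linear_maps k (T (Suc m)) (T (Suc m))"
    by (intro linear_maps_compose[OF tensor_lift_linear[OF module_H module_tensor_power cyclic_word_multilinear]]
        tensor_lift_linear module_H module_tensor_power comult_word_multilinear)
  then show ?thesis by (simp add: cyclic_operator_def[abs_def])
qed

lemma cyclic_pure:
  assumes hs: "hs \<in> words H (Suc m)"
  shows "\<tau> (Suc m) (pure hs) = sweedler_words (Suc m) (T (Suc m))
    (\<lambda>as bs. \<delta> (last bs) \<odot>\<^bsub>T (Suc m)\<^esub> pure (S\<sigma> (word_prod as) # butlast bs)) hs"
proof -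
  have "\<tau> (Suc m) (pure hs) =
      tensor_lift k (T (Suc m)) (cyclic_word k H S \<delta> \<sigma> (Suc m)) (comult_word k H \<Delta> hs)"
    using tensor_lift_pure[OF module_H module_tensor_power comult_word_multilinear hs]
    by (simp add: cyclic_operator_def)
  also have "\<dots> = sweedler_words (Suc m) (T (Suc m)) (\<lambda>as bs. cyclic_word k H S \<delta> \<sigma> (Suc m) (interleave as bs)) hs"
    by (rule tensor_lift_comult_word[OF module_tensor_power cyclic_word_multilinear hs])
  also have "\<dots> = sweedler_words (Suc m) (T (Suc m))
    (\<lambda>as bs. \<delta> (last bs) \<odot>\<^bsub>T (Suc m)\<^esub> pure (S\<sigma> (word_prod as) # butlast bs)) hs"
    using evens_interleave odds_interleave
    by (intro sweedler_words_cong refl) (simp add: cyclic_word_def Let_def evens_def odds_def del: upt_Suc)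
  finally show ?thesis .
qed

text \<open>The last letter is separated because its second leg is the one that goes under
  \<open>\<delta>\<close>; the legs of all other letters are treated alike.\<close>

lemma cyclic_snoc:
  assumes xs: "xs \<in> words H m" and h: "h \<in> carrier H"
  shows "\<tau> (Suc m) (pure (xs @ [h])) = sweedler_words m (T (Suc m)) (\<lambda>as bs. sweedler (T (Suc m))
    (\<lambda>a b. \<delta> b \<odot>\<^bsub>T (Suc m)\<^esub> pure (S\<sigma> (word_prod as \<otimes> a) # bs)) h) xs"
proof -
  have w: "xs @ [h] \<in> words H (Suc m)" using xs h by (auto simp: words_def)
  show ?thesis
    unfolding cyclic_pure[OF w] sweedler_words_snoc[OF xs]
  proof (intro sweedler_words_cong sweedler_cong refl)
    fix as bs a b assume *: "as \<in> words H m" "a \<in> carrier H"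
    have "word_prod (as @ [a]) = word_prod as \<otimes> a"
      using word_prod_append[OF *(1), of "[a]" "Suc 0"] * by simp
    then show "\<delta> (last (bs @ [b])) \<odot>\<^bsub>T (Suc m)\<^esub> pure (S\<sigma> (word_prod (as @ [a])) # butlast (bs @ [b])) =
        \<delta> b \<odot>\<^bsub>T (Suc m)\<^esub> pure (S\<sigma> (word_prod as \<otimes> a) # bs)" by (simp del: foldr_append)
  qed
qed

lemma cyclic_eq_last_face_extra_pure:
  assumes hs: "hs \<in> words H (Suc m)"
  shows "\<tau> (Suc m) (pure hs) = D (Suc (Suc m)) (Suc (Suc m)) (E (Suc m) (pure hs))"
proof -
  have "D (Suc (Suc m)) (Suc (Suc m)) (E (Suc m) (pure hs)) =
      sweedler_words (Suc m) (T (Suc m)) (\<lambda>as bs. D (Suc (Suc m)) (Suc (Suc m)) (extra_word as bs)) hs"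
    unfolding extra_pure[OF hs] using face_linear[of "Suc (Suc m)" "Suc (Suc m)"]
    by (intro sweedler_words_compose) simp_all
  also have "\<dots> = \<tau> (Suc m) (pure hs)"
    unfolding cyclic_pure[OF hs]
  proof (intro sweedler_words_cong refl)
    fix as bs assume *: "as \<in> words H (Suc m)" "bs \<in> words H (Suc m)"
    from *(2) obtain b bs' where bs: "bs = bs' @ [b]" "b \<in> carrier H" "bs' \<in> words H m"
      by (auto elim: words_snocE)
    then show "D (Suc (Suc m)) (Suc (Suc m)) (extra_word as bs) =
        \<delta> (last bs) \<odot>\<^bsub>T (Suc m)\<^esub> pure (S\<sigma> (word_prod as) # butlast bs)"
      using face_last[of b "S\<sigma> (word_prod as) # bs'" "Suc (Suc m)" "Suc (Suc m)"] word_prod_closed[OF *(1)]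
      by (simp add: extra_word_def words_set words_length)
  qed
  finally show ?thesis ..
qed

text \<open>The modular condition enters in degree 0: there \<open>E\<close> sends the empty tensor
  to \<open>\<sigma>\<close>, whose last face is the scalar \<delta>(\<sigma>), while
  \<open>\<tau> 0\<close> is the identity.\<close>

lemma cyclic_eq_last_face_extra:
  assumes modular: "\<delta> \<sigma> = \<one>\<^bsub>k\<^esub>" and t: "t \<in> carrier (T n)"
  shows "\<tau> n t = D (Suc n) (Suc n) (E n t)"
proof -
  have DE: "(\<lambda>t. D (Suc n) (Suc n) (E n t)) \<in> linear_maps k (T n) (T n)"
    using linear_maps_compose[OF face_linear extra_linear, of n "Suc n"] by simp
  show ?thesis
  proof (cases n)
    case 0
    have "\<tau> n \<in> linear_maps k (T n) (T n)"
      using linear_maps_ident by (simp add: cyclic_operator_def[abs_def] 0)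
    then show ?thesis
    proof (rule tensor_power_ext[OF module_H module_tensor_power _ DE _ t])
      fix xs assume "xs \<in> words H n"
      then have "xs = []" "[] \<in> words H 0" by (simp_all add: 0)
      then show "\<tau> n (pure xs) = D (Suc n) (Suc n) (E n (pure xs))"
        using face_last[of \<sigma> "[]" "Suc 0" "Suc 0"]
        by (simp add: 0 extra_pure extra_word_def antipode_one cyclic_operator_def modular)
    qed
  next
    case (Suc m)
    show ?thesis
      using DE cyclic_eq_last_face_extra_pure unfolding Suc
      by (intro tensor_power_ext[OF module_H module_tensor_power cyclic_linear_Suc _ _ t[unfolded Suc]])
  qed
qed

section \<open>The winding map \<open>\<theta>\<close> of the character and the rotation\<close>

definition \<theta> :: "'h \<Rightarrow> 'h"
  where "\<theta> h = sweedler H (\<lambda>a b. \<delta> a \<odot> b) h"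

lemma theta_linear: "\<theta> \<in> linear_maps k H H"
  unfolding \<theta>_def[abs_def] by (auto intro!: char_intros)

lemma theta_closed [simp]: "h \<in> carrier H \<Longrightarrow> \<theta> h \<in> carrier H"
  using linear_mapsD(1)[OF theta_linear] .

text \<open>The counit removes the second leg and leaves \<open>\<delta>\<close> of the argument; as
  in \<open>counit_antipode\<close>, scalars are carried as multiples of
  \<open>\<one>\<close>.\<close>

lemma counit_theta: assumes h: "h \<in> carrier H" shows "\<epsilon> (\<theta> h) = \<delta> h"
proof -
  have "\<epsilon> (\<theta> h) \<odot> \<one> = sweedler H (\<lambda>a b. \<epsilon> (\<delta> a \<odot> b) \<odot> \<one>) h"
    unfolding \<theta>_def
    by (rule sweedler_compose[where g = "\<lambda>z. \<epsilon> z \<odot> \<one>"]) (auto intro!: linear_intros)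
  also have "\<dots> = sweedler H (\<lambda>a b. \<epsilon> b \<odot> (\<delta> a \<odot> \<one>)) h"
    by (simp add: counit smult_smult_module R.m_comm)
  also have "\<dots> = \<delta> h \<odot> \<one>"
    by (rule sweedler_counit_right) (auto intro!: char_intros h)
  finally have "\<epsilon> (\<epsilon> (\<theta> h) \<odot> \<one>) = \<epsilon> (\<delta> h \<odot> \<one>)" by simp
  then show ?thesis using h by (simp add: counit)
qed

text \<open>Convolution by \<delta> S undoes \<open>\<theta>\<close>: after coassociativity the two
  characters combine to \<delta>(S(a) c), and the antipode law reduces the sum over a and c to a
  counit.\<close>

lemma sweedler_char_antipode_theta:
  assumes N: "module k N" and f: "f \<in> linear_maps k H N" and h: "h \<in> carrier H"
  shows "sweedler N (\<lambda>a b. \<delta> (S a) \<odot>\<^bsub>N\<^esub> f (\<theta> b)) h = f h"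
proof -
  have f_closed [simp]: "f x \<in> carrier N" if "x \<in> carrier H" for x using linear_mapsD(1)[OF f that] .
  note lin = char_intros linear_maps_compose[OF f] N
  have "sweedler N (\<lambda>a b. \<delta> (S a) \<odot>\<^bsub>N\<^esub> f (\<theta> b)) h =
      sweedler N (\<lambda>a b. sweedler N (\<lambda>c d. \<delta> (S a) \<odot>\<^bsub>N\<^esub> f (\<delta> c \<odot> d)) b) h"
    unfolding \<theta>_def
    by (intro sweedler_cong refl sweedler_compose[where g = "\<lambda>z. \<delta> (S _) \<odot>\<^bsub>N\<^esub> f z"]) (auto intro!: lin f)
  also have "\<dots> = sweedler N (\<lambda>a b. sweedler N (\<lambda>c d. \<delta> (S a \<otimes> c) \<odot>\<^bsub>N\<^esub> f d) b) h"
    by (intro sweedler_cong refl) (simp add: linear_mapsD(3)[OF f] smult_smult_module N char)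
  also have "\<dots> = sweedler N (\<lambda>u d. sweedler N (\<lambda>a c. \<delta> (S a \<otimes> c) \<odot>\<^bsub>N\<^esub> f d) u) h"
    by (rule sweedler_coassoc[symmetric]) (auto intro!: lin f h)
  also have "\<dots> = sweedler N (\<lambda>u d. \<epsilon> u \<odot>\<^bsub>N\<^esub> (\<delta> \<one> \<odot>\<^bsub>N\<^esub> f d)) h"
    by (intro sweedler_cong refl sweedler_antipode_left[where g = "\<lambda>z. \<delta> z \<odot>\<^bsub>N\<^esub> f _"]) (auto intro!: lin)
  also have "\<dots> = f h"
    using sweedler_counit_left[OF N f h] by (simp add: N)
  finally show ?thesis .
qed

text \<open>Antimultiplicativity of \<open>S\<close> and multiplicativity of \<open>\<delta>\<close>
  split the scalar into one factor per letter, and each factor undoes \<open>\<theta>\<close> on the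
  second leg of its own letter.\<close>

lemma sweedler_words_char_antipode_theta:
  assumes N: "module k N"
  shows "\<lbrakk>g \<in> multilinear_maps k H n N; hs \<in> words H n\<rbrakk> \<Longrightarrow>
    sweedler_words n N (\<lambda>as bs. \<delta> (S (word_prod as)) \<odot>\<^bsub>N\<^esub> g (map \<theta> bs)) hs = g hs"
proof (induction n arbitrary: g hs)
  case 0
  then show ?case by (auto simp: N multilinear_mapsD(1) antipode_one)
next
  case (Suc n)
  then obtain h hs' where hs: "hs = h # hs'" "h \<in> carrier H" "hs' \<in> words H n" by (auto elim!: words_SucE)
  note g = multilinear_maps_Cons[OF Suc.prems(1)]
  have map_theta: "map \<theta> bs \<in> words H n" if "bs \<in> words H n" for bs
    using that by (auto simp: words_def)
  have "sweedler_words (Suc n) N (\<lambda>as bs. \<delta> (S (word_prod as)) \<odot>\<^bsub>N\<^esub> g (map \<theta> bs)) hs =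
    sweedler N (\<lambda>a b. sweedler_words n N (\<lambda>as bs. \<delta> (S (word_prod as)) \<odot>\<^bsub>N\<^esub> (\<delta> (S a) \<odot>\<^bsub>N\<^esub> g (\<theta> b # map \<theta> bs))) hs') h"
    unfolding hs sweedler_words.simps list.sel
  proof (intro sweedler_cong sweedler_words_cong refl)
    fix a b as bs assume *: "a \<in> carrier H" "b \<in> carrier H" "as \<in> words H n" "bs \<in> words H n"
    have "g (\<theta> b # map \<theta> bs) \<in> carrier N"
      using * map_theta by (intro multilinear_mapsD(1)[OF Suc.prems(1)]) auto
    then show "\<delta> (S (word_prod (a # as))) \<odot>\<^bsub>N\<^esub> g (map \<theta> (b # bs)) =
      \<delta> (S (word_prod as)) \<odot>\<^bsub>N\<^esub> (\<delta> (S a) \<odot>\<^bsub>N\<^esub> g (\<theta> b # map \<theta> bs))"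
      using * word_prod_closed[OF *(3)] by (simp add: antipode_mult char smult_smult_module N)
  qed
  also have "\<dots> = sweedler N (\<lambda>a b. \<delta> (S a) \<odot>\<^bsub>N\<^esub> g (\<theta> b # hs')) h"
    by (intro sweedler_cong refl Suc.IH hs multilinear_maps_compose[where g = "\<lambda>x. _ \<odot>\<^bsub>N\<^esub> x" and N = N] g linear_intros N)
      simp_all
  also have "\<dots> = g (h # hs')"
    by (rule sweedler_char_antipode_theta[OF N g(1) hs(2)]) (rule hs)
  finally show ?case by (simp add: hs)
qed

definition rotation :: "nat \<Rightarrow> ('h list \<Rightarrow> 'k) set \<Rightarrow> ('h list \<Rightarrow> 'k) set"
  where "rotation n = tensor_lift k (T n) (\<lambda>gs. pure (\<theta> (last gs) # butlast gs))"

lemma rotation_multilinear: "(\<lambda>gs. pure (\<theta> (last gs) # butlast gs)) \<in> multilinear_maps k H (Suc n) (T (Suc n))"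
proof (rule multilinear_maps_snocI)
  show "(\<lambda>x. pure (\<theta> (last (xs @ [x])) # butlast (xs @ [x]))) \<in> linear_maps k H (T (Suc n))" if "xs \<in> words H n" for xs
    using that by (simp add: pure_head_linear theta_linear)
  show "(\<lambda>xs. pure (\<theta> (last (xs @ [x])) # butlast (xs @ [x]))) \<in> multilinear_maps k H n (T (Suc n))" if "x \<in> carrier H" for x
    using that by (simp add: pure_tail_multilinear)
qed

lemma rotation_linear: "rotation (Suc n) \<in> linear_maps k (T (Suc n)) (T (Suc n))"
  unfolding rotation_def by (rule tensor_lift_linear) (simp_all add: rotation_multilinear)

lemma rotation_pure:
  assumes "x \<in> carrier H" "xs \<in> words H n"
  shows "rotation (Suc n) (pure (xs @ [x])) = pure (\<theta> x # xs)"
proof -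
  have "xs @ [x] \<in> words H (Suc n)" using assms by (auto simp: words_def)
  then show ?thesis
    unfolding rotation_def
    using tensor_lift_pure[OF module_H module_tensor_power rotation_multilinear] by simp
qed

lemma rotation_power_linear: "(rotation (Suc n) ^^ j) \<in> linear_maps k (T (Suc n)) (T (Suc n))"
proof (induction j)
  case (Suc j)
  then show ?case using linear_maps_compose[OF rotation_linear] by (simp add: comp_def)
qed (use linear_maps_ident in \<open>simp add: id_def\<close>)

text \<open>Every rotation sends one letter of \<open>vs\<close> through \<open>\<theta>\<close> to
  the front. With \<open>us = []\<close> this is a full turn, in which every letter meets
  \<open>\<theta>\<close> exactly once.\<close>

lemma rotation_power_append:
  "\<lbrakk>set us \<subseteq> carrier H; set vs \<subseteq> carrier H; length us + length vs = Suc n\<rbrakk> \<Longrightarrow>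
    (rotation (Suc n) ^^ length vs) (pure (us @ vs)) = pure (map \<theta> vs @ us)"
proof (induction vs arbitrary: us)
  case (Cons v vs)
  have "(rotation (Suc n) ^^ length (v # vs)) (pure (us @ v # vs)) =
      rotation (Suc n) ((rotation (Suc n) ^^ length vs) (pure ((us @ [v]) @ vs)))" by simp
  also have "(rotation (Suc n) ^^ length vs) (pure ((us @ [v]) @ vs)) = pure (map \<theta> vs @ us @ [v])"
    using Cons.prems by (intro Cons.IH) auto
  also have "rotation (Suc n) (pure (map \<theta> vs @ us @ [v])) = pure (\<theta> v # map \<theta> vs @ us)"
  proof -
    have "map \<theta> vs @ us \<in> words H n" using Cons.prems by (auto simp: words_def)
    then show ?thesis using Cons.prems rotation_pure[of v "map \<theta> vs @ us" n] by simp
  qed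
  finally show ?case by simp
qed simp

section \<open>The twisted antipode and the order of the cyclic operator\<close>

abbreviation "twisted \<equiv> twisted_antipode k H \<Delta> S \<delta> \<sigma>"

lemma twisted_sweedler:
  assumes h: "h \<in> carrier H"
  shows "twisted h = sweedler H (\<lambda>a b. \<delta> b \<odot> S\<sigma> a) h"
proof -
  have "tensor_lift k H (\<lambda>ab. \<delta> (ab ! 1) \<odot> S (ab ! 0)) (\<Delta> h) = sweedler H (\<lambda>a b. \<delta> b \<odot> S a) h"
    by (rule sweedler_tensor_lift[where F = "\<lambda>a b. \<delta> b \<odot> S a"]) (simp_all add: h)
  then have "twisted h = \<sigma> \<otimes> sweedler H (\<lambda>a b. \<delta> b \<odot> S a) h"
    by (simp add: twisted_antipode_def)
  also have "\<dots> = sweedler H (\<lambda>a b. \<sigma> \<otimes> (\<delta> b \<odot> S a)) h"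
    by (rule sweedler_compose) (auto intro!: linear_intros)
  also have "\<dots> = sweedler H (\<lambda>a b. \<delta> b \<odot> S\<sigma> a) h"
    by (intro sweedler_cong refl) (simp add: smult_mult_right)
  finally show ?thesis .
qed

lemma twisted_closed [simp]: "h \<in> carrier H \<Longrightarrow> twisted h \<in> carrier H"
  by (simp add: twisted_sweedler)

lemma twisted_linear: "twisted \<in> linear_maps k H H"
  by (rule linear_maps_cong[OF module_H _ twisted_sweedler]) (auto intro!: char_intros)

lemma cyclic_one_pure:
  assumes h: "h \<in> carrier H" shows "\<tau> 1 (pure [h]) = pure [twisted h]"
proof -
  have "\<tau> 1 (pure [h]) = sweedler (T (Suc 0)) (\<lambda>a b. \<delta> b \<odot>\<^bsub>T (Suc 0)\<^esub> pure [S\<sigma> a]) h"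
    using cyclic_snoc[of "[]" 0 h] h by simp
  also have "\<dots> = sweedler (T (Suc 0)) (\<lambda>a b. pure [\<delta> b \<odot> S\<sigma> a]) h"
    using linear_mapsD(3)[OF pure_head_linear[OF linear_maps_ident, of "[]" 0]] by (intro sweedler_cong refl) simp
  also have "\<dots> = pure [twisted h]"
    unfolding twisted_sweedler[OF h]
    by (rule sweedler_compose[where g = "\<lambda>z. pure [z]", symmetric]) (auto intro!: pure_head_linear linear_intros)
  finally show ?thesis .
qed

text \<open>The lift of \<open>hd\<close> is a left inverse of x \<mapsto> \<open>pure [x]\<close>.
  It brings the identity for \<open>\<tau> 1\<close> back from the first tensor power to
  \<open>H\<close>.\<close>

lemma pure_singleton_inject:
  assumes "x \<in> carrier H" "y \<in> carrier H" "pure [x] = pure [y]"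
  shows "x = y"
proof -
  have "hd \<in> multilinear_maps k H (Suc 0) H"
    by (rule multilinear_maps_1) (simp add: linear_maps_ident)
  from tensor_lift_pure[OF module_H module_H this] have "tensor_lift k H hd (pure [z]) = z" if "z \<in> carrier H" for z
    using that by simp
  with assms show ?thesis by metis
qed

lemma involution_if_cyclic_power:
  assumes "\<And>x. x \<in> carrier (T 1) \<Longrightarrow> (\<tau> 1 ^^ 2) x = x" and h: "h \<in> carrier H"
  shows "twisted (twisted h) = h"
proof -
  have "pure [h] \<in> carrier (T 1)" using h by simp
  then have "(\<tau> 1 ^^ 2) (pure [h]) = pure [h]" by (rule assms(1))
  moreover have "(\<tau> 1 ^^ 2) (pure [h]) = pure [twisted (twisted h)]"
    using h by (simp add: numeral_2_eq_2 cyclic_one_pure del: One_nat_def)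
  ultimately show ?thesis using h by (intro pure_singleton_inject) auto
qed

section \<open>The cyclic relations that follow from the modular condition\<close>

context
  assumes modular: "\<delta> \<sigma> = \<one>\<^bsub>k\<^esub>"
begin

lemma delta_sigma_antipode: "h \<in> carrier H \<Longrightarrow> \<delta> (S\<sigma> h) = \<delta> (S h)"
  by (simp add: char modular)

lemma cyclic_linear_modular: "\<tau> n \<in> linear_maps k (T n) (T n)"
proof (cases n)
  case 0
  then show ?thesis using linear_maps_ident by (simp add: cyclic_operator_def[abs_def])
qed (simp add: cyclic_linear_Suc)

lemma extra_closed [simp]: "t \<in> carrier (T n) \<Longrightarrow> E n t \<in> carrier (T (Suc n))"
  by (rule linear_mapsD(1)[OF extra_linear])

lemma face_closed: "\<lbrakk>i \<le> Suc n; t \<in> carrier (T (Suc n))\<rbrakk> \<Longrightarrow> D (Suc n) i t \<in> carrier (T n)"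
  using linear_mapsD(1)[OF face_linear, of "Suc n" i] by simp

lemma degeneracy_closed: "\<lbrakk>i \<le> n; t \<in> carrier (T n)\<rbrakk> \<Longrightarrow> Z n i t \<in> carrier (T (Suc n))"
  using linear_mapsD(1)[OF degeneracy_linear, of i n] by simp

lemma cyclic_closed: "t \<in> carrier (T n) \<Longrightarrow> \<tau> n t \<in> carrier (T n)"
  by (rule linear_mapsD(1)[OF cyclic_linear_modular])

text \<open>Moving the face past the last face turns the latter into the last face one degree lower;
  moving it on past \<open>E\<close> lowers its own index.\<close>

lemma face_cyclic_modular:
  assumes i: "1 \<le> i" "i \<le> n" and t: "t \<in> carrier (T n)"
  shows "D n i (\<tau> n t) = \<tau> (n - 1) (D n (i - 1) t)"
proof -
  obtain m where n: "n = Suc m" using i by (cases n) auto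
  have "D n i (\<tau> n t) = D (Suc n - 1) i (D (Suc n) (Suc n) (E n t))"
    by (simp add: cyclic_eq_last_face_extra[OF modular t])
  also have "\<dots> = D (Suc n - 1) (Suc n - 1) (D (Suc n) i (E n t))"
    by (rule face_face) (use i t in auto)
  also have "\<dots> = D n n (E m (D n (i - 1) t))"
    using face_extra[OF i t] by (simp add: n)
  also have "\<dots> = \<tau> m (D n (i - 1) t)"
    using cyclic_eq_last_face_extra[OF modular face_closed[of "i - 1" m t]] i t by (simp add: n)
  finally show ?thesis by (simp add: n)
qed

lemma face_zero_cyclic_modular:
  assumes n: "1 \<le> n" and t: "t \<in> carrier (T n)"
  shows "D n 0 (\<tau> n t) = D n n t"
proof -
  have "D n 0 (\<tau> n t) = D (Suc n - 1) 0 (D (Suc n) (Suc n) (E n t))"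
    by (simp add: cyclic_eq_last_face_extra[OF modular t])
  also have "\<dots> = D (Suc n - 1) (Suc n - 1) (D (Suc n) 0 (E n t))"
    by (rule face_face) (use n t in auto)
  finally show ?thesis by (simp add: face_zero_extra[OF t])
qed

lemma degeneracy_last_face_extra:
  assumes i: "i \<le> n" and t: "t \<in> carrier (T n)"
  shows "Z n i (\<tau> n t) = D (Suc (Suc n)) (Suc (Suc n)) (Z (Suc n) i (E n t))"
  using face_degeneracy_greater[of i "Suc (Suc n)" "Suc n" "E n t"] i t
  by (simp add: cyclic_eq_last_face_extra[OF modular t])

lemma degeneracy_cyclic_modular:
  assumes i: "1 \<le> i" "i \<le> n" and t: "t \<in> carrier (T n)"
  shows "Z n i (\<tau> n t) = \<tau> (n + 1) (Z n (i - 1) t)"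
proof -
  have "Z n i (\<tau> n t) = D (Suc (Suc n)) (Suc (Suc n)) (E (Suc n) (Z n (i - 1) t))"
    using degeneracy_last_face_extra[OF i(2) t] degeneracy_extra[OF i(1) _ t] i(2) by simp
  also have "\<dots> = \<tau> (Suc n) (Z n (i - 1) t)"
    by (rule cyclic_eq_last_face_extra[OF modular degeneracy_closed, symmetric]) (use i t in auto)
  finally show ?thesis by simp
qed

text \<open>The computation shows that \<open>\<tau> (Suc n)\<close> after the last degeneracy
  equals \<open>E n\<close>, the usual description of the extra degeneracy of a cyclic module. A
  second \<open>\<tau>\<close> gives the last face of E E, and \<open>extra_extra\<close> turns this
  into the zeroth degeneracy of \<open>\<tau> n t\<close>.\<close>

lemma degeneracy_zero_cyclic_modular:
  assumes t: "t \<in> carrier (T n)"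
  shows "Z n 0 (\<tau> n t) = \<tau> (n + 1) (\<tau> (n + 1) (Z n n t))"
proof -
  have "\<tau> (Suc n) (Z n n t) = D (Suc (Suc n)) (Suc (Suc n)) (E (Suc n) (Z n n t))"
    by (rule cyclic_eq_last_face_extra[OF modular degeneracy_closed]) (use t in auto)
  also have "\<dots> = D (Suc (Suc n)) (Suc (Suc n)) (Z (Suc n) (Suc n) (E n t))"
    using degeneracy_extra[of "Suc n" n t] t by simp
  also have "\<dots> = E n t"
    using face_degeneracy_same[of "Suc n" "Suc n" "Suc (Suc n)" "E n t"] t by simp
  finally have "\<tau> (Suc n) (\<tau> (Suc n) (Z n n t)) = D (Suc (Suc n)) (Suc (Suc n)) (E (Suc n) (E n t))"
    using cyclic_eq_last_face_extra[OF modular extra_closed[OF t]] by simp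
  then show ?thesis
    using degeneracy_last_face_extra[OF _ t, of 0] extra_extra[OF t] by simp
qed

section \<open>The order of the cyclic operator under the involution condition\<close>

context
  assumes involution: "\<And>h. h \<in> carrier H \<Longrightarrow> twisted (twisted h) = h"
begin

text \<open>S_\<sigma> reverses the legs, so \<open>\<delta>\<close> lands on the image of the first
  one; \<delta>(\<sigma>) = 1 then removes \<open>\<sigma>\<close> from the scalar.\<close>

lemma twisted_sigma_antipode:
  assumes a: "a \<in> carrier H"
  shows "twisted (S\<sigma> a) = sweedler H (\<lambda>c d. \<delta> (S c) \<odot> S\<sigma> (S\<sigma> d)) a"
proof -
  have "twisted (S\<sigma> a) = sweedler H (\<lambda>u v. \<delta> v \<odot> S\<sigma> u) (S\<sigma> a)"
    using a by (intro twisted_sweedler) simp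
  also have "\<dots> = sweedler H (\<lambda>c d. \<delta> (S\<sigma> c) \<odot> S\<sigma> (S\<sigma> d)) a"
    by (rule sweedler_sigma_antipode) (auto intro!: char_intros a)
  also have "\<dots> = sweedler H (\<lambda>c d. \<delta> (S c) \<odot> S\<sigma> (S\<sigma> d)) a"
    by (intro sweedler_cong refl) (simp add: delta_sigma_antipode)
  finally show ?thesis .
qed

text \<open>The one place where the involution condition is applied. With K the left-hand side, the
  square of the twisted antipode is the convolution of \<delta> S with K, so the condition says that
  this convolution is the identity map; multiplying by \<open>\<delta>\<close> on the left solves
  for K.\<close>

lemma theta_eq:
  assumes h: "h \<in> carrier H"
  shows "sweedler H (\<lambda>q b. \<delta> b \<odot> S\<sigma> (S\<sigma> q)) h = \<theta> h"
proof -
  define K where "K = sweedler H (\<lambda>q b. \<delta> b \<odot> S\<sigma> (S\<sigma> q))"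
  have K: "K \<in> linear_maps k H H"
    unfolding K_def by (intro sweedler_linear) (auto intro!: char_intros)
  note K_closed [simp] = linear_mapsD(1)[OF K]
  note lin = char_intros linear_maps_compose[OF K]
  have expand: "x = sweedler H (\<lambda>c e. \<delta> (S c) \<odot> K e) x" if x: "x \<in> carrier H" for x
  proof -
    have "x = twisted (sweedler H (\<lambda>a b. \<delta> b \<odot> S\<sigma> a) x)"
      using involution[OF x] x by (simp add: twisted_sweedler)
    also have "\<dots> = sweedler H (\<lambda>a b. twisted (\<delta> b \<odot> S\<sigma> a)) x"
      by (rule sweedler_compose[OF module_H module_H twisted_linear]) simp
    also have "\<dots> = sweedler H (\<lambda>a b. sweedler H (\<lambda>c d. \<delta> (S c) \<odot> (\<delta> b \<odot> S\<sigma> (S\<sigma> d))) a) x"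
    proof (rule sweedler_cong[OF refl])
      fix a b assume *: "a \<in> carrier H" "b \<in> carrier H"
      have "twisted (\<delta> b \<odot> S\<sigma> a) = \<delta> b \<odot> sweedler H (\<lambda>c d. \<delta> (S c) \<odot> S\<sigma> (S\<sigma> d)) a"
        using * by (simp add: linear_mapsD(3)[OF twisted_linear] twisted_sigma_antipode)
      also have "\<dots> = sweedler H (\<lambda>c d. \<delta> b \<odot> (\<delta> (S c) \<odot> S\<sigma> (S\<sigma> d))) a"
        by (rule sweedler_compose[where g = "\<lambda>z. \<delta> b \<odot> z"]) (use * in \<open>auto intro!: linear_intros\<close>)
      finally show "twisted (\<delta> b \<odot> S\<sigma> a) = sweedler H (\<lambda>c d. \<delta> (S c) \<odot> (\<delta> b \<odot> S\<sigma> (S\<sigma> d))) a"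
        using * by (simp add: smult_commute_module)
    qed
    also have "\<dots> = sweedler H (\<lambda>c e. sweedler H (\<lambda>d b. \<delta> (S c) \<odot> (\<delta> b \<odot> S\<sigma> (S\<sigma> d))) e) x"
      by (rule sweedler_coassoc) (auto intro!: lin x)
    also have "\<dots> = sweedler H (\<lambda>c e. \<delta> (S c) \<odot> K e) x"
      unfolding K_def
      by (intro sweedler_cong refl sweedler_compose[symmetric, where g = "\<lambda>z. \<delta> (S _) \<odot> z"]) (auto intro!: lin)
    finally show ?thesis .
  qed
  \<comment> \<open>\<open>expand\<close> is substituted into the second leg of
    \<open>\<theta>\<close>, so that \<delta>(a) and \<delta>(S(c)) meet on adjacent legs and
    cancel.\<close>
  have "\<theta> h = sweedler H (\<lambda>a b. \<delta> a \<odot> sweedler H (\<lambda>c e. \<delta> (S c) \<odot> K e) b) h"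
    unfolding \<theta>_def using expand by (intro sweedler_cong refl) simp
  also have "\<dots> = sweedler H (\<lambda>a b. sweedler H (\<lambda>c e. \<delta> a \<odot> (\<delta> (S c) \<odot> K e)) b) h"
    by (intro sweedler_cong refl sweedler_compose[where g = "\<lambda>z. \<delta> _ \<odot> z"]) (auto intro!: lin)
  also have "\<dots> = sweedler H (\<lambda>u e. sweedler H (\<lambda>a c. \<delta> a \<odot> (\<delta> (S c) \<odot> K e)) u) h"
    by (rule sweedler_coassoc[symmetric]) (auto intro!: lin K h)
  also have "\<dots> = sweedler H (\<lambda>u e. sweedler H (\<lambda>a c. \<delta> (a \<otimes> S c) \<odot> K e) u) h"
    by (simp add: char smult_smult_module)
  also have "\<dots> = sweedler H (\<lambda>u e. \<epsilon> u \<odot> (\<delta> \<one> \<odot> K e)) h"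
    by (intro sweedler_cong refl sweedler_antipode_right[where g = "\<lambda>z. \<delta> z \<odot> K _"]) (auto intro!: lin)
  also have "\<dots> = K h"
    using sweedler_counit_left[OF module_H K h] by simp
  finally show ?thesis by (simp add: K_def)
qed

text \<open>The last letter h has three legs on the left: one joins the second factor, one sits in
  the head under two copies of S_\<sigma>, one goes under \<open>\<delta>\<close>. The legs of the
  other letters cancel inside the head, and by \<open>theta_eq\<close> what remains there is
  \<open>\<theta>\<close> of the last letter of \<open>E\<close>, moved to the front.\<close>

lemma extra_cyclic_pure:
  assumes xs: "xs \<in> words H m" and h: "h \<in> carrier H"
  shows "E (Suc m) (\<tau> (Suc m) (pure (xs @ [h]))) = rotation (Suc (Suc m)) (E (Suc m) (pure (xs @ [h])))"
proof -
  let ?N = "T (Suc (Suc m))"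
  have w: "xs @ [h] \<in> words H (Suc m)" using xs h by (auto simp: words_def)
  \<comment> \<open>The legs of \<open>h\<close> are \<open>p\<close> in the second factor,
    \<open>q\<close> in the head and \<open>b\<close> under \<open>\<delta>\<close>. The slot
    \<open>z\<close> receives the product of S(qs) and cs, to be cancelled to
    \<open>\<one>\<close>.\<close>
  define B where "B = (\<lambda>p q b z ps ds. \<delta> b \<odot>\<^bsub>?N\<^esub> pure (S\<sigma> (\<sigma> \<otimes> (S q \<otimes> z)) # S\<sigma> (word_prod ps \<otimes> p) # ds))"
  note lin = char_intros pure_head_linear pure_second_linear
  have B_closed: "B p q b z ps ds \<in> carrier ?N"
    if "p \<in> carrier H" "q \<in> carrier H" "b \<in> carrier H" "z \<in> carrier H" "ps \<in> words H m" "ds \<in> words H m"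
    for p q b z ps ds
    using that word_prod_closed[OF that(5)] by (simp add: B_def words_set words_length)
  have B1: "(\<lambda>z. B p q b z ps ds) \<in> linear_maps k H ?N"
    if "p \<in> carrier H" "q \<in> carrier H" "b \<in> carrier H" "ps \<in> words H m" "ds \<in> words H m" for p q b ps ds
    using that word_prod_closed[OF that(4)] unfolding B_def by (auto intro!: lin)
  have B2: "(\<lambda>ps. B p q b z ps ds) \<in> multilinear_maps k H m ?N"
    if "p \<in> carrier H" "q \<in> carrier H" "b \<in> carrier H" "z \<in> carrier H" "ds \<in> words H m" for p q b z ds
    using that unfolding B_def
    by (intro word_prod_multilinear[where g = "\<lambda>w. \<delta> b \<odot>\<^bsub>?N\<^esub> pure (S\<sigma> (\<sigma> \<otimes> (S q \<otimes> z)) # S\<sigma> (w \<otimes> p) # ds)"])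
      (auto intro!: lin)
  have B3: "(\<lambda>ds. B p q b z ps ds) \<in> multilinear_maps k H m ?N"
    if "p \<in> carrier H" "q \<in> carrier H" "b \<in> carrier H" "z \<in> carrier H" "ps \<in> words H m" for p q b z ps
    using that word_prod_closed[OF that(5)] unfolding B_def
    by (intro multilinear_maps_compose[where g = "\<lambda>x. \<delta> b \<odot>\<^bsub>?N\<^esub> x" and N = ?N] pure_tail2_multilinear)
      (auto intro!: lin)
  \<comment> \<open>The contribution of the other letters before cancellation: \<open>as\<close> and
    \<open>bs\<close> are their legs in \<open>\<tau>\<close>, and \<open>E\<close> splits each of
    them again.\<close>
  define C where "C = (\<lambda>p q b as bs. sweedler_words m ?N (\<lambda>ps qs. sweedler_words m ?N
      (\<lambda>cs ds. B p q b (S (word_prod qs) \<otimes> word_prod cs) ps ds) bs) as)"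
  have C_closed: "C p q b as bs \<in> carrier ?N"
    if "p \<in> carrier H" "q \<in> carrier H" "b \<in> carrier H" for p q b as bs
    using that unfolding C_def by (auto intro!: sweedler_words_closed B_closed)
  \<comment> \<open>\<open>E\<close> on one term of \<open>\<tau>\<close>. Reversal of legs together
    with antimultiplicativity places S(q) to the left of S(qs) cs, so that \<open>q\<close> does not
    obstruct the cancellation.\<close>
  have step: "E (Suc m) (\<delta> b \<odot>\<^bsub>T (Suc m)\<^esub> pure (S\<sigma> (word_prod as \<otimes> a) # bs)) =
      sweedler ?N (\<lambda>p q. C p q b as bs) a"
    if *: "as \<in> words H m" "bs \<in> words H m" "a \<in> carrier H" "b \<in> carrier H" for as bs a b
  proof -
    note as = word_prod_closed[OF *(1)]
    have aw: "as @ [a] \<in> words H (Suc m)" using * by (auto simp: words_def)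
    have prod: "word_prod (ys @ [y]) = word_prod ys \<otimes> y" if "ys \<in> words H m" "y \<in> carrier H" for ys y
      using word_prod_append[OF that(1), of "[y]" "Suc 0"] that by simp
    define F where "F = (\<lambda>p q. sweedler_words m ?N
        (\<lambda>cs ds. \<delta> b \<odot>\<^bsub>?N\<^esub> pure (S\<sigma> (S\<sigma> q \<otimes> word_prod cs) # S\<sigma> p # ds)) bs)"
    have F: "F \<in> bilinear_maps ?N"
      unfolding F_def using * by (auto intro!: lin sweedler_words_parameter_linear)
    have "E (Suc m) (\<delta> b \<odot>\<^bsub>T (Suc m)\<^esub> pure (S\<sigma> (word_prod as \<otimes> a) # bs)) =
        \<delta> b \<odot>\<^bsub>?N\<^esub> sweedler ?N (\<lambda>p q. sweedler_words m ?N
          (\<lambda>cs ds. pure (S\<sigma> (S\<sigma> q \<otimes> word_prod cs) # S\<sigma> p # ds)) bs) (word_prod as \<otimes> a)"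
      using * as by (subst linear_mapsD(3)[OF extra_linear])
        (auto simp: words_set words_length extra_sigma_antipode_pure)
    also have "\<dots> = sweedler ?N F (word_prod as \<otimes> a)"
    proof -
      have cl: "pure (S\<sigma> (S\<sigma> q \<otimes> word_prod cs) # S\<sigma> p # ds) \<in> carrier ?N"
        if "p \<in> carrier H" "q \<in> carrier H" "cs \<in> words H m" "ds \<in> words H m" for p q cs ds
        using that word_prod_closed[OF that(3)] by (simp add: words_set words_length)
      have sm: "(\<lambda>z. \<delta> b \<odot>\<^bsub>?N\<^esub> z) \<in> linear_maps k ?N ?N"
        using *(4) by (auto intro!: linear_intros)
      show ?thesis
        unfolding F_def
        by (subst sweedler_compose[OF module_tensor_power module_tensor_power sm])
          (auto intro!: cl sweedler_cong sweedler_words_closed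
            sweedler_words_compose[OF module_tensor_power module_tensor_power sm])
    qed
    also have "\<dots> = sweedler_words (Suc m) ?N (\<lambda>ps qs. F (word_prod ps) (word_prod qs)) (as @ [a])"
      unfolding prod[OF *(1,3), symmetric] by (rule sweedler_word_prod[OF module_tensor_power F aw])
    also have "\<dots> = sweedler_words m ?N (\<lambda>ps qs. sweedler ?N (\<lambda>p q. sweedler_words m ?N
        (\<lambda>cs ds. B p q b (S (word_prod qs) \<otimes> word_prod cs) ps ds) bs) a) as"
      unfolding sweedler_words_snoc[OF *(1)]
    proof (intro sweedler_words_cong sweedler_cong refl)
      fix ps qs p q assume **: "ps \<in> words H m" "qs \<in> words H m" "p \<in> carrier H" "q \<in> carrier H"
      show "F (word_prod (ps @ [p])) (word_prod (qs @ [q])) = sweedler_words m ?N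
        (\<lambda>cs ds. B p q b (S (word_prod qs) \<otimes> word_prod cs) ps ds) bs"
        unfolding F_def B_def prod[OF **(1,3)] prod[OF **(2,4)]
      proof (intro sweedler_words_cong refl)
        fix cs ds assume "cs \<in> words H m"
        then show "\<delta> b \<odot>\<^bsub>?N\<^esub> pure (S\<sigma> (S\<sigma> (word_prod qs \<otimes> q) \<otimes> word_prod cs) # S\<sigma> (word_prod ps \<otimes> p) # ds) =
          \<delta> b \<odot>\<^bsub>?N\<^esub> pure (S\<sigma> (\<sigma> \<otimes> (S q \<otimes> (S (word_prod qs) \<otimes> word_prod cs))) # S\<sigma> (word_prod ps \<otimes> p) # ds)"
          using ** word_prod_closed[OF **(2)] word_prod_closed[of cs m]
          by (simp add: antipode_mult M.m_assoc)
      qed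
    qed
    also have "\<dots> = sweedler ?N (\<lambda>p q. C p q b as bs) a"
      unfolding C_def
      by (rule sweedler_words_swap) (auto intro!: sweedler_words_closed B_closed * word_prod_closed)
    finally show ?thesis .
  qed
  have "E (Suc m) (\<tau> (Suc m) (pure (xs @ [h]))) = sweedler_words m ?N (\<lambda>as bs. sweedler ?N (\<lambda>a b.
      E (Suc m) (\<delta> b \<odot>\<^bsub>T (Suc m)\<^esub> pure (S\<sigma> (word_prod as \<otimes> a) # bs))) h) xs"
  proof -
    have cl: "\<delta> b \<odot>\<^bsub>T (Suc m)\<^esub> pure (S\<sigma> (word_prod as \<otimes> a) # bs) \<in> carrier (T (Suc m))"
      if "a \<in> carrier H" "b \<in> carrier H" "as \<in> words H m" "bs \<in> words H m" for a b as bs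
      using that word_prod_closed[OF that(3)] by (simp add: words_set words_length)
    show ?thesis
      unfolding cyclic_snoc[OF xs h]
      by (subst sweedler_words_compose[OF module_tensor_power module_tensor_power extra_linear], simp,
          intro sweedler_words_cong refl sweedler_compose extra_linear module_tensor_power cl)
  qed
  also have "\<dots> = sweedler_words m ?N (\<lambda>as bs. sweedler ?N (\<lambda>a b. sweedler ?N (\<lambda>p q. C p q b as bs) a) h) xs"
    by (intro sweedler_words_cong sweedler_cong refl step)
  \<comment> \<open>The sums over \<open>h\<close> are moved outermost, so that the legs of
    \<open>xs\<close> cancel for fixed \<open>p\<close>, \<open>q\<close> and
    \<open>b\<close>.\<close>
  also have "\<dots> = sweedler ?N (\<lambda>a b. sweedler_words m ?N (\<lambda>as bs. sweedler ?N (\<lambda>p q. C p q b as bs) a) xs) h"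
    by (rule sweedler_words_swap[OF module_tensor_power xs h]) simp
  also have "\<dots> = sweedler ?N (\<lambda>a b. sweedler ?N (\<lambda>p q. sweedler_words m ?N (\<lambda>as bs. C p q b as bs) xs) a) h"
    by (intro sweedler_cong refl sweedler_words_swap[OF module_tensor_power xs] C_closed)
  also have "\<dots> = sweedler ?N (\<lambda>a b. sweedler ?N (\<lambda>p q. sweedler_words m ?N (B p q b \<one>) xs) a) h"
    unfolding C_def
    by (intro sweedler_cong refl sweedler_words_antipode_cancel[OF module_tensor_power xs] B1 B2 B3)
  \<comment> \<open>Coassociativity in \<open>h\<close> makes \<open>q\<close> and \<open>b\<close>
    the two legs of one \<open>e\<close>, the shape to which \<open>theta_eq\<close>
    applies.\<close>
  also have "\<dots> = sweedler ?N (\<lambda>p e. sweedler ?N (\<lambda>q b. sweedler_words m ?N (B p q b \<one>) xs) e) h"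
    unfolding B_def
    by (rule sweedler_coassoc[OF module_tensor_power h])
      (auto intro!: lin sweedler_words_parameter_linear xs)
  also have "\<dots> = sweedler ?N (\<lambda>p e. sweedler_words m ?N (\<lambda>ps ds. sweedler ?N (\<lambda>q b. B p q b \<one> ps ds) e) xs) h"
    by (intro sweedler_cong refl sweedler_words_swap[OF module_tensor_power xs, symmetric] B_closed) auto
  also have "\<dots> = sweedler ?N (\<lambda>p e. sweedler_words m ?N (\<lambda>ps ds.
      rotation (Suc (Suc m)) (extra_word (ps @ [p]) (ds @ [e]))) xs) h"
  proof (intro sweedler_cong sweedler_words_cong refl)
    fix p e ps ds assume *: "p \<in> carrier H" "e \<in> carrier H" "ps \<in> words H m" "ds \<in> words H m"
    note ps = word_prod_closed[OF *(3)]
    have g: "(\<lambda>z. pure (z # S\<sigma> (word_prod ps \<otimes> p) # ds)) \<in> linear_maps k H ?N"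
      using * ps by (intro pure_head_linear linear_maps_ident) auto
    have "sweedler ?N (\<lambda>q b. B p q b \<one> ps ds) e =
        sweedler ?N (\<lambda>q b. pure ((\<delta> b \<odot> S\<sigma> (S\<sigma> q)) # S\<sigma> (word_prod ps \<otimes> p) # ds)) e"
      unfolding B_def by (intro sweedler_cong refl) (simp add: linear_mapsD(3)[OF g])
    also have "\<dots> = pure (\<theta> e # S\<sigma> (word_prod ps \<otimes> p) # ds)"
      unfolding theta_eq[OF *(2), symmetric]
      by (rule sweedler_compose[OF module_H module_tensor_power g, symmetric]) simp
    also have "\<dots> = rotation (Suc (Suc m)) (pure ((S\<sigma> (word_prod ps \<otimes> p) # ds) @ [e]))"
      by (rule rotation_pure[symmetric]) (use * ps in auto)
    also have "\<dots> = rotation (Suc (Suc m)) (extra_word (ps @ [p]) (ds @ [e]))"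
      using word_prod_append[OF *(3), of "[p]" "Suc 0"] *(1) by (simp add: extra_word_def del: foldr_append)
    finally show "sweedler ?N (\<lambda>q b. B p q b \<one> ps ds) e = \<dots>" .
  qed
  also have "\<dots> = sweedler_words (Suc m) ?N (\<lambda>as bs. rotation (Suc (Suc m)) (extra_word as bs)) (xs @ [h])"
    unfolding sweedler_words_snoc[OF xs]
  proof (rule sweedler_words_swap[OF module_tensor_power xs h, symmetric])
    fix as bs c d assume "as \<in> words H m" "bs \<in> words H m" "c \<in> carrier H" "d \<in> carrier H"
    then have "as @ [c] \<in> words H (Suc m)" "bs @ [d] \<in> words H (Suc m)" by (auto simp: words_def)
    then show "rotation (Suc (Suc m)) (extra_word (as @ [c]) (bs @ [d])) \<in> carrier ?N"
      by (intro linear_mapsD(1)[OF rotation_linear] extra_word_closed)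
  qed
  also have "\<dots> = rotation (Suc (Suc m)) (E (Suc m) (pure (xs @ [h])))"
    unfolding extra_pure[OF w]
    by (rule sweedler_words_compose[OF module_tensor_power module_tensor_power rotation_linear, symmetric]) simp
  finally show ?thesis .
qed

lemma extra_cyclic:
  assumes t: "t \<in> carrier (T (Suc m))"
  shows "E (Suc m) (\<tau> (Suc m) t) = rotation (Suc (Suc m)) (E (Suc m) t)"
  by (rule tensor_power_ext[OF module_H module_tensor_power _ _ _ t, where f = "\<lambda>t. E (Suc m) (\<tau> (Suc m) t)"
        and g = "\<lambda>t. rotation (Suc (Suc m)) (E (Suc m) t)"])
    (use linear_maps_compose[OF extra_linear cyclic_linear_Suc] linear_maps_compose[OF rotation_linear extra_linear]
      extra_cyclic_pure in \<open>auto elim!: words_snocE\<close>)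

lemma extra_cyclic_power:
  assumes t: "t \<in> carrier (T (Suc m))"
  shows "(\<tau> (Suc m) ^^ j) t \<in> carrier (T (Suc m)) \<and>
    E (Suc m) ((\<tau> (Suc m) ^^ j) t) = (rotation (Suc (Suc m)) ^^ j) (E (Suc m) t)"
  by (induction j) (auto simp: t extra_cyclic cyclic_closed)

text \<open>A full turn applies \<open>\<theta>\<close> to the head and to every second leg. By
  \<open>counit_theta\<close> and the modular condition the zeroth face turns the head into
  \<delta>(S(as)), which undoes \<open>\<theta>\<close> on the second legs.\<close>

lemma face_zero_rotation_power_pure:
  assumes hs: "hs \<in> words H n"
  shows "D (Suc n) 0 ((rotation (Suc n) ^^ Suc n) (E n (pure hs))) = pure hs"
proof -
  have map_theta: "map \<theta> bs \<in> words H n" if "bs \<in> words H n" for bs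
    using that by (auto simp: words_def)
  have DR: "(\<lambda>t. D (Suc n) 0 ((rotation (Suc n) ^^ Suc n) t)) \<in> linear_maps k (T (Suc n)) (T n)"
    using linear_maps_compose[OF face_linear rotation_power_linear, of n 0 "Suc n"] by simp
  have "D (Suc n) 0 ((rotation (Suc n) ^^ Suc n) (E n (pure hs))) =
      sweedler_words n (T n) (\<lambda>as bs. D (Suc n) 0 ((rotation (Suc n) ^^ Suc n) (extra_word as bs))) hs"
    unfolding extra_pure[OF hs]
    by (rule sweedler_words_compose[OF module_tensor_power module_tensor_power DR]) simp
  also have "\<dots> = sweedler_words n (T n) (\<lambda>as bs. \<delta> (S (word_prod as)) \<odot>\<^bsub>T n\<^esub> pure (map \<theta> bs)) hs"
  proof (intro sweedler_words_cong refl)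
    fix as bs assume *: "as \<in> words H n" "bs \<in> words H n"
    note as = word_prod_closed[OF *(1)]
    have "(rotation (Suc n) ^^ Suc n) (extra_word as bs) = pure (map \<theta> (S\<sigma> (word_prod as) # bs))"
      using rotation_power_append[of "[]" "S\<sigma> (word_prod as) # bs" n] * as
      by (simp add: extra_word_def words_set words_length)
    then show "D (Suc n) 0 ((rotation (Suc n) ^^ Suc n) (extra_word as bs)) = \<delta> (S (word_prod as)) \<odot>\<^bsub>T n\<^esub> pure (map \<theta> bs)"
      using as words_set[OF map_theta[OF *(2)]] words_length[OF *(2)]
      by (simp add: face_zero counit_theta delta_sigma_antipode)
  qed
  also have "\<dots> = pure hs"
    by (rule sweedler_words_char_antipode_theta[OF module_tensor_power pure_multilinear hs])
  finally show ?thesis .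
qed

lemma cyclic_power_modular:
  assumes t: "t \<in> carrier (T n)"
  shows "(\<tau> n ^^ (n + 1)) t = t"
proof (cases n)
  case 0
  then show ?thesis by (simp add: cyclic_operator_def)
next
  case (Suc m)
  note t' = t[unfolded Suc]
  have "(\<tau> n ^^ (n + 1)) t = D (Suc n) 0 (E n ((\<tau> n ^^ (n + 1)) t))"
    by (rule face_zero_extra[symmetric]) (use extra_cyclic_power[OF t', of "n + 1"] Suc in simp)
  also have "\<dots> = D (Suc n) 0 ((rotation (Suc n) ^^ Suc n) (E n t))"
    using extra_cyclic_power[OF t', of "n + 1"] Suc by simp
  also have "\<dots> = t"
  proof (rule tensor_power_ext[OF module_H module_tensor_power _ _ _ t, where g = "\<lambda>t. t"
        and f = "\<lambda>t. D (Suc n) 0 ((rotation (Suc n) ^^ Suc n) (E n t))"])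
    show "(\<lambda>t. D (Suc n) 0 ((rotation (Suc n) ^^ Suc n) (E n t))) \<in> linear_maps k (T n) (T n)"
      using linear_maps_compose[OF face_linear linear_maps_compose[OF rotation_power_linear extra_linear], of n 0 "Suc n"]
      by simp
  qed (simp_all only: linear_maps_ident face_zero_rotation_power_pure)
  finally show ?thesis .
qed

lemma cyclic_module: "cyclic_module k T D Z \<tau>"
proof (intro cyclic_module.intro simplicial_module_axioms cyclic_module_axioms.intro)
qed (simp_all only: cyclic_linear_modular cyclic_power_modular face_cyclic_modular face_zero_cyclic_modular
    degeneracy_cyclic_modular degeneracy_zero_cyclic_modular)

end

end

end

theorem theorem2p1:
  fixes k :: "('k, 'a) ring_scheme"
    and H :: "('k, 'h, 'b) module_scheme"
    and \<Delta> :: "'h \<Rightarrow> ('h list \<Rightarrow> 'k) set"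
    and \<epsilon> :: "'h \<Rightarrow> 'k"
    and S :: "'h \<Rightarrow> 'h"
    and \<delta> :: "'h \<Rightarrow> 'k"
    and \<sigma> :: 'h
  assumes "hopf_algebra k H \<Delta> \<epsilon> S"
    and "character k H \<delta>"
    and "grouplike k H \<Delta> \<epsilon> \<sigma>"
  shows "(modular_pair_in_involution k H \<Delta> S \<delta> \<sigma> \<longrightarrow>
            cyclic_module k (tensor_power k H) (face k H \<epsilon> \<delta>) (degeneracy k H)
              (cyclic_operator k H \<Delta> S \<delta> \<sigma>)) \<and>
         (\<delta> \<sigma> = \<one>\<^bsub>k\<^esub> \<and>
            cyclic_module k (tensor_power k H) (face k H \<epsilon> \<delta>) (degeneracy k H)
              (cyclic_operator k H \<Delta> S \<delta> \<sigma>) \<longrightarrow>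
          modular_pair_in_involution k H \<Delta> S \<delta> \<sigma>)"
proof -
  interpret hopf_pair k H \<Delta> \<epsilon> S \<delta> \<sigma>
    by (intro hopf_pair.intro hopf_character.intro hopf_character_axioms.intro hopf_pair_axioms.intro assms)
  have "twisted (twisted h) = h"
    if "cyclic_module k T D Z \<tau>" "h \<in> carrier H" for h
    using that(2) cyclic_module.cyclic_power[OF that(1), of _ 1]
    by (intro involution_if_cyclic_power) (simp_all add: numeral_2_eq_2)
  then show ?thesis
    using cyclic_module by (auto simp: modular_pair_in_involution_def modular_pair_def)
qed

end
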